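(* Let $\{a_{lm}\}$ be the spherical harmonic coefficients of a zero-mean isotropic Gaussian field on the sphere with angular power spectrum $C_l>0$, as described in the context. Let $l_1\le l_2\le l_3$ be positive integers satisfying the triangle rule ($l_i\le l_j+l_k$ for all permutations $(i,j,k)$ of $(1,2,3)$) with $l_1+l_2+l_3$ even, and let $$I_{l_1l_2l_3}=(-1)^{(l_1+l_2+l_3)/2}\,\frac{1}{\sqrt{C_{l_1}C_{l_2}C_{l_3}}}\sum_{m_1=-l_1}^{l_1}\sum_{m_2=-l_2}^{l_2}\sum_{m_3=-l_3}^{l_3}\begin{pmatrix} l_1 & l_2 & l_3\\ m_1 & m_2 & m_3\end{pmatrix} a_{l_1m_1}a_{l_2m_2}a_{l_3m_3}.$$ Then $E I_{l_1l_2l_3}^2=\Delta_{l_1l_2l_3}$. Moreover, for each $p\in\{2,3,4\}$ there is a constant $c_p$ (independent of $l_1,l_2,l_3$) such that for all such triples $$\left|E I_{l_1l_2l_3}^{2p}-(2p-1)!!\,\Delta_{l_1l_2l_3}^p\right|\le \frac{c_p}{l_1}.$$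
   Context: The coefficients: for each integer $l\ge1$, $a_{l0}$ is real $N(0,C_l)$; for $1\le m\le l$, $a_{lm}$ is complex Gaussian with independent real and imaginary parts each $N(0,C_l/2)$; the family $\{a_{lm}: l\ge1, 0\le m\le l\}$ is independent; and $a_{l,-m}=(-1)^m\overline{a_{lm}}$. Thus $E|a_{lm}|^2=C_l$ and $E a_{lm}a_{l'm'}=(-1)^m C_l\delta_l^{l'}\delta_m^{-m'}$. The symbol $\begin{pmatrix} l_1 & l_2 & l_3\\ m_1 & m_2 & m_3\end{pmatrix}$ is the Wigner $3j$ symbol. For $l_1\le l_2\le l_3$, $\Delta_{l_1l_2l_3}=1$ if $l_1<l_2<l_3$, $=2$ if exactly two of the $l_i$ are equal, and $=6$ if $l_1=l_2=l_3$. $(2p-1)!!=(2p-1)(2p-3)\cdots1$. *)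

theory Defs
  imports "HOL-Probability.Probability"
begin

text \<open>Factorial of an integer argument (only used at nonnegative arguments).\<close>
definition ifact :: "int \<Rightarrow> real" where
  "ifact n = fact (nat n)"

text \<open>Wigner 3j symbol, via the Racah formula (integer angular momenta).\<close>
definition wigner3j :: "int \<Rightarrow> int \<Rightarrow> int \<Rightarrow> int \<Rightarrow> int \<Rightarrow> int \<Rightarrow> real" where
  "wigner3j j1 j2 j3 m1 m2 m3 =
    (if m1 + m2 + m3 = 0 \<and> \<bar>m1\<bar> \<le> j1 \<and> \<bar>m2\<bar> \<le> j2 \<and> \<bar>m3\<bar> \<le> j3
        \<and> \<bar>j1 - j2\<bar> \<le> j3 \<and> j3 \<le> j1 + j2
     then (-1) powi (j1 - j2 - m3)
          * sqrt (ifact (j1 + j2 - j3) * ifact (j1 - j2 + j3) * ifact (- j1 + j2 + j3)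
                  / ifact (j1 + j2 + j3 + 1))
          * sqrt (ifact (j1 + m1) * ifact (j1 - m1) * ifact (j2 + m2) * ifact (j2 - m2)
                  * ifact (j3 + m3) * ifact (j3 - m3))
          * (\<Sum>k \<in> {max 0 (max (j2 - j3 - m1) (j1 - j3 + m2)) ..
                      min (j1 + j2 - j3) (min (j1 - m1) (j2 + m2))}.
               (-1) powi k / (ifact k * ifact (j3 - j2 + k + m1) * ifact (j3 - j1 + k - m2)
                  * ifact (j1 + j2 - j3 - k) * ifact (j1 - k - m1) * ifact (j2 - k + m2)))
     else 0)"

definition Delta3 :: "nat \<Rightarrow> nat \<Rightarrow> nat \<Rightarrow> nat" where
  "Delta3 l1 l2 l3 = (if l1 = l2 \<and> l2 = l3 then 6 else if l1 = l2 \<or> l2 = l3 \<or> l1 = l3 then 2 else 1)"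

definition odd_dfact :: "nat \<Rightarrow> nat" where
  "odd_dfact p = (\<Prod>i\<in>{1..p}. 2 * i - 1)"

definition isotropic_gaussian_coeffs ::
    "'a measure \<Rightarrow> (nat \<Rightarrow> real) \<Rightarrow> (nat \<Rightarrow> int \<Rightarrow> 'a \<Rightarrow> complex) \<Rightarrow> bool" where
  "isotropic_gaussian_coeffs M C a \<longleftrightarrow>
     prob_space M
   \<and> (\<forall>l\<ge>1. C l > 0)
   \<and> (\<forall>l\<ge>1. (\<forall>x\<in>space M. Im (a l 0 x) = 0)
        \<and> distributed M lborel (\<lambda>x. Re (a l 0 x)) (normal_density 0 (sqrt (C l))))
   \<and> (\<forall>l\<ge>1. \<forall>m::int. 1 \<le> m \<and> m \<le> int l \<longrightarrow>
          distributed M lborel (\<lambda>x. Re (a l m x)) (normal_density 0 (sqrt (C l / 2)))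
        \<and> distributed M lborel (\<lambda>x. Im (a l m x)) (normal_density 0 (sqrt (C l / 2))))
   \<and> prob_space.indep_vars M (\<lambda>_. borel)
        (\<lambda>(l, m, b) x. if b then Re (a l m x) else Im (a l m x))
        {(l, m, b). 1 \<le> l \<and> 0 \<le> m \<and> m \<le> int l \<and> (b \<or> 1 \<le> m)}
   \<and> (\<forall>l\<ge>1. \<forall>m::int. 1 \<le> m \<and> m \<le> int l \<longrightarrow>
        (\<forall>x\<in>space M. a l (- m) x = (-1) ^ nat m * cnj (a l m x)))"

definition Ibisp :: "(nat \<Rightarrow> real) \<Rightarrow> (nat \<Rightarrow> int \<Rightarrow> 'a \<Rightarrow> complex)
    \<Rightarrow> nat \<Rightarrow> nat \<Rightarrow> nat \<Rightarrow> 'a \<Rightarrow> complex" where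
  "Ibisp C a l1 l2 l3 x =
     (-1) ^ ((l1 + l2 + l3) div 2) * complex_of_real (1 / sqrt (C l1 * C l2 * C l3)) *
     (\<Sum>m1\<in>{- int l1..int l1}. \<Sum>m2\<in>{- int l2..int l2}. \<Sum>m3\<in>{- int l3..int l3}.
        complex_of_real (wigner3j (int l1) (int l2) (int l3) m1 m2 m3)
        * a l1 m1 x * a l2 m2 x * a l3 m3 x)"

end

theory Submission
  imports Defs
begin

text \<open>
  By Wick's formula, the moment of order \<open>n\<close> is a sum over perfect pairings of the \<open>3 n\<close> half-edges of
  \<open>n\<close> trivalent vertices, each carrying a 3j symbol. A pairing that joins two half-edges of one vertex
  contributes 0, because a 3j symbol is orthogonal to the singlet. A vertex joined three times to the
  same vertex splits off a factor 1, by orthonormality and the column symmetries; such pairings produce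
  the recursion \<open>e n = (n - 1) \<Delta> e (n - 2)\<close>. For any other pairing, order the vertices
  with two neighbours first and distribute the vertices over two groups according to whether at most one
  or at least two of their edges lead backwards. Cauchy-Schwarz then bounds the contribution: every vertex
  with both backward and forward edges gains a factor \<open>1 / sqrt (2 l + 1)\<close>, and counting edges
  modulo 3 shows that there are at least two such vertices.

  The 3j identities needed are the column symmetries of the Racah sum and the ladder recursion; the latter
  shows that the row norms do not depend on \<open>m\<close>, and at the lowest \<open>m\<close> they are a Vandermonde sum.
\<close>

section \<open>Wigner 3j symbols\<close>

text \<open>The number of index assignments grows with the levels, so a pairing cannot be estimated
  by bounding its terms one by one; nor is any recoupling coefficient evaluated. The estimate rests
  on norms alone: the square sum of a 3j symbol with one index fixed is
  \<open>1 / (2 l + 1)\<close>, and two fixed indices determine the third. Cauchy-Schwarz turns one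
  gaining vertex into only the square root of such a factor; two of them give one full factor. The
  smallest level \<open>l1\<close> is the worst case, hence the rate \<open>1 / l1\<close>. The
  number \<open>Delta3\<close> counts the ways to join two vertices by three edges between legs of
  equal levels, and evenness of \<open>l1 + l2 + l3\<close> makes each of these ways count with sign
  +1. With two vertices, every pairing without a loop is a theta, which is why the second moment is
  exact. The recursion without error is solved by \<open>(2p - 1)!! * Delta3 ^ p\<close>; errors are
  passed on with factors bounded through \<open>Delta3 <= 6\<close>, so the constants depend on
  \<open>p\<close> alone.\<close>

definition ibinom :: "int \<Rightarrow> int \<Rightarrow> real" where
  "ibinom n k = (if 0 \<le> k \<and> k \<le> n then ifact n / (ifact k * ifact (n - k)) else 0)"

lemma ifact_pos [simp]: "ifact n > 0"
  by (simp add: ifact_def)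

lemma ifact_nonzero [simp]: "ifact n \<noteq> 0"
  by (simp add: ifact_def)

lemma ifact_rec: "0 < n \<Longrightarrow> ifact n = of_int n * ifact (n - 1)"
  unfolding ifact_def
  by (subst fact_reduce) (auto simp: nat_diff_distrib)

lemma ifact_Suc: "0 \<le> n \<Longrightarrow> ifact (n + 1) = (of_int n + 1) * ifact n"
  using ifact_rec[of "n + 1"] by simp

text \<open>The ends of the range are no exception: at \<open>k = n + 1\<close> the left coefficient
  vanishes, at \<open>k = 0\<close> the right one. This is what allows the Racah sums to be shifted
  freely.\<close>

lemma ibinom_absorb:
  assumes "0 \<le> n"
  shows "(of_int n - of_int k + 1) * ibinom n (k - 1) = of_int k * ibinom n k"
proof -
  consider "k \<le> 0" | "1 \<le> k" "k \<le> n" | "k = n + 1" | "k > n + 1" by linarith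
  then show ?thesis
  proof cases
    case 2
    have "n - k + 1 = n - (k - 1)" by simp
    then have "ifact (n - (k - 1)) = (of_int n - of_int k + 1) * ifact (n - k)"
      using ifact_Suc[of "n - k"] 2 by (simp add: algebra_simps)
    moreover have "ifact k = of_int k * ifact (k - 1)" using 2 ifact_rec[of k] by simp
    ultimately show ?thesis using 2 by (simp add: ibinom_def divide_simps)
  qed (auto simp: ibinom_def)
qed

lemma ibinom_symmetric: "ibinom n (n - k) = ibinom n k"
  by (simp add: ibinom_def mult.commute)

section \<open>Coefficients of the Racah polynomial\<close>

definition racah :: "int \<Rightarrow> int \<Rightarrow> int \<Rightarrow> int \<Rightarrow> int \<Rightarrow> real" where
  "racah a b c p q = (\<Sum>k\<in>{0..a}. (-1) powi k * ibinom a k * ibinom b (p - k) * ibinom c (q - k))"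

text \<open>This is the coefficient of \<open>x^p y^q\<close> in \<open>(1 - x y)^a (1 + x)^b (1 + y)^c\<close>; the recursion
  expresses a first-order differential equation of that polynomial.\<close>

lemma racah_rec:
  assumes "0 \<le> a" "0 \<le> b" "0 \<le> c"
  shows "of_int (a + b - p + 1) * racah a b c (p - 1) q + of_int (q + 1) * racah a b c p (q + 1)
       = of_int (c + p - q) * racah a b c p q"
proof -
  \<comment> \<open>The recursion holds term by term up to the error \<open>u k + v k\<close>, and
    \<open>v (k + 1) = - u k\<close>, so the errors cancel after a shift of
    \<open>k\<close>.\<close>
  define u where "u k = (-1) powi k * (of_int (a - k) * ibinom a k) * ibinom b (p - 1 - k) * ibinom c (q - k)" for k :: int
  define v where "v k = (-1) powi k * (of_int k * ibinom a k) * ibinom b (p - k) * ibinom c (q + 1 - k)" for k :: int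
  have t: "of_int (a + b - p + 1) * ((-1) powi k * ibinom a k * ibinom b (p - 1 - k) * ibinom c (q - k))
      + of_int (q + 1) * ((-1) powi k * ibinom a k * ibinom b (p - k) * ibinom c (q + 1 - k))
      = of_int (c + p - q) * ((-1) powi k * ibinom a k * ibinom b (p - k) * ibinom c (q - k)) + (u k + v k)" for k
  proof -
    have e: "p - k - 1 = p - 1 - k" "q + 1 - k - 1 = q - k" by auto
    have 1: "(of_int b - of_int (p - k) + 1) * ibinom b (p - 1 - k) = of_int (p - k) * ibinom b (p - k)"
      and 2: "(of_int c - of_int (q + 1 - k) + 1) * ibinom c (q - k) = of_int (q + 1 - k) * ibinom c (q + 1 - k)"
      using ibinom_absorb[OF assms(2), of "p - k"] ibinom_absorb[OF assms(3), of "q + 1 - k"] unfolding e .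
    have "of_int (a + b - p + 1) * ibinom b (p - 1 - k) = of_int (p - k) * ibinom b (p - k) + of_int (a - k) * ibinom b (p - 1 - k)"
      unfolding 1[symmetric] by (simp add: algebra_simps)
    moreover have "of_int (q + 1) * ibinom c (q + 1 - k) = of_int (c - q + k) * ibinom c (q - k) + of_int k * ibinom c (q + 1 - k)"
      using 2 by (simp add: algebra_simps)
    moreover have "of_int (a + b - p + 1) * (s * A * X * Y) + of_int (q + 1) * (s * A * X' * Y')
       = s * A * (of_int (a + b - p + 1) * X) * Y + s * A * X' * (of_int (q + 1) * Y')" for s A X Y X' Y' :: real
      by (simp add: algebra_simps)
    ultimately show ?thesis
      by (simp only:) (simp add: u_def v_def algebra_simps)
  qed
  have uv: "v (k + 1) = - u k" for k
  proof -
    have e: "of_int (k + 1) * ibinom a (k + 1) = of_int (a - k) * ibinom a k"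
      using ibinom_absorb[OF assms(1), of "k + 1"] by simp
    have e': "p - (k + 1) = p - 1 - k" "q + 1 - (k + 1) = q - k" by auto
    show ?thesis unfolding u_def v_def e e'
      by (simp add: power_int_add_1)
  qed
  have "(\<Sum>k\<in>{0..a}. v k) = (\<Sum>k\<in>{-1..a-1}. v (k + 1))"
    by (rule sum.reindex_bij_witness[of _ "\<lambda>k. k + 1" "\<lambda>k. k - 1"]) auto
  also have "\<dots> = - (\<Sum>k\<in>{-1..a-1}. u k)" by (simp add: uv sum_negf)
  \<comment> \<open>Both changes of the range are free: the factor \<open>a - k\<close> vanishes at
    \<open>k = a\<close>, and \<open>ibinom a (-1)\<close> is 0.\<close>
  also have "(\<Sum>k\<in>{-1..a-1}. u k) = (\<Sum>k\<in>{-1..a}. u k)"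
    by (rule sum.mono_neutral_left) (auto simp: u_def)
  also have "\<dots> = (\<Sum>k\<in>{0..a}. u k)"
    by (rule sum.mono_neutral_right) (auto simp: u_def ibinom_def)
  finally have "(\<Sum>k\<in>{0..a}. u k + v k) = 0" by (simp add: sum.distrib)
  moreover have "of_int (a + b - p + 1) * racah a b c (p - 1) q + of_int (q + 1) * racah a b c p (q + 1)
     = of_int (c + p - q) * racah a b c p q + (\<Sum>k\<in>{0..a}. u k + v k)"
    unfolding racah_def sum_distrib_left sum.distrib[symmetric] t ..
  ultimately show ?thesis by simp
qed

text \<open>The generating polynomial is reciprocal: replacing \<open>x\<close> and \<open>y\<close>
  by their inverses and clearing denominators multiplies it by \<open>(-1)^a\<close>, whence the
  parity hypothesis.\<close>

lemma racah_flip: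
  assumes "even a"
  shows "racah a b c (a + b - p) (a + c - q) = racah a b c p q"
proof -
  have "racah a b c (a + b - p) (a + c - q) =
    (\<Sum>k\<in>{0..a}. (-1) powi (a - k) * ibinom a (a - k) * ibinom b (a + b - p - (a - k)) * ibinom c (a + c - q - (a - k)))"
    unfolding racah_def by (rule sum.reindex_bij_witness[of _ "\<lambda>k. a - k" "\<lambda>k. a - k"]) auto
  also have "\<dots> = racah a b c p q"
    unfolding racah_def
  proof (rule sum.cong)
    fix k
    have "a + b - p - (a - k) = b - (p - k)" "a + c - q - (a - k) = c - (q - k)" by auto
    moreover have "(-1::real) powi (a - k) = (-1) powi k"
      using assms by (simp add: power_int_minus_one_minus power_int_minus_left)
    ultimately show "(-1) powi (a - k) * ibinom a (a - k) * ibinom b (a + b - p - (a - k)) * ibinom c (a + c - q - (a - k))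
       = (-1) powi k * ibinom a k * ibinom b (p - k) * ibinom c (q - k)"
      by (simp only: ibinom_symmetric)
  qed simp
  finally show ?thesis .
qed

lemma racah_swap12: "racah a b c p q = racah a c b q p"
  unfolding racah_def by (rule sum.cong) auto

text \<open>Substituting \<open>p - k\<close> for \<open>k\<close> exchanges the first two binomials
  and turns the sign into \<open>(-1)^p * (-1)^k\<close>; the third binomial is put back into shape
  by its symmetry.\<close>

lemma racah_swap23:
  assumes "0 \<le> a" "0 \<le> b"
  shows "racah a b c p q = (-1) powi p * racah b a c p (c + p - q)"
proof -
  have "racah a b c p q = (\<Sum>k\<in>{0..a}\<inter>{p-b..p}. (-1) powi k * ibinom a k * ibinom b (p - k) * ibinom c (q - k))"
    unfolding racah_def by (rule sum.mono_neutral_right) (auto simp: ibinom_def)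
  also have "\<dots> = (\<Sum>k\<in>{0..b}\<inter>{p-a..p}. (-1) powi (p - k) * ibinom a (p - k) * ibinom b (p - (p - k)) * ibinom c (q - (p - k)))"
    by (rule sum.reindex_bij_witness[of _ "\<lambda>k. p - k" "\<lambda>k. p - k"]) auto
  also have "\<dots> = (\<Sum>k\<in>{0..b}. (-1) powi (p - k) * ibinom a (p - k) * ibinom b (p - (p - k)) * ibinom c (q - (p - k)))"
    by (rule sum.mono_neutral_left) (auto simp: ibinom_def)
  also have "\<dots> = (-1) powi p * racah b a c p (c + p - q)"
    unfolding racah_def sum_distrib_left
  proof (rule sum.cong)
    fix k
    have "c + p - q - k = c - (q - (p - k))" by auto
    moreover have "(-1::real) powi (p - k) = (-1) powi p * (-1) powi k"
      by (simp add: power_int_diff power_int_minus_left)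
    ultimately show "(-1) powi (p - k) * ibinom a (p - k) * ibinom b (p - (p - k)) * ibinom c (q - (p - k))
       = (-1) powi p * ((-1) powi k * ibinom b k * ibinom a (p - k) * ibinom c (c + p - q - k))"
      by (simp only: ibinom_symmetric mult.assoc mult.left_commute) (simp add: mult_ac)
  qed simp
  finally show ?thesis .
qed

text \<open>In \<open>wigner3j_ladder\<close> the three alternatives are the places where raising
  the first, second or third magnetic number would leave its range.\<close>

lemma racah_zero:
  assumes "p < 0 \<or> q > a + c \<or> p - q > b"
  shows "racah a b c p q = 0"
  unfolding racah_def using assms
  by (intro sum.neutral) (auto simp: ibinom_def)

section \<open>The 3j symbol as a Racah coefficient, and its symmetries\<close>

definition w3_norm :: "int \<Rightarrow> int \<Rightarrow> int \<Rightarrow> real" where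
  "w3_norm j1 j2 j3 = sqrt (ifact (j1 + j2 - j3) * ifact (j1 - j2 + j3) * ifact (- j1 + j2 + j3)
        / ifact (j1 + j2 + j3 + 1)) / (ifact (j1 + j2 - j3) * ifact (j1 - j2 + j3) * ifact (- j1 + j2 + j3))"

definition w3_weight :: "int \<Rightarrow> int \<Rightarrow> real" where
  "w3_weight j m = sqrt (ifact (j + m) * ifact (j - m))"

definition w3_triangle :: "int \<Rightarrow> int \<Rightarrow> int \<Rightarrow> bool" where
  "w3_triangle j1 j2 j3 \<longleftrightarrow> j1 \<le> j2 + j3 \<and> j2 \<le> j1 + j3 \<and> j3 \<le> j1 + j2"

text \<open>The limits of the Racah sum are exactly the common support of the three binomials, into
  which its six reciprocal factorials pair up. The factorials inserted in the numerators are divided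
  out again in \<open>w3_norm\<close>.\<close>

lemma wigner3j_racah:
  assumes "w3_triangle j1 j2 j3"
  shows "wigner3j j1 j2 j3 m1 m2 m3 = (if m1 + m2 + m3 = 0 \<and> \<bar>m1\<bar> \<le> j1 \<and> \<bar>m2\<bar> \<le> j2 \<and> \<bar>m3\<bar> \<le> j3
    then (-1) powi (j1 - j2 - m3) * w3_norm j1 j2 j3 * (w3_weight j1 m1 * w3_weight j2 m2 * w3_weight j3 m3) *
       racah (j1 + j2 - j3) (j1 - j2 + j3) (- j1 + j2 + j3) (j1 - m1) (j2 + m2) else 0)"
proof (cases "m1 + m2 + m3 = 0 \<and> \<bar>m1\<bar> \<le> j1 \<and> \<bar>m2\<bar> \<le> j2 \<and> \<bar>m3\<bar> \<le> j3")
  case True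
  let ?A = "j1 + j2 - j3" and ?B = "j1 - j2 + j3" and ?C = "- j1 + j2 + j3"
  let ?F = "ifact ?A * ifact ?B * ifact ?C"
  have tri: "\<bar>j1 - j2\<bar> \<le> j3 \<and> j3 \<le> j1 + j2" using assms by (auto simp: w3_triangle_def)
  have "racah ?A ?B ?C (j1 - m1) (j2 + m2) = (\<Sum>k \<in> {max 0 (max (j2 - j3 - m1) (j1 - j3 + m2)) ..
                      min (j1 + j2 - j3) (min (j1 - m1) (j2 + m2))}.
       (-1) powi k * ibinom ?A k * ibinom ?B (j1 - m1 - k) * ibinom ?C (j2 + m2 - k))"
    unfolding racah_def by (rule sum.mono_neutral_right) (auto simp: ibinom_def)
  also have "\<dots> = (\<Sum>k \<in> {max 0 (max (j2 - j3 - m1) (j1 - j3 + m2)) ..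
                      min (j1 + j2 - j3) (min (j1 - m1) (j2 + m2))}. ?F *
               ((-1) powi k / (ifact k * ifact (j3 - j2 + k + m1) * ifact (j3 - j1 + k - m2)
                  * ifact (j1 + j2 - j3 - k) * ifact (j1 - k - m1) * ifact (j2 - k + m2))))"
  proof (rule sum.cong)
    fix k assume "k \<in> {max 0 (max (j2 - j3 - m1) (j1 - j3 + m2)) ..
                      min (j1 + j2 - j3) (min (j1 - m1) (j2 + m2))}"
    then have "ibinom ?A k = ifact ?A / (ifact k * ifact (?A - k))"
      "ibinom ?B (j1 - m1 - k) = ifact ?B / (ifact (j1 - m1 - k) * ifact (?B - (j1 - m1 - k)))"
      "ibinom ?C (j2 + m2 - k) = ifact ?C / (ifact (j2 + m2 - k) * ifact (?C - (j2 + m2 - k)))"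
      by (auto simp: ibinom_def)
    moreover have e: "?B - (j1 - m1 - k) = j3 - j2 + k + m1" "?C - (j2 + m2 - k) = j3 - j1 + k - m2"
       "j1 - m1 - k = j1 - k - m1" "j2 + m2 - k = j2 - k + m2" by auto
    ultimately show "(-1) powi k * ibinom ?A k * ibinom ?B (j1 - m1 - k) * ibinom ?C (j2 + m2 - k) =
       ?F * ((-1) powi k / (ifact k * ifact (j3 - j2 + k + m1) * ifact (j3 - j1 + k - m2)
                  * ifact (j1 + j2 - j3 - k) * ifact (j1 - k - m1) * ifact (j2 - k + m2)))"
      by (simp only: e) (simp add: mult_ac)
  qed simp
  finally have R: "racah ?A ?B ?C (j1 - m1) (j2 + m2) / ?F = (\<Sum>k \<in> {max 0 (max (j2 - j3 - m1) (j1 - j3 + m2)) ..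
                      min (j1 + j2 - j3) (min (j1 - m1) (j2 + m2))}.
               ((-1) powi k / (ifact k * ifact (j3 - j2 + k + m1) * ifact (j3 - j1 + k - m2)
                  * ifact (j1 + j2 - j3 - k) * ifact (j1 - k - m1) * ifact (j2 - k + m2))))"
    unfolding sum_distrib_left[symmetric] by simp
  show ?thesis unfolding wigner3j_def R[symmetric] w3_norm_def w3_weight_def using True tri
    by (simp add: real_sqrt_mult)
qed (auto simp: wigner3j_def)

lemma wigner3j_eq_0:
  assumes "\<bar>m1\<bar> > j1 \<or> \<bar>m2\<bar> > j2 \<or> \<bar>m3\<bar> > j3 \<or> m1 + m2 + m3 \<noteq> 0"
  shows "wigner3j j1 j2 j3 m1 m2 m3 = 0"
  using assms unfolding wigner3j_def by (subst if_not_P) auto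

text \<open>Reciprocity (\<open>racah_flip\<close>) followed by exchanging the roles of
  \<open>x\<close> and \<open>y\<close>. Evenness of the level sum makes \<open>j1 + j2 - j3\<close>
  even, which removes the sign of an odd column permutation.\<close>

lemma wigner3j_swap12:
  assumes "w3_triangle j1 j2 j3" "even (j1 + j2 + j3)"
  shows "wigner3j j1 j2 j3 m1 m2 m3 = wigner3j j2 j1 j3 m2 m1 m3"
proof -
  have tri: "w3_triangle j2 j1 j3" using assms by (auto simp: w3_triangle_def)
  have n: "w3_norm j1 j2 j3 = w3_norm j2 j1 j3"
    unfolding w3_norm_def by (simp add: algebra_simps)
  have "racah (j1 + j2 - j3) (j1 - j2 + j3) (- j1 + j2 + j3) (j1 - m1) (j2 + m2)
    = racah (j1 + j2 - j3) (j1 - j2 + j3) (- j1 + j2 + j3) ((j1 + j2 - j3) + (j1 - j2 + j3) - (j1 - m1))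
     ((j1 + j2 - j3) + (- j1 + j2 + j3) - (j2 + m2))"
    by (rule racah_flip[symmetric]) (use assms in auto)
  also have "\<dots> = racah (j1 + j2 - j3) (- j1 + j2 + j3) (j1 - j2 + j3) (j2 - m2) (j1 + m1)"
    by (subst racah_swap12) (simp add: algebra_simps)
  also have "\<dots> = racah (j2 + j1 - j3) (j2 - j1 + j3) (- j2 + j1 + j3) (j2 - m2) (j1 + m1)"
    by (simp add: algebra_simps)
  finally have r: "racah (j1 + j2 - j3) (j1 - j2 + j3) (- j1 + j2 + j3) (j1 - m1) (j2 + m2) = \<dots>" .
  have "even ((j1 - j2 - m3) - (j2 - j1 - m3))" by simp
  then have "(-1::real) powi (j1 - j2 - m3) = (-1) powi (j2 - j1 - m3)"
    by (auto simp: power_int_minus_left)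
  then show ?thesis
    unfolding wigner3j_racah[OF assms(1)] wigner3j_racah[OF tri] r n by (auto simp: algebra_simps)
qed

text \<open>\<open>racah_swap23\<close> contributes the sign \<open>(-1)^(j1 - m1)\<close>, which
  together with the two phase prefactors has total exponent \<open>j1 + j2 + j3\<close> modulo
  2.\<close>

lemma wigner3j_swap23:
  assumes "w3_triangle j1 j2 j3" "even (j1 + j2 + j3)"
  shows "wigner3j j1 j2 j3 m1 m2 m3 = wigner3j j1 j3 j2 m1 m3 m2"
proof (cases "m1 + m2 + m3 = 0 \<and> \<bar>m1\<bar> \<le> j1 \<and> \<bar>m2\<bar> \<le> j2 \<and> \<bar>m3\<bar> \<le> j3")
  case True
  have tri: "w3_triangle j1 j3 j2" using assms by (auto simp: w3_triangle_def)
  have n: "w3_norm j1 j2 j3 = w3_norm j1 j3 j2"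
    unfolding w3_norm_def by (simp add: algebra_simps)
  have "racah (j1 + j2 - j3) (j1 - j2 + j3) (- j1 + j2 + j3) (j1 - m1) (j2 + m2)
    = (-1) powi (j1 - m1) * racah (j1 - j2 + j3) (j1 + j2 - j3) (- j1 + j2 + j3) (j1 - m1)
     ((- j1 + j2 + j3) + (j1 - m1) - (j2 + m2))"
    by (rule racah_swap23) (use assms in \<open>auto simp: w3_triangle_def\<close>)
  also have "(- j1 + j2 + j3) + (j1 - m1) - (j2 + m2) = j3 + m3" using True by auto
  also have "racah (j1 - j2 + j3) (j1 + j2 - j3) (- j1 + j2 + j3) = racah (j1 + j3 - j2) (j1 - j3 + j2) (- j1 + j3 + j2)"
    by (simp add: algebra_simps)
  finally have r: "racah (j1 + j2 - j3) (j1 - j2 + j3) (- j1 + j2 + j3) (j1 - m1) (j2 + m2) =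
    (-1) powi (j1 - m1) * racah (j1 + j3 - j2) (j1 - j3 + j2) (- j1 + j3 + j2) (j1 - m1) (j3 + m3)" .
  have "even ((j1 - j2 - m3) + (j1 - m1) - (j1 - j3 - m2))"
  proof -
    have "(j1 - j2 - m3) + (j1 - m1) - (j1 - j3 - m2) = (j1 + j2 + j3) + 2 * (m2 - j2)" using True by simp
    then show ?thesis using assms(2) by auto
  qed
  then have "(-1::real) powi (j1 - j2 - m3) * (-1) powi (j1 - m1) = (-1) powi (j1 - j3 - m2)"
    by (auto simp: power_int_minus_left)
  then show ?thesis
    unfolding wigner3j_racah[OF assms(1)] wigner3j_racah[OF tri] r n using True by (auto simp: algebra_simps)
qed (auto simp: wigner3j_eq_0)

lemma wigner3j_neg:
  assumes "w3_triangle j1 j2 j3" "even (j1 + j2 + j3)"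
  shows "wigner3j j1 j2 j3 (- m1) (- m2) (- m3) = wigner3j j1 j2 j3 m1 m2 m3"
proof -
  have "racah (j1 + j2 - j3) (j1 - j2 + j3) (- j1 + j2 + j3) ((j1 + j2 - j3) + (j1 - j2 + j3) - (j1 - m1))
     ((j1 + j2 - j3) + (- j1 + j2 + j3) - (j2 + m2))
   = racah (j1 + j2 - j3) (j1 - j2 + j3) (- j1 + j2 + j3) (j1 - m1) (j2 + m2)"
    by (rule racah_flip) (use assms in auto)
  moreover have "(j1 + j2 - j3) + (j1 - j2 + j3) - (j1 - m1) = j1 - - m1" "(j1 + j2 - j3) + (- j1 + j2 + j3) - (j2 + m2) = j2 + - m2"
    by auto
  ultimately have r: "racah (j1 + j2 - j3) (j1 - j2 + j3) (- j1 + j2 + j3) (j1 - - m1) (j2 + - m2)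
   = racah (j1 + j2 - j3) (j1 - j2 + j3) (- j1 + j2 + j3) (j1 - m1) (j2 + m2)" by simp
  have "(-1::real) powi (j1 - j2 - - m3) = (-1) powi (j1 - j2 - m3)"
    by (auto simp: power_int_minus_left)
  moreover have "w3_weight j (- m) = w3_weight j m" for j m by (simp add: w3_weight_def mult.commute)
  moreover have "- m1 + - m2 + - m3 = 0 \<longleftrightarrow> m1 + m2 + m3 = 0" by auto
  ultimately show ?thesis
    unfolding wigner3j_racah[OF assms(1)] r by simp
qed

section \<open>Ladder relations and orthogonality\<close>

text \<open>Matrix element of the raising operator from \<open>m\<close> to \<open>m + 1\<close>. It
  vanishes at \<open>m = j\<close> and \<open>m = - j - 1\<close>, which supplies boundary
  conditions below.\<close>

definition w3_ladder :: "int \<Rightarrow> int \<Rightarrow> real" where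
  "w3_ladder j m = sqrt (of_int ((j - m) * (j + m + 1)))"

lemma w3_ladder_neg: "w3_ladder j (- m) = w3_ladder j (m - 1)"
  unfolding w3_ladder_def by (rule arg_cong[where f=sqrt], rule arg_cong[where f=of_int]) (simp add: algebra_simps)

lemma w3_ladder_weight:
  assumes "- j \<le> m" "m < j"
  shows "w3_ladder j m * w3_weight j (m + 1) = of_int (j + m + 1) * w3_weight j m"
proof -
  have 1: "ifact (j + (m + 1)) = of_int (j + m + 1) * ifact (j + m)"
    using ifact_rec[of "j + m + 1"] assms by (simp add: algebra_simps)
  have 2: "ifact (j - m) = of_int (j - m) * ifact (j - (m + 1))"
    using ifact_rec[of "j - m"] assms by (simp add: algebra_simps)
  have "w3_ladder j m * w3_weight j (m + 1) =
    sqrt (of_int ((j - m) * (j + m + 1)) * (ifact (j + (m + 1)) * ifact (j - (m + 1))))"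
    unfolding w3_ladder_def w3_weight_def real_sqrt_mult ..
  also have "of_int ((j - m) * (j + m + 1)) * (ifact (j + (m + 1)) * ifact (j - (m + 1)))
     = (of_int (j + m + 1))\<^sup>2 * (ifact (j + m) * ifact (j - m))"
    unfolding 1 2 by (simp add: power2_eq_square)
  also have "sqrt \<dots> = of_int (j + m + 1) * w3_weight j m"
    unfolding w3_weight_def real_sqrt_mult using assms by simp
  finally show ?thesis .
qed

text \<open>The 3j tensor is rotation invariant, hence annihilated by the total raising operator. In
  components this is \<open>racah_rec\<close> at \<open>p = j1 - m1\<close>,
  \<open>q = j2 + m2\<close>.\<close>

lemma wigner3j_ladder:
  assumes "w3_triangle j1 j2 j3" "m1 + m2 + m3 = -1"
  shows "w3_ladder j1 m1 * wigner3j j1 j2 j3 (m1 + 1) m2 m3 + w3_ladder j2 m2 * wigner3j j1 j2 j3 m1 (m2 + 1) m3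
     + w3_ladder j3 m3 * wigner3j j1 j2 j3 m1 m2 (m3 + 1) = 0"
proof (cases "\<bar>m1\<bar> \<le> j1 \<and> \<bar>m2\<bar> \<le> j2 \<and> \<bar>m3\<bar> \<le> j3")
  case True
  let ?A = "j1 + j2 - j3" and ?B = "j1 - j2 + j3" and ?C = "- j1 + j2 + j3"
  let ?R = "racah ?A ?B ?C"
  define K where "K = (-1) powi (j1 - j2 - m3) * w3_norm j1 j2 j3 * (w3_weight j1 m1 * w3_weight j2 m2 * w3_weight j3 m3)"
  define p q where "p = j1 - m1" and "q = j2 + m2"
  have 1: "w3_ladder j1 m1 * wigner3j j1 j2 j3 (m1 + 1) m2 m3 = K * (of_int (j1 + m1 + 1) * ?R (p - 1) q)"
  proof (cases "m1 = j1")
    case True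
    then show ?thesis by (simp add: w3_ladder_def racah_zero p_def)
  next
    case False
    have "w3_ladder j1 m1 * wigner3j j1 j2 j3 (m1 + 1) m2 m3 = (-1) powi (j1 - j2 - m3) * w3_norm j1 j2 j3 *
       ((w3_ladder j1 m1 * w3_weight j1 (m1 + 1)) * w3_weight j2 m2 * w3_weight j3 m3) * ?R (j1 - (m1 + 1)) (j2 + m2)"
      unfolding wigner3j_racah[OF assms(1)] using True False assms by auto
    also have "w3_ladder j1 m1 * w3_weight j1 (m1 + 1) = of_int (j1 + m1 + 1) * w3_weight j1 m1"
      by (rule w3_ladder_weight) (use True False in auto)
    also have "j1 - (m1 + 1) = p - 1" by (simp add: p_def)
    finally show ?thesis unfolding K_def q_def by (simp add: mult_ac)
  qed
  have 2: "w3_ladder j2 m2 * wigner3j j1 j2 j3 m1 (m2 + 1) m3 = K * (of_int (j2 + m2 + 1) * ?R p (q + 1))"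
  proof (cases "m2 = j2")
    case True
    then show ?thesis by (simp add: w3_ladder_def racah_zero q_def)
  next
    case False
    have "w3_ladder j2 m2 * wigner3j j1 j2 j3 m1 (m2 + 1) m3 = (-1) powi (j1 - j2 - m3) * w3_norm j1 j2 j3 *
       (w3_weight j1 m1 * (w3_ladder j2 m2 * w3_weight j2 (m2 + 1)) * w3_weight j3 m3) * ?R (j1 - m1) (j2 + (m2 + 1))"
      unfolding wigner3j_racah[OF assms(1)] using True False assms by auto
    also have "w3_ladder j2 m2 * w3_weight j2 (m2 + 1) = of_int (j2 + m2 + 1) * w3_weight j2 m2"
      by (rule w3_ladder_weight) (use True False in auto)
    also have "j2 + (m2 + 1) = q + 1" by (simp add: q_def)
    finally show ?thesis unfolding K_def p_def by (simp add: mult_ac)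
  qed
  \<comment> \<open>Only the third index enters the phase \<open>(-1) powi (j1 - j2 - m3)\<close>,
    so raising it produces the minus sign.\<close>
  have 3: "w3_ladder j3 m3 * wigner3j j1 j2 j3 m1 m2 (m3 + 1) = - K * (of_int (j3 + m3 + 1) * ?R p q)"
  proof (cases "m3 = j3")
    case True
    then show ?thesis using assms by (simp add: w3_ladder_def racah_zero p_def q_def)
  next
    case False
    have "w3_ladder j3 m3 * wigner3j j1 j2 j3 m1 m2 (m3 + 1) = (-1) powi (j1 - j2 - (m3 + 1)) * w3_norm j1 j2 j3 *
       (w3_weight j1 m1 * w3_weight j2 m2 * (w3_ladder j3 m3 * w3_weight j3 (m3 + 1))) * ?R (j1 - m1) (j2 + m2)"
      unfolding wigner3j_racah[OF assms(1)] using True False assms by auto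
    also have "w3_ladder j3 m3 * w3_weight j3 (m3 + 1) = of_int (j3 + m3 + 1) * w3_weight j3 m3"
      by (rule w3_ladder_weight) (use True False in auto)
    also have "(-1::real) powi (j1 - j2 - (m3 + 1)) = - ((-1) powi (j1 - j2 - m3))"
      by (auto simp: power_int_minus_left)
    finally show ?thesis unfolding K_def p_def q_def by (simp add: mult_ac)
  qed
  have "of_int (?A + ?B - p + 1) * ?R (p - 1) q + of_int (q + 1) * ?R p (q + 1) = of_int (?C + p - q) * ?R p q"
    by (rule racah_rec) (use assms in \<open>auto simp: w3_triangle_def\<close>)
  moreover have "?A + ?B - p + 1 = j1 + m1 + 1" "q + 1 = j2 + m2 + 1" "?C + p - q = j3 + m3 + 1"
    using assms by (auto simp: p_def q_def)
  ultimately have "of_int (j1 + m1 + 1) * ?R (p - 1) q + of_int (j2 + m2 + 1) * ?R p (q + 1) - of_int (j3 + m3 + 1) * ?R p q = 0"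
    by (simp only: diff_self)
  then have "K * (of_int (j1 + m1 + 1) * ?R (p - 1) q + of_int (j2 + m2 + 1) * ?R p (q + 1) - of_int (j3 + m3 + 1) * ?R p q) = 0"
    by simp
  then show ?thesis unfolding 1 2 3 distrib_left right_diff_distrib mult_minus_left by linarith
next
  case False
  \<comment> \<open>An index outside its range can enter it by raising only from
    \<open>- j - 1\<close>, where the ladder coefficient is 0.\<close>
  have L: "w3_ladder j m = 0" if "\<not> \<bar>m\<bar> \<le> j" "\<bar>m + 1\<bar> \<le> j" for j m
  proof -
    have "m = - j - 1" using that by auto
    then show ?thesis by (simp add: w3_ladder_def)
  qed
  have "w3_ladder j1 m1 * wigner3j j1 j2 j3 (m1 + 1) m2 m3 = 0"
    using False L[of m1 j1] wigner3j_eq_0[of j1 "m1 + 1" j2 m2 j3 m3] by fastforce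
  moreover have "w3_ladder j2 m2 * wigner3j j1 j2 j3 m1 (m2 + 1) m3 = 0"
    using False L[of m2 j2] wigner3j_eq_0[of j1 m1 j2 "m2 + 1" j3 m3] by fastforce
  moreover have "w3_ladder j3 m3 * wigner3j j1 j2 j3 m1 m2 (m3 + 1) = 0"
    using False L[of m3 j3] wigner3j_eq_0[of j1 m1 j2 m2 j3 "m3 + 1"] by fastforce
  ultimately show ?thesis by linarith
qed

lemma wigner3j_ladder_down:
  assumes "w3_triangle j1 j2 j3" "even (j1 + j2 + j3)" "m1 + m2 + m3 = 1"
  shows "w3_ladder j1 (m1 - 1) * wigner3j j1 j2 j3 (m1 - 1) m2 m3 + w3_ladder j2 (m2 - 1) * wigner3j j1 j2 j3 m1 (m2 - 1) m3
     + w3_ladder j3 (m3 - 1) * wigner3j j1 j2 j3 m1 m2 (m3 - 1) = 0"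
proof -
  have "- m1 + - m2 + - m3 = -1" using assms(3) by simp
  from wigner3j_ladder[OF assms(1) this]
  have "w3_ladder j1 (- m1) * wigner3j j1 j2 j3 (- (m1 - 1)) (- m2) (- m3) + w3_ladder j2 (- m2) * wigner3j j1 j2 j3 (- m1) (- (m2 - 1)) (- m3)
     + w3_ladder j3 (- m3) * wigner3j j1 j2 j3 (- m1) (- m2) (- (m3 - 1)) = 0"
    by (simp add: algebra_simps)
  then show ?thesis unfolding wigner3j_neg[OF assms(1,2)] w3_ladder_neg .
qed

text \<open>Raising and lowering are adjoint: the raising relation times the entry in row
  \<open>m3 + 1\<close>, and the lowering relation times the entry in row \<open>m3\<close>, have
  the same cross terms \<open>f\<close> and \<open>g\<close> up to a shift of \<open>m\<close>. The
  common factor \<open>w3_ladder j3 m3\<close> is nonzero because \<open>m3 < j3\<close>.\<close>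

lemma wigner3j_norm_step:
  assumes "w3_triangle j1 j2 j3" "even (j1 + j2 + j3)" "- j3 \<le> m3" "m3 < j3"
  shows "(\<Sum>m\<in>{-j1..j1}. (wigner3j j1 j2 j3 m (- m - (m3 + 1)) (m3 + 1))\<^sup>2) =
         (\<Sum>m\<in>{-j1..j1}. (wigner3j j1 j2 j3 m (- m - m3) m3)\<^sup>2)" (is "?L = ?R")
proof -
  let ?w = "wigner3j j1 j2 j3"
  define f where "f m = w3_ladder j1 m * ?w (m + 1) (- m - 1 - m3) m3 * ?w m (- m - 1 - m3) (m3 + 1)" for m
  define g where "g m = w3_ladder j2 (- m - 1 - m3) * ?w m (- m - m3) m3 * ?w m (- m - 1 - m3) (m3 + 1)" for m
  have 1: "w3_ladder j3 m3 * (?w m (- m - (m3 + 1)) (m3 + 1))\<^sup>2 = - f m - g m" for m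
  proof -
    have e: "- m - 1 - m3 + 1 = - m - m3" "- m - (m3 + 1) = - m - 1 - m3" by auto
    have "w3_ladder j3 m3 * ?w m (- m - 1 - m3) (m3 + 1) =
       - (w3_ladder j1 m * ?w (m + 1) (- m - 1 - m3) m3) - w3_ladder j2 (- m - 1 - m3) * ?w m (- m - m3) m3"
      using wigner3j_ladder[OF assms(1), of m "- m - 1 - m3" m3] unfolding e by simp
    then have "w3_ladder j3 m3 * ?w m (- m - 1 - m3) (m3 + 1) * ?w m (- m - 1 - m3) (m3 + 1) =
       (- (w3_ladder j1 m * ?w (m + 1) (- m - 1 - m3) m3) - w3_ladder j2 (- m - 1 - m3) * ?w m (- m - m3) m3) * ?w m (- m - 1 - m3) (m3 + 1)"
      by simp
    then show ?thesis unfolding f_def g_def e by (simp add: power2_eq_square algebra_simps)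
  qed
  have 2: "w3_ladder j3 m3 * (?w m (- m - m3) m3)\<^sup>2 = - f (m - 1) - g m" for m
  proof -
    have e: "- (m - 1) - 1 - m3 = - m - m3" "- m - m3 - 1 = - m - 1 - m3" "m - 1 + 1 = m" "m3 + 1 - 1 = m3" by auto
    have "w3_ladder j3 m3 * ?w m (- m - m3) m3 =
       - (w3_ladder j1 (m - 1) * ?w (m - 1) (- m - m3) (m3 + 1)) - w3_ladder j2 (- m - 1 - m3) * ?w m (- m - 1 - m3) (m3 + 1)"
      using wigner3j_ladder_down[OF assms(1,2), of m "- m - m3" "m3 + 1"] unfolding e by simp
    then have "w3_ladder j3 m3 * ?w m (- m - m3) m3 * ?w m (- m - m3) m3 =
       (- (w3_ladder j1 (m - 1) * ?w (m - 1) (- m - m3) (m3 + 1)) - w3_ladder j2 (- m - 1 - m3) * ?w m (- m - 1 - m3) (m3 + 1)) * ?w m (- m - m3) m3"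
      by simp
    then show ?thesis unfolding f_def g_def e by (simp add: power2_eq_square algebra_simps)
  qed
  \<comment> \<open>The shift costs nothing, since one of the two symbols in \<open>f\<close> is out
    of range at \<open>m = j1\<close> and at \<open>m = - j1 - 1\<close>.\<close>
  have "(\<Sum>m\<in>{-j1..j1}. f (m - 1)) = (\<Sum>m\<in>{-j1-1..j1-1}. f m)"
    by (rule sum.reindex_bij_witness[of _ "\<lambda>k. k + 1" "\<lambda>k. k - 1"]) auto
  also have "\<dots> = (\<Sum>m\<in>{-j1-1..j1}. f m)"
    by (rule sum.mono_neutral_left) (auto simp: f_def wigner3j_eq_0)
  also have "\<dots> = (\<Sum>m\<in>{-j1..j1}. f m)"
    by (rule sum.mono_neutral_right) (auto simp: f_def wigner3j_eq_0)
  finally have "(\<Sum>m\<in>{-j1..j1}. - f (m - 1) - g m) = (\<Sum>m\<in>{-j1..j1}. - f m - g m)"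
    by (simp add: sum_subtractf sum_negf)
  then have "w3_ladder j3 m3 * ?L = w3_ladder j3 m3 * ?R"
    unfolding sum_distrib_left 1 2 by simp
  moreover have "w3_ladder j3 m3 \<noteq> 0" using assms by (auto simp: w3_ladder_def)
  ultimately show ?thesis by simp
qed

text \<open>Coefficient of \<open>x^a\<close> in the product of \<open>(1 - x)^(-b-1)\<close> and
  \<open>(1 - x)^(-c-1)\<close>, obtained from Vandermonde's identity with negative upper
  arguments.\<close>

lemma sum_binomial_product:
  "(\<Sum>p\<le>a. real ((b + (a - p)) choose (a - p)) * real ((c + p) choose p)) = real ((a + b + c + 1) choose a)"
proof -
  have neg: "((- real n - 1) gchoose k) = (-1) ^ k * real ((n + k) choose k)" for n k
  proof -
    have "((- real n - 1) gchoose k) = (- (real n + 1)) gchoose k" by simp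
    also have "\<dots> = (-1) ^ k * (real n + 1 + real k - 1 gchoose k)" by (rule gbinomial_minus)
    also have "real n + 1 + real k - 1 = real (n + k)" by simp
    finally show ?thesis by (simp add: binomial_gbinomial)
  qed
  have "(\<Sum>p\<le>a. ((- real c - 1) gchoose p) * ((- real b - 1) gchoose (a - p))) = ((- real c - 1) + (- real b - 1)) gchoose a"
    using gbinomial_Vandermonde[of "- real c - 1" "- real b - 1" a] by (simp only: atLeast0AtMost)
  also have "(- real c - 1) + (- real b - 1) = - real (b + c + 1) - 1" by simp
  finally have "(\<Sum>p\<le>a. ((- real c - 1) gchoose p) * ((- real b - 1) gchoose (a - p))) = (-1) ^ a * real ((b + c + 1 + a) choose a)"
    unfolding neg .
  moreover have "(\<Sum>p\<le>a. ((- real c - 1) gchoose p) * ((- real b - 1) gchoose (a - p))) =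
     (-1) ^ a * (\<Sum>p\<le>a. real ((b + (a - p)) choose (a - p)) * real ((c + p) choose p))"
    unfolding sum_distrib_left neg
  proof (rule sum.cong)
    fix p assume "p \<in> {..a}"
    then have e: "(-1::real) ^ a = (-1) ^ p * (-1) ^ (a - p)" by (simp flip: power_add)
    show "(-1) ^ p * real ((c + p) choose p) * ((-1) ^ (a - p) * real ((b + (a - p)) choose (a - p))) =
       (-1) ^ a * (real ((b + (a - p)) choose (a - p)) * real ((c + p) choose p))"
      unfolding e by (simp add: mult_ac)
  qed simp
  ultimately show ?thesis by (simp add: algebra_simps)
qed

text \<open>At \<open>m3 = - j3\<close> the Racah sum collapses to one term, so each square is a
  multiple of a product of two binomials, which \<open>sum_binomial_product\<close> adds up.\<close>

lemma wigner3j_norm_lowest: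
  assumes "w3_triangle j1 j2 j3"
  shows "(\<Sum>m\<in>{-j1..j1}. (wigner3j j1 j2 j3 m (- m + j3) (- j3))\<^sup>2) = 1 / (2 * of_int j3 + 1)"
proof -
  define a b c where "a = nat (j1 + j2 - j3)" and "b = nat (j1 - j2 + j3)" and "c = nat (- j1 + j2 + j3)"
  have abc: "j1 + j2 - j3 = int a" "j1 - j2 + j3 = int b" "- j1 + j2 + j3 = int c"
    using assms by (auto simp: w3_triangle_def a_def b_def c_def)
  then have J: "2 * j1 = int (a + b)" "2 * j2 = int (a + c)" "2 * j3 = int (b + c)" "j1 + j2 + j3 + 1 = int (a + b + c + 1)" by auto
  have F: "ifact (int n) = fact n" for n by (simp add: ifact_def)
  let ?K = "fact (b + c) * fact a / fact (a + b + c + 1) :: real"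
  have summand: "(wigner3j j1 j2 j3 m (- m + j3) (- j3))\<^sup>2 =
     ?K * (real ((b + (a - p)) choose (a - p)) * real ((c + p) choose p))"
    if p: "p \<le> a" "m = j1 - int p" for m p
  proof -
    \<comment> \<open>The second binomial forces \<open>k <= p\<close>, the third one
      \<open>k >= p\<close>.\<close>
    have R: "racah (int a) (int b) (int c) (int p) (int c + int p) = (-1) powi (int p) * ibinom (int a) (int p)"
    proof -
      have "racah (int a) (int b) (int c) (int p) (int c + int p) =
       (\<Sum>k\<in>{int p}. (-1) powi k * ibinom (int a) k * ibinom (int b) (int p - k) * ibinom (int c) (int c + int p - k))"
        unfolding racah_def using p by (intro sum.mono_neutral_right) (auto simp: ibinom_def)
      then show ?thesis by (simp add: ibinom_def F ifact_def)
    qed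
    have e: "j1 - m = int p" "j2 + (- m + j3) = int c + int p" "j1 + m = int (a + b - p)"
      "j2 - (- m + j3) = int (a - p)"  "j3 + - j3 = int 0" "j3 - - j3 = int (b + c)" "int c + int p = int (c + p)"
      using p abc J by (auto simp: of_nat_diff)
    have r: "\<bar>m\<bar> \<le> j1 \<and> \<bar>- m + j3\<bar> \<le> j2 \<and> \<bar>- j3\<bar> \<le> j3"
      using e p J abc by linarith
    have "(wigner3j j1 j2 j3 m (- m + j3) (- j3))\<^sup>2 = (w3_norm j1 j2 j3)\<^sup>2 * ((w3_weight j1 m)\<^sup>2 * (w3_weight j2 (- m + j3))\<^sup>2 *
       (w3_weight j3 (- j3))\<^sup>2) * (racah (int a) (int b) (int c) (int p) (int c + int p))\<^sup>2"
      unfolding wigner3j_racah[OF assms] abc e(1) e(2) using r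
      by (simp add: power_mult_distrib power_int_minus_left)
    also have "(w3_norm j1 j2 j3)\<^sup>2 = 1 / (fact a * fact b * fact c * fact (a + b + c + 1))"
      unfolding w3_norm_def abc J F by (simp add: power_divide) (simp add: power2_eq_square)
    also have "(w3_weight j1 m)\<^sup>2 = fact (a + b - p) * fact p"
      unfolding w3_weight_def e F by simp
    also have "(w3_weight j2 (- m + j3))\<^sup>2 = fact (c + p) * fact (a - p)"
      unfolding w3_weight_def e F by simp
    also have "(w3_weight j3 (- j3))\<^sup>2 = fact (b + c)"
      unfolding w3_weight_def e F by simp
    also have "(racah (int a) (int b) (int c) (int p) (int c + int p))\<^sup>2 = (fact a / (fact p * fact (a - p)))\<^sup>2"
      unfolding R using p by (simp add: ibinom_def F power_mult_distrib power_divide flip: of_nat_diff power_mult)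
    also have "1 / (fact a * fact b * fact c * fact (a + b + c + 1)) * (fact (a + b - p) * fact p * (fact (c + p) * fact (a - p)) * fact (b + c)) *
       (fact a / (fact p * fact (a - p)))\<^sup>2 =
       ?K * ((fact (b + (a - p)) / (fact (a - p) * fact b)) * (fact (c + p) / (fact p * fact c)))"
    proof -
      have "a + b - p = b + (a - p)" using p by simp
      then show ?thesis by (simp add: power2_eq_square mult_ac)
    qed
    also have "fact (b + (a - p)) / (fact (a - p) * fact b) = real ((b + (a - p)) choose (a - p))"
      by (simp add: binomial_fact)
    also have "fact (c + p) / (fact p * fact c) = real ((c + p) choose p)"
      by (simp add: binomial_fact)
    finally show ?thesis .
  qed
  \<comment> \<open>For smaller \<open>m\<close> the second magnetic number \<open>j3 - m\<close>
    would exceed \<open>j2\<close>.\<close>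
  have "(\<Sum>m\<in>{-j1..j1}. (wigner3j j1 j2 j3 m (- m + j3) (- j3))\<^sup>2) = (\<Sum>m\<in>{j1 - int a..j1}. (wigner3j j1 j2 j3 m (- m + j3) (- j3))\<^sup>2)"
    using abc J by (intro sum.mono_neutral_right) (auto simp: wigner3j_eq_0)
  also have "\<dots> = (\<Sum>p\<le>a. ?K * (real ((b + (a - p)) choose (a - p)) * real ((c + p) choose p)))"
  proof (rule sum.reindex_bij_witness[of _ "\<lambda>p. j1 - int p" "\<lambda>m. nat (j1 - m)"])
    fix m assume "m \<in> {j1 - int a..j1}"
    then show "?K * (real ((b + (a - nat (j1 - m))) choose (a - nat (j1 - m))) * real ((c + nat (j1 - m)) choose nat (j1 - m)))
      = (wigner3j j1 j2 j3 m (- m + j3) (- j3))\<^sup>2"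
      by (intro summand[symmetric]) auto
  qed auto
  also have "\<dots> = ?K * real ((a + b + c + 1) choose a)"
    unfolding sum_distrib_left[symmetric] sum_binomial_product ..
  also have "real ((a + b + c + 1) choose a) = fact (a + b + c + 1) / (fact a * fact (b + c + 1))"
    by (subst binomial_fact) auto
  also have "?K * \<dots> = 1 / (real (b + c) + 1)"
    by (simp add: divide_simps)
  also have "real (b + c) = 2 * of_int j3"
    using J(3) by (metis of_int_mult of_int_numeral of_int_of_nat_eq)
  finally show ?thesis .
qed

lemma wigner3j_norm:
  assumes "w3_triangle j1 j2 j3" "even (j1 + j2 + j3)" "\<bar>m3\<bar> \<le> j3"
  shows "(\<Sum>m\<in>{-j1..j1}. (wigner3j j1 j2 j3 m (- m - m3) m3)\<^sup>2) = 1 / (2 * of_int j3 + 1)"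
proof -
  have "- j3 \<le> m3" using assms by auto
  then have "m3 \<le> j3 \<longrightarrow> ?thesis"
  proof (induction m3 rule: int_ge_induct)
    case base
    show ?case using wigner3j_norm_lowest[OF assms(1)] by simp
  next
    case (step i)
    then show ?case using wigner3j_norm_step[OF assms(1,2), of i] by auto
  qed
  then show ?thesis using assms by auto
qed

text \<open>Contracting two legs of an invariant tensor leaves an invariant vector of spin
  \<open>j3 >= 1\<close>, which must be 0. Concretely, the ladder relation that raises the third
  index from -1 to 0 makes the alternating sum telescope, and \<open>h\<close> vanishes at both
  ends.\<close>

lemma wigner3j_loop:
  assumes "w3_triangle j j j3" "even (j + j + j3)" "1 \<le> j3"
  shows "(\<Sum>m\<in>{-j..j}. (-1) powi m * wigner3j j j j3 m (- m) 0) = 0"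
proof -
  let ?w = "wigner3j j j j3"
  define h where "h m = w3_ladder j m * ?w (m + 1) (- m) (-1)" for m
  have 1: "w3_ladder j3 (-1) * ((-1) powi m * ?w m (- m) 0) = (-1) powi (m - 1) * h (m - 1) - (-1) powi m * h m" for m
  proof -
    have e: "w3_ladder j3 (-1) * ?w m (- m) 0 = - h m - h (m - 1)"
      using wigner3j_ladder[OF assms(1), of m "- m" "-1"] unfolding h_def w3_ladder_neg by (simp add: algebra_simps)
    have e': "(-1::real) powi (m - 1) = - ((-1) powi m)" by (auto simp: power_int_minus_left)
    show ?thesis unfolding e' mult.left_commute[of _ "(-1) powi m"] e by (simp add: algebra_simps)
  qed
  have h0: "h j = 0" "h (- j - 1) = 0" by (auto simp: h_def w3_ladder_def)
  have "(\<Sum>m\<in>{-j..j}. (-1) powi (m - 1) * h (m - 1)) = (\<Sum>m\<in>{-j-1..j-1}. (-1) powi m * h m)"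
    by (rule sum.reindex_bij_witness[of _ "\<lambda>k. k + 1" "\<lambda>k. k - 1"]) auto
  also have "\<dots> = (\<Sum>m\<in>{-j-1..j}. (-1) powi m * h m)"
  proof (rule sum.mono_neutral_left)
    show "\<forall>i\<in>{- j - 1..j} - {- j - 1..j - 1}. (-1) powi i * h i = 0"
    proof
      fix i assume "i \<in> {- j - 1..j} - {- j - 1..j - 1}"
      then have "i = j" by auto
      then show "(-1) powi i * h i = 0" by (simp only: h0)
    qed
  qed auto
  also have "\<dots> = (\<Sum>m\<in>{-j..j}. (-1) powi m * h m)"
  proof (rule sum.mono_neutral_right)
    show "\<forall>i\<in>{- j - 1..j} - {- j..j}. (-1) powi i * h i = 0"
    proof
      fix i assume "i \<in> {- j - 1..j} - {- j..j}"
      then have "i = - j - 1" by auto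
      then show "(-1) powi i * h i = 0" by (simp only: h0)
    qed
  qed auto
  finally have "w3_ladder j3 (-1) * (\<Sum>m\<in>{-j..j}. (-1) powi m * ?w m (- m) 0) = 0"
    unfolding sum_distrib_left 1 by (simp add: sum_subtractf)
  moreover have "w3_ladder j3 (-1) \<noteq> 0" using assms by (auto simp: w3_ladder_def)
  ultimately show ?thesis by simp
qed

section \<open>Pairings and cubic networks\<close>

lemma sum_PiE_insert:
  assumes "x \<notin> S"
  shows "(\<Sum>m\<in>PiE (insert x S) (\<lambda>_. B). F m) = (\<Sum>m\<in>PiE S (\<lambda>_. B). \<Sum>y\<in>B. F (m(x := y)))"
proof -
  have "(\<Sum>m\<in>PiE (insert x S) (\<lambda>_. B). F m) = (\<Sum>z\<in>B \<times> PiE S (\<lambda>_. B). F ((snd z)(x := fst z)))"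
    unfolding PiE_insert_eq
    by (subst sum.reindex[OF inj_combinator[OF assms, of "\<lambda>_. B"]]) (simp add: case_prod_unfold o_def)
  also have "\<dots> = (\<Sum>y\<in>B. \<Sum>m\<in>PiE S (\<lambda>_. B). F (m(x := y)))"
    by (simp add: sum.cartesian_product case_prod_unfold)
  also have "\<dots> = (\<Sum>m\<in>PiE S (\<lambda>_. B). \<Sum>y\<in>B. F (m(x := y)))" by (rule sum.swap)
  finally show ?thesis .
qed

text \<open>Sum out the coordinates in decreasing order of \<open>r\<close>: the highest one left
  occurs only in its own factor, whose sum is at most \<open>K\<close> whatever the other
  coordinates are.\<close>

lemma sum_PiE_prod_le:
  fixes r :: "'v \<Rightarrow> nat" and G :: "'v \<Rightarrow> ('v \<Rightarrow> 'b) \<Rightarrow> real"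
  assumes "finite V" "inj_on r V"
    and nonneg: "\<And>v m. 0 \<le> G v m"
    and dep: "\<And>v m x y. v \<in> V \<Longrightarrow> x \<in> V \<Longrightarrow> r v < r x \<Longrightarrow> G v (m(x := y)) = G v m"
    and bound: "\<And>v m. v \<in> V \<Longrightarrow> (\<Sum>y\<in>B. G v (m(v := y))) \<le> K v"
  shows "(\<Sum>m\<in>PiE V (\<lambda>_. B). \<Prod>v\<in>V. G v m) \<le> (\<Prod>v\<in>V. K v)"
proof -
  have K: "0 \<le> K v" if "v \<in> V" for v
    using bound[OF that, of undefined] sum_nonneg[of B "\<lambda>y. G v (undefined(v := y))"] nonneg by force
  have "S \<subseteq> V \<Longrightarrow> (\<Sum>m\<in>PiE S (\<lambda>_. B). \<Prod>v\<in>S. G v m) \<le> (\<Prod>v\<in>S. K v)" if "finite S" for S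
    using that
  proof (induction S rule: finite_ranking_induct[where f = r])
    case (insert x S)
    show ?case
    proof (cases "x \<in> S")
      case True
      then show ?thesis using insert by (simp add: insert_absorb)
    next
      case False
      have less: "r v < r x" if "v \<in> S" for v
        using insert.hyps(2)[OF that] insert.prems that False assms(2)
        by (metis inj_on_eq_iff insert_subset le_neq_implies_less subsetD)
      have "(\<Sum>m\<in>PiE (insert x S) (\<lambda>_. B). \<Prod>v\<in>insert x S. G v m)
        = (\<Sum>m\<in>PiE S (\<lambda>_. B). \<Sum>y\<in>B. \<Prod>v\<in>insert x S. G v (m(x := y)))"
        by (rule sum_PiE_insert[OF False])
      also have "\<dots> = (\<Sum>m\<in>PiE S (\<lambda>_. B). (\<Prod>v\<in>S. G v m) * (\<Sum>y\<in>B. G x (m(x := y))))"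
      proof (rule sum.cong)
        fix m
        have "(\<Prod>v\<in>S. G v (m(x := y))) = (\<Prod>v\<in>S. G v m)" for y
          using insert.prems by (intro prod.cong dep less) auto
        then have "(\<Prod>v\<in>insert x S. G v (m(x := y))) = (\<Prod>v\<in>S. G v m) * G x (m(x := y))" for y
          using insert.hyps(1) False by (simp add: mult.commute)
        then show "(\<Sum>y\<in>B. \<Prod>v\<in>insert x S. G v (m(x := y))) = (\<Prod>v\<in>S. G v m) * (\<Sum>y\<in>B. G x (m(x := y)))"
          by (simp add: sum_distrib_left)
      qed simp
      also have "\<dots> \<le> (\<Sum>m\<in>PiE S (\<lambda>_. B). (\<Prod>v\<in>S. G v m) * K x)"
        using insert.prems by (intro sum_mono mult_left_mono bound prod_nonneg nonneg) auto
      also have "\<dots> = (\<Sum>m\<in>PiE S (\<lambda>_. B). \<Prod>v\<in>S. G v m) * K x" by (simp add: sum_distrib_right)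
      also have "\<dots> \<le> (\<Prod>v\<in>S. K v) * K x"
        using insert.prems insert.IH K by (intro mult_right_mono) auto
      also have "\<dots> = (\<Prod>v\<in>insert x S. K v)" using insert.hyps(1) False by (simp add: mult.commute)
      finally show ?thesis .
    qed
  qed simp
  then show ?thesis using assms(1) by blast
qed

text \<open>Perfect matchings as fixed-point-free involutions; \<open>permutes\<close> prescribes
  the values outside \<open>H\<close>, so distinct functions are distinct matchings.\<close>

definition pairings :: "'h set \<Rightarrow> ('h \<Rightarrow> 'h) set" where
  "pairings H = {p. p permutes H \<and> (\<forall>h\<in>H. p h \<noteq> h \<and> p (p h) = h)}"

lemma pairingsD:
  assumes "p \<in> pairings H" "h \<in> H"
  shows "p h \<in> H" "p h \<noteq> h" "p (p h) = h"
  using assms permutes_in_image[of p H] by (auto simp: pairings_def)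

lemma finite_pairings: "finite H \<Longrightarrow> finite (pairings H)"
  unfolding pairings_def by (rule finite_subset[OF _ finite_permutations[of H]]) auto

lemma pairings_iff:
  "p \<in> pairings H \<longleftrightarrow> (\<forall>h. h \<notin> H \<longrightarrow> p h = h) \<and> (\<forall>h\<in>H. p h \<noteq> h \<and> p (p h) = h)"
proof -
  have "p permutes H" if "\<forall>h. h \<notin> H \<longrightarrow> p h = h" "\<forall>h\<in>H. p h \<noteq> h \<and> p (p h) = h"
  proof -
    have "p (p h) = h" for h using that by (cases "h \<in> H") auto
    then show ?thesis unfolding permutes_def using that(1) by metis
  qed
  then show ?thesis unfolding pairings_def by (auto simp: permutes_not_in)
qed

lemma pairings_outside: "p \<in> pairings H \<Longrightarrow> h \<notin> H \<Longrightarrow> p h = h"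
  by (auto simp: pairings_iff)

lemma in_lessThan_3: "i < 3 \<longleftrightarrow> i = 0 \<or> i = 1 \<or> i = (2::nat)" by auto

lemma lessThan_3: "{..<3} = {0, 1, 2::nat}" by auto

lemma third_index:
  fixes i j :: nat
  assumes "i < 3" "j < 3" "i \<noteq> j"
  obtains k where "k < 3" "k \<noteq> i" "k \<noteq> j" "{..<3} = {i, j, k}"
proof -
  have "\<exists>k<3. k \<noteq> i \<and> k \<noteq> j \<and> {..<3} = {i, j, k}"
    using assms unfolding in_lessThan_3 lessThan_3
    by (elim disjE) (simp_all, (rule exI[of _ 0] exI[of _ 1] exI[of _ 2], force)+)
  then show ?thesis using that by blast
qed

definition mbox :: "(nat \<Rightarrow> nat) \<Rightarrow> (nat \<Rightarrow> int) set" where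
  "mbox l = PiE {..<3} (\<lambda>i. {- int (l i)..int (l i)})"

lemma finite_mbox: "finite (mbox l)"
  unfolding mbox_def by (intro finite_PiE) auto

text \<open>All that the graph expansion uses of the 3j symbol: \<open>row\<close> bounds a vertex
  with a prescribed leg, \<open>total\<close> one with free legs, \<open>sym\<close> evaluates
  thetas and \<open>loop\<close> kills self-contractions. The negation in \<open>sym\<close> is
  there because paired half-edges carry opposite indices.\<close>

locale cubic_network =
  fixes l :: "nat \<Rightarrow> nat" and T :: "(nat \<Rightarrow> int) \<Rightarrow> real" and g :: real
  assumes support: "\<And>m. m \<in> mbox l \<Longrightarrow> T m \<noteq> 0 \<Longrightarrow> m 0 + m 1 + m 2 = 0"
    and row: "\<And>i \<mu>. i < 3 \<Longrightarrow> (\<Sum>m\<in>{m\<in>mbox l. m i = \<mu>}. (T m)\<^sup>2) \<le> g"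
    and total: "(\<Sum>m\<in>mbox l. (T m)\<^sup>2) = 1"
    and g: "0 \<le> g" "g \<le> 1"
    and sym: "\<And>\<sigma> m. \<sigma> permutes {..<3} \<Longrightarrow> \<forall>i<3. l (\<sigma> i) = l i \<Longrightarrow> m \<in> mbox l \<Longrightarrow>
        T (\<lambda>i\<in>{..<3}. - m (\<sigma> i)) = T m"
    and loop: "\<And>i j k \<mu>. {..<3} = {i, j, k} \<Longrightarrow> i \<noteq> j \<Longrightarrow> k \<noteq> i \<Longrightarrow> k \<noteq> j \<Longrightarrow> l i = l j \<Longrightarrow>
        (\<Sum>m\<in>{m\<in>mbox l. m i = - m j \<and> m k = \<mu>}. T m) = 0"
begin

abbreviation "Box \<equiv> mbox l"

text \<open>Stands in for \<open>T\<close> at the vertices whose \<open>T\<close> goes into the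
  other Cauchy-Schwarz factor; with two legs prescribed it leaves at most one triple.\<close>

definition supp :: "(nat \<Rightarrow> int) \<Rightarrow> real" where
  "supp y = of_bool (y 0 + y 1 + y 2 = 0)"

definition edge_weight :: "('v \<Rightarrow> nat \<Rightarrow> int) \<Rightarrow> 'v \<times> nat \<Rightarrow> 'v \<times> nat \<Rightarrow> real" where
  "edge_weight m h h' = of_bool (l (snd h) = l (snd h') \<and> m (fst h) (snd h) = - m (fst h') (snd h'))"

text \<open>The product over half-edges meets every edge from both ends, which is harmless because
  \<open>edge_weight\<close> is symmetric with values 0 and 1.\<close>

definition val :: "'v set \<Rightarrow> ('v \<times> nat \<Rightarrow> 'v \<times> nat) \<Rightarrow> real" where
  "val V p = (\<Sum>m\<in>PiE V (\<lambda>_. Box). (\<Prod>v\<in>V. T (m v)) * (\<Prod>h\<in>V \<times> {..<3}. edge_weight m h (p h)))"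

definition Z :: "'v set \<Rightarrow> real" where
  "Z V = (\<Sum>p\<in>pairings (V \<times> {..<3}). val V p)"

lemma edge_weight_range: "0 \<le> edge_weight m h h'" "edge_weight m h h' \<le> 1"
  by (auto simp: edge_weight_def)

lemma supp_determined:
  fixes y y' :: "nat \<Rightarrow> int"
  assumes "y \<in> Box" "y' \<in> Box" "i < 3" "j < 3" "i \<noteq> j" "y i = y' i" "y j = y' j"
    "y 0 + y 1 + y 2 = 0" "y' 0 + y' 1 + y' 2 = 0"
  shows "y = y'"
proof (rule PiE_ext[OF assms(1,2)[unfolded mbox_def]])
  fix n :: nat assume "n \<in> {..<3}"
  then have "n = 0 \<or> n = 1 \<or> n = 2" by auto
  moreover have "i = 0 \<or> i = 1 \<or> i = 2" "j = 0 \<or> j = 1 \<or> j = 2" using assms(3,4) by auto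
  ultimately show "y n = y' n" using assms(5-) by (elim disjE) simp_all
qed

text \<open>Charge each edge to its later end and sum the vertices from the last to the first. A
  vertex with \<open>Q\<close> costs \<open>g\<close> by \<open>row\<close> if some edge leads
  backward, otherwise 1 by \<open>total\<close>; a vertex without \<open>Q\<close> has two legs
  prescribed and hence at most one admissible triple.\<close>

lemma val_weighted_bound:
  fixes V :: "'v set" and r :: "'v \<Rightarrow> nat"
  defines "In \<equiv> \<lambda>p v. {i\<in>{..<3}. r (fst (p (v, i))) < r v}"
  assumes V: "finite V" "inj_on r V" and p: "p \<in> pairings (V \<times> {..<3})"
    and Q: "\<And>v. v \<in> V \<Longrightarrow> \<not> Q v \<Longrightarrow> 2 \<le> card (In p v)"
  shows "(\<Sum>m\<in>PiE V (\<lambda>_. Box). (\<Prod>v\<in>V. if Q v then (T (m v))\<^sup>2 else supp (m v)) * (\<Prod>h\<in>V \<times> {..<3}. edge_weight m h (p h)))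
     \<le> (\<Prod>v\<in>V. if Q v \<and> In p v \<noteq> {} then g else 1)"
proof -
  define G where "G v m = (if Q v then (T (m v))\<^sup>2 else supp (m v)) * (\<Prod>i\<in>In p v. edge_weight m (v, i) (p (v, i)))" for v m
  have fin: "finite (In p v)" for v unfolding In_def by auto
  have G0: "0 \<le> G v m" for v m
    unfolding G_def by (intro mult_nonneg_nonneg prod_nonneg) (auto simp: edge_weight_def supp_def)
  have "(\<Sum>m\<in>PiE V (\<lambda>_. Box). (\<Prod>v\<in>V. if Q v then (T (m v))\<^sup>2 else supp (m v)) * (\<Prod>h\<in>V \<times> {..<3}. edge_weight m h (p h)))
     \<le> (\<Sum>m\<in>PiE V (\<lambda>_. Box). \<Prod>v\<in>V. G v m)"
  proof (rule sum_mono)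
    fix m
    have "(\<Prod>h\<in>V \<times> {..<3}. edge_weight m h (p h)) = (\<Prod>v\<in>V. \<Prod>i<3. edge_weight m (v, i) (p (v, i)))"
      by (simp add: prod.cartesian_product case_prod_unfold)
    \<comment> \<open>Dropping the factors of the other half-edges, all at most 1, leaves for each
      vertex a factor that depends on it and on earlier vertices only.\<close>
    also have "\<dots> \<le> (\<Prod>v\<in>V. \<Prod>i\<in>In p v. edge_weight m (v, i) (p (v, i)))"
    proof (intro prod_mono conjI prod_nonneg edge_weight_range)
      fix v
      have "(\<Prod>i<3. edge_weight m (v, i) (p (v, i))) = (\<Prod>i\<in>{..<3} - In p v. edge_weight m (v, i) (p (v, i))) * (\<Prod>i\<in>In p v. edge_weight m (v, i) (p (v, i)))"
        by (rule prod.subset_diff) (auto simp: In_def)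
      also have "\<dots> \<le> 1 * (\<Prod>i\<in>In p v. edge_weight m (v, i) (p (v, i)))"
        by (intro mult_right_mono prod_le_1 prod_nonneg) (auto simp: edge_weight_range)
      finally show "(\<Prod>i<3. edge_weight m (v, i) (p (v, i))) \<le> (\<Prod>i\<in>In p v. edge_weight m (v, i) (p (v, i)))" by simp
    qed
    finally have "(\<Prod>v\<in>V. if Q v then (T (m v))\<^sup>2 else supp (m v)) * (\<Prod>h\<in>V \<times> {..<3}. edge_weight m h (p h)) \<le>
      (\<Prod>v\<in>V. if Q v then (T (m v))\<^sup>2 else supp (m v)) * (\<Prod>v\<in>V. \<Prod>i\<in>In p v. edge_weight m (v, i) (p (v, i)))"
      by (intro mult_left_mono prod_nonneg) (auto simp: supp_def)
    also have "\<dots> = (\<Prod>v\<in>V. G v m)" by (simp add: G_def prod.distrib)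
    finally show "(\<Prod>v\<in>V. if Q v then (T (m v))\<^sup>2 else supp (m v)) * (\<Prod>h\<in>V \<times> {..<3}. edge_weight m h (p h)) \<le> (\<Prod>v\<in>V. G v m)" .
  qed
  also have "\<dots> \<le> (\<Prod>v\<in>V. if Q v \<and> In p v \<noteq> {} then g else 1)"
  proof (rule sum_PiE_prod_le[OF V G0])
    fix v m x y assume vx: "v \<in> V" "x \<in> V" "r v < r x"
    have "edge_weight (m(x := y)) (v, i) (p (v, i)) = edge_weight m (v, i) (p (v, i))" if "i \<in> In p v" for i
    proof -
      have "r (fst (p (v, i))) < r x" using that vx by (auto simp: In_def)
      then have "fst (p (v, i)) \<noteq> x" by auto
      then show ?thesis using vx by (auto simp: edge_weight_def)
    qed
    then show "G v (m(x := y)) = G v m" using vx by (auto simp: G_def)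
  next
    fix v and m :: "'v \<Rightarrow> nat \<Rightarrow> int" assume v: "v \<in> V"
    \<comment> \<open>The value that an earlier neighbour imposes on leg \<open>i\<close>; changing
      the label of \<open>v\<close> does not affect it.\<close>
    define \<mu> where "\<mu> i = - m (fst (p (v, i))) (snd (p (v, i)))" for i
    have cwle: "edge_weight (m(v := y)) (v, i) (p (v, i)) \<le> of_bool (y i = \<mu> i)" if "i \<in> In p v" for i y
    proof -
      have "fst (p (v, i)) \<noteq> v" using that by (auto simp: In_def)
      then show ?thesis by (auto simp: edge_weight_def \<mu>_def)
    qed
    have prodle: "(\<Prod>i\<in>In p v. edge_weight (m(v := y)) (v, i) (p (v, i))) \<le> (\<Prod>i\<in>I. of_bool (y i = \<mu> i))"
      if "I \<subseteq> In p v" for I y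
    proof -
      have "(\<Prod>i\<in>In p v. edge_weight (m(v := y)) (v, i) (p (v, i))) =
        (\<Prod>i\<in>In p v - I. edge_weight (m(v := y)) (v, i) (p (v, i))) * (\<Prod>i\<in>I. edge_weight (m(v := y)) (v, i) (p (v, i)))"
        by (rule prod.subset_diff[OF that fin])
      also have "\<dots> \<le> 1 * (\<Prod>i\<in>I. of_bool (y i = \<mu> i))"
        using that by (intro mult_mono prod_le_1 prod_mono prod_nonneg conjI cwle) (auto simp: edge_weight_range)
      finally show ?thesis by simp
    qed
    consider "Q v" "In p v \<noteq> {}" | "Q v" "In p v = {}" | "\<not> Q v" by blast
    then show "(\<Sum>y\<in>Box. G v (m(v := y))) \<le> (if Q v \<and> In p v \<noteq> {} then g else 1)"
    proof cases
      case 1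
      then obtain i where i: "i \<in> In p v" by auto
      have "(\<Sum>y\<in>Box. G v (m(v := y))) \<le> (\<Sum>y\<in>Box. (T y)\<^sup>2 * of_bool (y i = \<mu> i))"
      proof (rule sum_mono)
        fix y
        have "G v (m(v := y)) = (T y)\<^sup>2 * (\<Prod>i\<in>In p v. edge_weight (m(v := y)) (v, i) (p (v, i)))"
          using 1 by (simp add: G_def)
        also have "\<dots> \<le> (T y)\<^sup>2 * of_bool (y i = \<mu> i)"
          using prodle[of "{i}" y] i by (intro mult_left_mono) simp_all
        finally show "G v (m(v := y)) \<le> (T y)\<^sup>2 * of_bool (y i = \<mu> i)" .
      qed
      also have "\<dots> = (\<Sum>y\<in>{y\<in>Box. y i = \<mu> i}. (T y)\<^sup>2)"
        by (simp add: sum.inter_filter[OF finite_mbox] if_distrib of_bool_def cong: if_cong)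
      also have "\<dots> \<le> g" using i by (intro row) (auto simp: In_def)
      finally show ?thesis using 1 by simp
    next
      case 2
      then show ?thesis using total by (simp add: G_def)
    next
      case 3
      then obtain S where S: "S \<subseteq> In p v" "card S = 2" using Q[OF v] by (meson obtain_subset_with_card_n)
      then obtain i j where ij: "S = {i, j}" "i \<noteq> j" by (auto simp: card_2_iff)
      have "(\<Sum>y\<in>Box. G v (m(v := y))) \<le> (\<Sum>y\<in>Box. supp y * (of_bool (y i = \<mu> i) * of_bool (y j = \<mu> j)))"
        using prodle[OF S(1)] ij 3 by (intro sum_mono) (auto simp: G_def supp_def)
      also have "\<dots> = (\<Sum>y\<in>{y\<in>Box. y 0 + y 1 + y 2 = 0 \<and> y i = \<mu> i \<and> y j = \<mu> j}. 1)"
        unfolding sum.inter_filter[OF finite_mbox] by (intro sum.cong) (auto simp: supp_def)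
      also have "\<dots> \<le> 1"
      proof -
        have "card {y\<in>Box. y 0 + y 1 + y 2 = 0 \<and> y i = \<mu> i \<and> y j = \<mu> j} \<le> Suc 0"
        proof (subst card_le_Suc0_iff_eq)
          show "\<forall>y\<in>{y \<in> Box. y 0 + y 1 + y 2 = 0 \<and> y i = \<mu> i \<and> y j = \<mu> j}.
             \<forall>y'\<in>{y \<in> Box. y 0 + y 1 + y 2 = 0 \<and> y i = \<mu> i \<and> y j = \<mu> j}. y = y'"
            using S(1) ij by (auto simp: In_def intro!: supp_determined[of _ _ i j])
        qed (simp add: finite_mbox)
        then show ?thesis by simp
      qed
      finally show ?thesis using 3 by simp
    qed
  qed
  finally show ?thesis .
qed

text \<open>In the Cauchy-Schwarz split, vertices with at most one backward edge keep
  \<open>T\<close> in the factor \<open>A\<close>, the others in \<open>B\<close>, with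
  \<open>supp\<close> in the complementary factor. \<open>A\<close> is summed in the order
  \<open>r\<close> and \<open>B\<close> in the reversed order \<open>r'\<close>. Each vertex of
  \<open>D\<close> then yields one \<open>g\<close>, so the square of the value is at most
  \<open>g ^ card D\<close>.\<close>

lemma val_loopless_bound:
  fixes V :: "nat set"
  assumes V: "finite V" and p: "p \<in> pairings (V \<times> {..<3})"
    and loopless: "\<And>h. h \<in> V \<times> {..<3} \<Longrightarrow> fst (p h) \<noteq> fst h"
    and v: "v \<in> V" and not_theta: "\<not> (\<exists>w. \<forall>i<3. fst (p (v, i)) = w)"
  shows "\<bar>val V p\<bar> \<le> g"
proof -
  let ?H = "V \<times> {..<3::nat}"
  define w where "w = fst (p (v, 0))"
  have w: "w \<in> V" "w \<noteq> v" "p (v, 0) \<in> ?H"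
    using pairingsD(1)[OF p, of "(v, 0)"] loopless[of "(v, 0)"] v by (auto simp: w_def)
  \<comment> \<open>All backward edges of \<open>w\<close> lead to \<open>v\<close>, so there are one or two of them.\<close>
  define r :: "nat \<Rightarrow> nat" where "r u = (if u = v then 0 else if u = w then 1 else u + 2)" for u
  have r: "inj_on r V" by (auto simp: inj_on_def r_def split: if_splits)
  define N where "N = Max (r ` V)"
  have N: "r u \<le> N" if "u \<in> V" for u using V that by (simp add: N_def)
  \<comment> \<open>Reversal exchanges backward and forward edges, so a vertex with at most one
    backward edge for \<open>r\<close> has at least two for \<open>r'\<close>, as
    \<open>val_weighted_bound\<close> requires of vertices that carry only
    \<open>supp\<close>.\<close>
  define r' where "r' u = N - r u" for u
  have r': "inj_on r' V"
  proof (rule inj_onI)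
    fix x y assume xy: "x \<in> V" "y \<in> V" "r' x = r' y"
    then have "r x = r y" using N[of x] N[of y] by (simp add: r'_def)
    then show "x = y" using r xy by (simp add: inj_on_def)
  qed
  define In where "In u = {i\<in>{..<3}. r (fst (p (u, i))) < r u}" for u
  have pV: "fst (p (u, i)) \<in> V" if "u \<in> V" "i < 3" for u i
    using pairingsD(1)[OF p, of "(u, i)"] that by auto
  have neq: "r (fst (p (u, i))) \<noteq> r u" if "u \<in> V" "i < 3" for u i
    using loopless[of "(u, i)"] that pV[OF that] r by (auto simp: inj_on_def)
  have In': "{i\<in>{..<3}. r' (fst (p (u, i))) < r' u} = {..<3} - In u" if u: "u \<in> V" for u
    using neq[OF u] N pV[OF u] N[OF u] unfolding In_def r'_def by (fastforce simp: not_less)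
  have fin: "finite (In u)" and sub: "In u \<subseteq> {..<3}" for u by (auto simp: In_def)
  have card_In: "card (In u) \<le> 3" for u using card_mono[OF _ sub[of u]] by simp
  have card_Out: "card ({..<3} - In u) = 3 - card (In u)" for u using sub by (simp add: card_Diff_subset fin)
  \<comment> \<open>The vertices with both a backward and a forward edge; these are the ones that
    gain a factor.\<close>
  define D where "D = {u\<in>V. card (In u) = 1 \<or> card (In u) = 2}"
  have wD: "w \<in> D"
  proof -
    obtain j where j: "p (v, 0) = (w, j)" "j < 3" using w by (cases "p (v, 0)") (auto simp: w_def)
    have pj: "p (w, j) = (v, 0)" using pairingsD(3)[OF p, of "(v, 0)"] v j by simp
    have "j \<in> In w" using j pj w by (auto simp: In_def r_def)
    then have "card (In w) \<noteq> 0" using fin by auto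
    \<comment> \<open>If all three edges of \<open>w\<close> led back to \<open>v\<close>, they
      would use up the three legs of \<open>v\<close> and form a theta.\<close>
    moreover have "card (In w) \<noteq> 3"
    proof
      assume "card (In w) = 3"
      then have "In w = {..<3}" using card_subset_eq[OF _ sub[of w]] by simp
      then have all: "fst (p (w, i)) = v" if "i < 3" for i
        using that w by (auto simp: In_def r_def split: if_splits)
      have inj: "inj_on p (Pair w ` {..<3})"
        using p permutes_inj by (force simp: pairings_def intro: inj_on_subset)
      have "p ` Pair w ` {..<3} = Pair v ` {..<3}"
      proof (rule card_subset_eq)
        show "p ` Pair w ` {..<3} \<subseteq> Pair v ` {..<3}"
        proof
          fix h assume "h \<in> p ` Pair w ` {..<3}"
          then obtain i where i: "i < 3" "h = p (w, i)" by auto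
          then show "h \<in> Pair v ` {..<3}"
            using all[OF i(1)] pairingsD(1)[OF p, of "(w, i)"] w by (cases "p (w, i)") auto
        qed
        show "card (p ` Pair w ` {..<3}) = card (Pair v ` {..<3::nat})"
          by (subst card_image[OF inj]) (simp add: card_image inj_on_def)
      qed simp
      then have "\<exists>k<3. p (w, k) = (v, i)" if "i < 3" for i
      proof -
        have "(v, i) \<in> p ` Pair w ` {..<3}" using that \<open>p ` Pair w ` {..<3} = Pair v ` {..<3}\<close> by auto
        then show ?thesis by auto
      qed
      then have "fst (p (v, i)) = w" if "i < 3" for i
        using that pairingsD(3)[OF p] w by (metis SigmaI fst_conv lessThan_iff)
      then show False using not_theta by blast
    qed
    ultimately show ?thesis using card_In[of w] w unfolding D_def by auto
  qed
  \<comment> \<open>Every edge leads backward from exactly one of its ends, so \<open>p\<close>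
    exchanges backward and forward half-edges.\<close>
  have "(\<Sum>u\<in>V. card (In u)) = (\<Sum>u\<in>V. card ({..<3} - In u))"
  proof -
    have "card (SIGMA u:V. In u) = card (SIGMA u:V. {..<3} - In u)"
    proof (rule bij_betw_same_card)
      show "bij_betw p (SIGMA u:V. In u) (SIGMA u:V. {..<3} - In u)"
      proof (rule bij_betw_byWitness[where f' = p])
        show "\<forall>h\<in>SIGMA u:V. In u. p (p h) = h" "\<forall>h\<in>SIGMA u:V. {..<3} - In u. p (p h) = h"
          using pairingsD(3)[OF p] by (auto simp: In_def)
        show "p ` (SIGMA u:V. In u) \<subseteq> (SIGMA u:V. {..<3} - In u)"
        proof
          fix h assume "h \<in> p ` (SIGMA u:V. In u)"
          then obtain u i where u: "u \<in> V" "i \<in> In u" and h: "h = p (u, i)" by auto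
          obtain u' i' where e: "p (u, i) = (u', i')" by force
          then have "p (u', i') = (u, i)" "u' \<in> V" "i' < 3"
            using pairingsD[OF p, of "(u, i)"] u by (auto simp: In_def)
          then show "h \<in> (SIGMA u:V. {..<3} - In u)" using u e h by (auto simp: In_def)
        qed
        show "p ` (SIGMA u:V. {..<3} - In u) \<subseteq> (SIGMA u:V. In u)"
        proof
          fix h assume "h \<in> p ` (SIGMA u:V. {..<3} - In u)"
          then obtain u i where u: "u \<in> V" "i < 3" "i \<notin> In u" and h: "h = p (u, i)" by auto
          obtain u' i' where e: "p (u, i) = (u', i')" by force
          then have "p (u', i') = (u, i)" "u' \<in> V" "i' < 3"
            using pairingsD[OF p, of "(u, i)"] u by (auto simp: In_def)
          then show "h \<in> (SIGMA u:V. In u)" using u e h neq[OF u(1,2)] by (auto simp: In_def)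
        qed
      qed
    qed
    then show ?thesis using V fin by simp
  qed
  then have "(\<Sum>u\<in>V. int (card (In u))) = (\<Sum>u\<in>V. int (3 - card (In u)))"
    unfolding card_Out of_nat_sum[symmetric] by simp
  also have "\<dots> = (\<Sum>u\<in>V. 3 - int (card (In u)))"
    using card_In by (intro sum.cong) (auto simp: of_nat_diff)
  finally have "(\<Sum>u\<in>V. int (card (In u))) = (\<Sum>u\<in>V. 3 - int (card (In u)))" .
  \<comment> \<open>Modulo 3, only the vertices in \<open>D\<close> contribute to this sum, and a single one cannot cancel.\<close>
  then have shake: "(\<Sum>u\<in>V. 2 * int (card (In u)) - 3) = 0"
    by (simp add: sum_subtractf flip: sum_distrib_left)
  have finD: "finite D" using V by (simp add: D_def)
  have cD: "2 \<le> card D"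
  proof (rule ccontr)
    assume "\<not> 2 \<le> card D"
    then have "card D = 1" using card_gt_0_iff[of D] wD finD by fastforce
    then have D: "D = {w}" using wD by (auto simp: card_1_singleton_iff)
    have "3 dvd (\<Sum>u\<in>V - {w}. 2 * int (card (In u)) - 3)"
    proof (rule dvd_sum)
      fix u assume "u \<in> V - {w}"
      then have "u \<notin> D" "u \<in> V" using D by auto
      then have "card (In u) = 0 \<or> card (In u) = 3" using card_In[of u] unfolding D_def by auto
      then show "3 dvd 2 * int (card (In u)) - 3" by auto
    qed
    moreover have "(\<Sum>u\<in>V. 2 * int (card (In u)) - 3) = (2 * int (card (In w)) - 3) + (\<Sum>u\<in>V - {w}. 2 * int (card (In u)) - 3)"
      using V w by (simp add: sum.remove)
    ultimately have "3 dvd 2 * int (card (In w)) - 3" using shake by presburger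
    then show False using wD unfolding D_def by auto
  qed
  define Q where "Q u \<longleftrightarrow> card (In u) \<le> 1" for u
  define W where "W m = (\<Prod>h\<in>?H. edge_weight m h (p h))" for m
  define A where "A m = (\<Prod>u\<in>V. if Q u then \<bar>T (m u)\<bar> else supp (m u))" for m
  define B where "B m = (\<Prod>u\<in>V. if \<not> Q u then \<bar>T (m u)\<bar> else supp (m u))" for m
  \<comment> \<open>Idempotence allows the full edge weight to be placed in both Cauchy-Schwarz
    factors.\<close>
  have W: "0 \<le> W m" "(W m)\<^sup>2 = W m" for m
  proof -
    show "0 \<le> W m" unfolding W_def by (intro prod_nonneg) (auto simp: edge_weight_range)
    have "(edge_weight m h h')\<^sup>2 = edge_weight m h h'" for h h' by (simp add: edge_weight_def)
    then show "(W m)\<^sup>2 = W m" unfolding W_def by (simp add: prod_power_distrib)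
  qed
  have supp_sq: "(supp y)\<^sup>2 = supp y" for y by (simp add: supp_def)
  have "\<bar>val V p\<bar> \<le> (\<Sum>m\<in>PiE V (\<lambda>_. Box). (A m * W m) * (B m * W m))"
    unfolding val_def
  proof (rule order_trans[OF sum_abs], rule sum_mono)
    fix m assume m: "m \<in> PiE V (\<lambda>_. Box)"
    have "(\<Prod>u\<in>V. \<bar>T (m u)\<bar>) = A m * B m"
      unfolding A_def B_def prod.distrib[symmetric]
    proof (rule prod.cong)
      fix u assume "u \<in> V"
      then have "m u \<in> Box" using m by auto
      then show "\<bar>T (m u)\<bar> = (if Q u then \<bar>T (m u)\<bar> else supp (m u)) * (if \<not> Q u then \<bar>T (m u)\<bar> else supp (m u))"
        using support[of "m u"] by (auto simp: supp_def)
    qed simp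
    then have "\<bar>(\<Prod>u\<in>V. T (m u)) * (\<Prod>h\<in>?H. edge_weight m h (p h))\<bar> = A m * B m * W m"
      by (simp add: abs_mult abs_prod W_def edge_weight_range)
    also have "\<dots> = (A m * W m) * (B m * W m)"
      by (subst W(2)[symmetric]) (simp add: power2_eq_square mult_ac)
    finally show "\<bar>(\<Prod>u\<in>V. T (m u)) * (\<Prod>h\<in>?H. edge_weight m h (p h))\<bar> \<le> (A m * W m) * (B m * W m)" by simp
  qed
  then have "(val V p)\<^sup>2 \<le> (\<Sum>m\<in>PiE V (\<lambda>_. Box). (A m * W m) * (B m * W m))\<^sup>2"
    using power_mono[of "\<bar>val V p\<bar>" _ 2] by fastforce
  also have "\<dots> \<le> (\<Sum>m\<in>PiE V (\<lambda>_. Box). (A m * W m)\<^sup>2) * (\<Sum>m\<in>PiE V (\<lambda>_. Box). (B m * W m)\<^sup>2)"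
    by (rule Cauchy_Schwarz_ineq_sum)
  also have "\<dots> \<le> (\<Prod>u\<in>V. if Q u \<and> In u \<noteq> {} then g else 1) * (\<Prod>u\<in>V. if \<not> Q u \<and> {..<3} - In u \<noteq> {} then g else 1)"
  proof (intro mult_mono sum_nonneg prod_nonneg)
    have "(\<Sum>m\<in>PiE V (\<lambda>_. Box). (A m * W m)\<^sup>2) = (\<Sum>m\<in>PiE V (\<lambda>_. Box). (\<Prod>u\<in>V. if Q u then (T (m u))\<^sup>2 else supp (m u)) * (\<Prod>h\<in>?H. edge_weight m h (p h)))"
      unfolding power_mult_distrib W(2) A_def prod_power_distrib by (simp add: W_def if_distrib[of "\<lambda>x. x\<^sup>2"] supp_sq cong: if_cong)
    also have "\<dots> \<le> (\<Prod>u\<in>V. if Q u \<and> In u \<noteq> {} then g else 1)"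
      unfolding In_def by (rule val_weighted_bound[OF V r p]) (auto simp: Q_def In_def)
    finally show "(\<Sum>m\<in>PiE V (\<lambda>_. Box). (A m * W m)\<^sup>2) \<le> (\<Prod>u\<in>V. if Q u \<and> In u \<noteq> {} then g else 1)" .
    have "(\<Sum>m\<in>PiE V (\<lambda>_. Box). (B m * W m)\<^sup>2) = (\<Sum>m\<in>PiE V (\<lambda>_. Box). (\<Prod>u\<in>V. if \<not> Q u then (T (m u))\<^sup>2 else supp (m u)) * (\<Prod>h\<in>?H. edge_weight m h (p h)))"
      unfolding power_mult_distrib W(2) B_def prod_power_distrib by (simp add: W_def if_distrib[of "\<lambda>x. x\<^sup>2"] supp_sq cong: if_cong)
    also have "\<dots> \<le> (\<Prod>u\<in>V. if \<not> Q u \<and> {i\<in>{..<3}. r' (fst (p (u, i))) < r' u} \<noteq> {} then g else 1)"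
    proof (rule val_weighted_bound[OF V r' p])
      fix u assume "u \<in> V" "\<not> \<not> Q u"
      then show "2 \<le> card {i\<in>{..<3}. r' (fst (p (u, i))) < r' u}"
        unfolding In'[OF \<open>u \<in> V\<close>] card_Out by (simp add: Q_def)
    qed
    also have "\<dots> = (\<Prod>u\<in>V. if \<not> Q u \<and> {..<3} - In u \<noteq> {} then g else 1)"
      using In' by (intro prod.cong) auto
    finally show "(\<Sum>m\<in>PiE V (\<lambda>_. Box). (B m * W m)\<^sup>2) \<le> (\<Prod>u\<in>V. if \<not> Q u \<and> {..<3} - In u \<noteq> {} then g else 1)" .
  qed (use g in auto)
  \<comment> \<open>A vertex of \<open>D\<close> gets \<open>g\<close> from exactly one of the two
    products. With no backward edge it belongs to \<open>Q\<close>, with three backward edges to the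
    complement, and gets 1 in either case.\<close>
  also have "\<dots> = (\<Prod>u\<in>V. if u \<in> D then g else 1)"
    unfolding prod.distrib[symmetric]
  proof (rule prod.cong)
    fix u assume u: "u \<in> V"
    have "In u = {} \<longleftrightarrow> card (In u) = 0" using fin by auto
    moreover have "{..<3} - In u = {} \<longleftrightarrow> 3 - card (In u) = 0"
      unfolding card_Out[symmetric] using fin by auto
    ultimately show "(if Q u \<and> In u \<noteq> {} then g else 1) * (if \<not> Q u \<and> {..<3} - In u \<noteq> {} then g else 1) = (if u \<in> D then g else 1)"
      using u card_In[of u] unfolding Q_def D_def by auto
  qed simp
  also have "\<dots> = g ^ card D"
    using V by (simp add: prod.If_cases D_def Int_def conj_commute)
  also have "\<dots> \<le> g\<^sup>2" using g cD by (intro power_decreasing) auto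
  finally show ?thesis using g power2_le_imp_le[of "\<bar>val V p\<bar>" g] by simp
qed

text \<open>Legs \<open>i\<close> and \<open>j\<close> of \<open>v\<close> are joined, so the
  remaining leg \<open>k\<close> must lead to another vertex \<open>u\<close>. With all other labels
  frozen, the sum over the label of \<open>v\<close> is a multiple of the sum in
  \<open>loop\<close>, or of 0 if levels mismatch.\<close>

lemma val_loop_eq_0:
  assumes V: "finite V" and p: "p \<in> pairings (V \<times> {..<3})"
    and h: "(v, i) \<in> V \<times> {..<3}" "fst (p (v, i)) = v"
  shows "val V p = 0"
proof -
  let ?H = "V \<times> {..<3::nat}"
  obtain j where pij: "p (v, i) = (v, j)" using h(2) by (cases "p (v, i)") auto
  have v: "v \<in> V" and i: "i < 3" using h by auto
  have j: "j < 3" "j \<noteq> i" "p (v, j) = (v, i)" using pairingsD[OF p h(1)] pij by auto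
  obtain k where k: "k < 3" "k \<noteq> i" "k \<noteq> j" "{..<3} = {i, j, k}"
    using third_index[OF i j(1)] j(2) by metis
  have k3: "n = i \<or> n = j \<or> n = k" if "n < 3" for n using that k(4) by blast
  have kH: "(v, k) \<in> ?H" using v k(1) by auto
  obtain u n where un: "p (v, k) = (u, n)" by force
  have pun: "(u, n) \<in> ?H" "p (u, n) = (v, k)" using pairingsD[OF p kH] un by auto
  have "u \<noteq> v"
  proof
    assume "u = v"
    then consider "(u, n) = (v, i)" | "(u, n) = (v, j)" | "(u, n) = (v, k)" using pun k3[of n] by auto
    then show False
    proof cases
      case 1 then show ?thesis using pun(2) pij k(3) by simp
    next
      case 2 then show ?thesis using pun(2) j(3) k(2) by simp
    next
      case 3 then show ?thesis using pairingsD(2)[OF p kH] un by simp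
    qed
  qed
  let ?S = "{(v, i), (v, j), (v, k), (u, n)}"
  have fH: "finite ?H" using V by auto
  have SH: "?S \<subseteq> ?H" using v i j(1) k(1) pun(1) by blast
  have rest: "edge_weight (m(v := y)) q (p q) = edge_weight m q (p q)" if "q \<in> ?H - ?S" for q m y
  proof -
    have "fst q \<noteq> v" using that k3[of "snd q"] by (cases q) auto
    moreover have "fst (p q) \<noteq> v"
    proof
      assume "fst (p q) = v"
      moreover have "p q \<in> ?H" using pairingsD(1)[OF p, of q] that by blast
      ultimately have "p q = (v, i) \<or> p q = (v, j) \<or> p q = (v, k)" using k3[of "snd (p q)"] by (cases "p q") auto
      moreover have "p (p q) = q" using pairingsD(3)[OF p, of q] that by blast
      ultimately have "q = p (v, i) \<or> q = p (v, j) \<or> q = p (v, k)" by metis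
      then show False using that pij j(3) un by auto
    qed
    ultimately show ?thesis by (simp add: edge_weight_def)
  qed
  have "val V p = (\<Sum>m\<in>PiE (insert v (V - {v})) (\<lambda>_. Box). (\<Prod>v\<in>V. T (m v)) * (\<Prod>h\<in>?H. edge_weight m h (p h)))"
    unfolding val_def using v by (simp add: insert_absorb)
  also have "\<dots> = (\<Sum>m\<in>PiE (V - {v}) (\<lambda>_. Box). \<Sum>y\<in>Box. (\<Prod>x\<in>V. T ((m(v := y)) x)) * (\<Prod>h\<in>?H. edge_weight (m(v := y)) h (p h)))"
    by (rule sum_PiE_insert) simp
  also have "\<dots> = 0"
  proof (rule sum.neutral, rule ballI)
    fix m
    define c where "c = (\<Prod>x\<in>V - {v}. T (m x)) * (\<Prod>q\<in>?H - ?S. edge_weight m q (p q))"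
    have "(\<Prod>x\<in>V. T ((m(v := y)) x)) * (\<Prod>h\<in>?H. edge_weight (m(v := y)) h (p h)) =
      c * (T y * of_bool (l i = l j \<and> l k = l n \<and> y i = - y j \<and> y k = - m u n))" for y
    proof -
      have "(\<Prod>x\<in>V. T ((m(v := y)) x)) = T y * (\<Prod>x\<in>V - {v}. T (m x))"
        using V v by (subst prod.remove[of V v]) auto
      moreover have "(\<Prod>h\<in>?H. edge_weight (m(v := y)) h (p h)) = (\<Prod>q\<in>?H - ?S. edge_weight (m(v := y)) q (p q)) * (\<Prod>q\<in>?S. edge_weight (m(v := y)) q (p q))"
        by (rule prod.subset_diff[OF SH fH])
      moreover have "(\<Prod>q\<in>?H - ?S. edge_weight (m(v := y)) q (p q)) = (\<Prod>q\<in>?H - ?S. edge_weight m q (p q))"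
        by (rule prod.cong) (use rest in auto)
      moreover have "(\<Prod>q\<in>?S. edge_weight (m(v := y)) q (p q)) = of_bool (l i = l j \<and> l k = l n \<and> y i = - y j \<and> y k = - m u n)"
        using \<open>u \<noteq> v\<close> j(2,3) k(2,3) pij un pun(2) by (auto simp: edge_weight_def)
      ultimately show ?thesis by (simp add: c_def)
    qed
    then have "(\<Sum>y\<in>Box. (\<Prod>x\<in>V. T ((m(v := y)) x)) * (\<Prod>h\<in>?H. edge_weight (m(v := y)) h (p h))) =
      c * (\<Sum>y\<in>Box. T y * of_bool (l i = l j \<and> l k = l n \<and> y i = - y j \<and> y k = - m u n))"
      by (simp add: sum_distrib_left)
    also have "(\<Sum>y\<in>Box. T y * of_bool (l i = l j \<and> l k = l n \<and> y i = - y j \<and> y k = - m u n)) = 0"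
    proof (cases "l i = l j \<and> l k = l n")
      case True
      have "(\<Sum>y\<in>Box. T y * of_bool (l i = l j \<and> l k = l n \<and> y i = - y j \<and> y k = - m u n)) =
        (\<Sum>y\<in>{y\<in>Box. y i = - y j \<and> y k = - m u n}. T y)"
        unfolding sum.inter_filter[OF finite_mbox] using True by (intro sum.cong) auto
      also have "\<dots> = 0" using True by (intro loop[OF k(4) j(2)[symmetric] k(2,3)]) simp
      finally show ?thesis .
    qed auto
    finally show "(\<Sum>y\<in>Box. (\<Prod>x\<in>V. T ((m(v := y)) x)) * (\<Prod>h\<in>?H. edge_weight (m(v := y)) h (p h))) = 0"
      by (simp only: mult_zero_right)
  qed
  finally show ?thesis .
qed

section \<open>Splitting off theta components\<close>

definition theta_join :: "'v \<Rightarrow> 'v \<Rightarrow> (nat \<Rightarrow> nat) \<Rightarrow> ('v \<times> nat \<Rightarrow> 'v \<times> nat) \<Rightarrow> 'v \<times> nat \<Rightarrow> 'v \<times> nat" where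
  "theta_join v w \<sigma> p = (\<lambda>(u, i). if u = v \<and> i < 3 then (w, \<sigma> i)
      else if u = w \<and> i < 3 then (v, inv \<sigma> i) else p (u, i))"

text \<open>The labels of \<open>v\<close> and \<open>w\<close> separate from the rest. A label of
  \<open>w\<close> determines that of \<open>v\<close>, and by \<open>sym\<close> the product of the
  two entries is a square, so the factor is \<open>total\<close>. If \<open>\<sigma>\<close> joins
  legs of different levels, some edge weight is 0.\<close>

lemma val_theta_join:
  assumes V: "finite V" and vw: "v \<in> V" "w \<in> V" "v \<noteq> w" and \<sigma>: "\<sigma> permutes {..<3}"
    and p: "p \<in> pairings ((V - {v, w}) \<times> {..<3})"
  shows "val V (theta_join v w \<sigma> p) = of_bool (\<forall>i<3. l (\<sigma> i) = l i) * val (V - {v, w}) p"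
proof -
  define V' where "V' = V - {v, w}"
  let ?q = "theta_join v w \<sigma> p"
  have VV: "V = insert v (insert w V')" "v \<notin> insert w V'" "w \<notin> V'" "finite V'" using vw V by (auto simp: V'_def)
  have i3: "inv \<sigma> i < 3 \<longleftrightarrow> i < 3" "\<sigma> i < 3 \<longleftrightarrow> i < 3" for i
    using permutes_in_image[OF permutes_inv[OF \<sigma>], of i] permutes_in_image[OF \<sigma>, of i] by auto
  have inv: "\<sigma> (inv \<sigma> i) = i" "inv \<sigma> (\<sigma> i) = i" for i using permutes_inverses[OF \<sigma>] by auto
  have cws: "(\<Prod>h\<in>V \<times> {..<3}. edge_weight (m(w := y, v := x)) h (?q h)) =
     of_bool (\<forall>i<3. l i = l (\<sigma> i) \<and> x i = - y (\<sigma> i)) * (\<Prod>h\<in>V' \<times> {..<3}. edge_weight m h (p h))" for m x y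
  proof -
    let ?m = "m(w := y, v := x)"
    have "(\<Prod>h\<in>V \<times> {..<3}. edge_weight ?m h (?q h)) = (\<Prod>u\<in>V. \<Prod>i<3. edge_weight ?m (u, i) (?q (u, i)))"
      by (simp add: prod.cartesian_product case_prod_unfold)
    also have "\<dots> = (\<Prod>i<3. edge_weight ?m (v, i) (?q (v, i))) * ((\<Prod>i<3. edge_weight ?m (w, i) (?q (w, i))) * (\<Prod>u\<in>V'. \<Prod>i<3. edge_weight ?m (u, i) (?q (u, i))))"
      unfolding VV(1) using VV(2-4) by simp
    also have "(\<Prod>u\<in>V'. \<Prod>i<3. edge_weight ?m (u, i) (?q (u, i))) = (\<Prod>u\<in>V'. \<Prod>i<3. edge_weight m (u, i) (p (u, i)))"
    proof (intro prod.cong refl)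
      fix u and i :: nat assume ui: "u \<in> V'" "i \<in> {..<3}"
      have "p (u, i) \<in> V' \<times> {..<3}" using pairingsD(1)[OF p, of "(u, i)"] ui unfolding V'_def by blast
      then have "fst (p (u, i)) \<noteq> v" "fst (p (u, i)) \<noteq> w" "u \<noteq> v" "u \<noteq> w"
        using ui VV(2,3) by (cases "p (u, i)"; force)+
      moreover from this have "?q (u, i) = p (u, i)" by (simp add: theta_join_def)
      ultimately show "edge_weight ?m (u, i) (?q (u, i)) = edge_weight m (u, i) (p (u, i))"
        by (simp add: edge_weight_def)
    qed
    also have "\<dots> = (\<Prod>h\<in>V' \<times> {..<3}. edge_weight m h (p h))"
      by (simp add: prod.cartesian_product case_prod_unfold)
    also have "(\<Prod>i<3. edge_weight ?m (v, i) (?q (v, i))) = (\<Prod>i<3. of_bool (l i = l (\<sigma> i) \<and> x i = - y (\<sigma> i)))"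
      using vw by (intro prod.cong refl) (auto simp: theta_join_def edge_weight_def)
    also have "(\<Prod>i<3. edge_weight ?m (w, i) (?q (w, i))) = (\<Prod>i<3. of_bool (l (inv \<sigma> i) = l i \<and> x (inv \<sigma> i) = - y i))"
      using vw by (intro prod.cong refl) (auto simp: theta_join_def edge_weight_def)
    \<comment> \<open>Seen from \<open>w\<close>, the three edges impose the same conditions once
      more, reindexed by \<open>\<sigma>\<close>.\<close>
    also have "\<dots> = (\<Prod>i<3. of_bool (l i = l (\<sigma> i) \<and> x i = - y (\<sigma> i)))"
      by (subst prod.permute[OF \<sigma>]) (simp add: inv o_def)
    also have "(\<Prod>i<3. of_bool (l i = l (\<sigma> i) \<and> x i = - y (\<sigma> i))) = (of_bool (\<forall>i<3. l i = l (\<sigma> i) \<and> x i = - y (\<sigma> i)) :: real)"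
      by (auto simp: of_bool_def intro: prod.neutral)
    also have "of_bool (\<forall>i<3. l i = l (\<sigma> i) \<and> x i = - y (\<sigma> i)) * (of_bool (\<forall>i<3. l i = l (\<sigma> i) \<and> x i = - y (\<sigma> i)) * (\<Prod>h\<in>V' \<times> {..<3}. edge_weight m h (p h)))
      = of_bool (\<forall>i<3. l i = l (\<sigma> i) \<and> x i = - y (\<sigma> i)) * (\<Prod>h\<in>V' \<times> {..<3}. edge_weight m h (p h))" by auto
    finally show ?thesis .
  qed
  have inner: "(\<Sum>y\<in>Box. \<Sum>x\<in>Box. T x * T y * of_bool (\<forall>i<3. l i = l (\<sigma> i) \<and> x i = - y (\<sigma> i))) = of_bool (\<forall>i<3. l (\<sigma> i) = l i)"
  proof (cases "\<forall>i<3. l (\<sigma> i) = l i")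
    case True
    have "(\<Sum>x\<in>Box. T x * T y * of_bool (\<forall>i<3. l i = l (\<sigma> i) \<and> x i = - y (\<sigma> i))) = (T y)\<^sup>2" if y: "y \<in> Box" for y
    proof -
      let ?x = "\<lambda>i\<in>{..<3}. - y (\<sigma> i)"
      have x: "?x \<in> Box"
        unfolding mbox_def
      proof (rule restrict_PiE_iff[THEN iffD2], rule ballI)
        fix i :: nat assume i: "i \<in> {..<3}"
        then have "y (\<sigma> i) \<in> {- int (l (\<sigma> i))..int (l (\<sigma> i))}"
          using PiE_mem[OF y[unfolded mbox_def], of "\<sigma> i"] i3(2)[of i] by simp
        moreover have "l (\<sigma> i) = l i" using True[rule_format, of i] i by simp
        ultimately show "- y (\<sigma> i) \<in> {- int (l i)..int (l i)}" by simp
      qed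
      have "(\<Sum>x\<in>Box. T x * T y * of_bool (\<forall>i<3. l i = l (\<sigma> i) \<and> x i = - y (\<sigma> i))) = (\<Sum>x\<in>{?x}. T x * T y)"
      proof (rule sum.mono_neutral_cong_right[OF finite_mbox])
        show "\<forall>x\<in>Box - {?x}. T x * T y * of_bool (\<forall>i<3. l i = l (\<sigma> i) \<and> x i = - y (\<sigma> i)) = 0"
        proof
          fix x assume xb: "x \<in> Box - {?x}"
          have "\<not> (\<forall>i<3. l i = l (\<sigma> i) \<and> x i = - y (\<sigma> i))"
          proof
            assume *: "\<forall>i<3. l i = l (\<sigma> i) \<and> x i = - y (\<sigma> i)"
            have "x \<in> Box" using xb by simp
            then have "x = ?x" unfolding mbox_def
              by (rule PiE_ext[OF _ x[unfolded mbox_def]]) (simp add: *)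
            then show False using xb by simp
          qed
          then show "T x * T y * of_bool (\<forall>i<3. l i = l (\<sigma> i) \<and> x i = - y (\<sigma> i)) = 0" by simp
        qed
      qed (use x True in auto)
      also have "\<dots> = (T y)\<^sup>2" using sym[OF \<sigma> True y] by (simp add: power2_eq_square)
      finally show ?thesis .
    qed
    then show ?thesis using True total by simp
  next
    case False
    then have P: "(\<forall>i<3. l i = l (\<sigma> i) \<and> x i = - y (\<sigma> i)) = False" for x y :: "nat \<Rightarrow> int" by metis
    show ?thesis unfolding P using False by simp
  qed
  have "val V ?q = (\<Sum>m\<in>PiE V' (\<lambda>_. Box). \<Sum>y\<in>Box. \<Sum>x\<in>Box.
     (\<Prod>u\<in>V. T ((m(w := y, v := x)) u)) * (\<Prod>h\<in>V \<times> {..<3}. edge_weight (m(w := y, v := x)) h (?q h)))"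
    unfolding val_def by (simp only: VV(1) sum_PiE_insert[OF VV(2)] sum_PiE_insert[OF VV(3)])
  also have "\<dots> = (\<Sum>m\<in>PiE V' (\<lambda>_. Box). \<Sum>y\<in>Box. \<Sum>x\<in>Box.
     ((\<Prod>u\<in>V'. T (m u)) * (\<Prod>h\<in>V' \<times> {..<3}. edge_weight m h (p h))) *
     (T x * T y * of_bool (\<forall>i<3. l i = l (\<sigma> i) \<and> x i = - y (\<sigma> i))))"
  proof (intro sum.cong refl)
    fix m x y
    have "(\<Prod>u\<in>V'. T ((m(w := y, v := x)) u)) = (\<Prod>u\<in>V'. T (m u))"
    proof (rule prod.cong)
      fix u assume "u \<in> V'"
      then have "u \<noteq> v" "u \<noteq> w" using VV(2,3) by auto
      then show "T ((m(w := y, v := x)) u) = T (m u)" by simp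
    qed simp
    then have "(\<Prod>u\<in>V. T ((m(w := y, v := x)) u)) = T x * T y * (\<Prod>u\<in>V'. T (m u))"
      unfolding VV(1) using VV(2-4) by auto
    then show "(\<Prod>u\<in>V. T ((m(w := y, v := x)) u)) * (\<Prod>h\<in>V \<times> {..<3}. edge_weight (m(w := y, v := x)) h (?q h)) =
      ((\<Prod>u\<in>V'. T (m u)) * (\<Prod>h\<in>V' \<times> {..<3}. edge_weight m h (p h))) *
     (T x * T y * of_bool (\<forall>i<3. l i = l (\<sigma> i) \<and> x i = - y (\<sigma> i)))"
      unfolding cws by (simp only: mult.assoc mult.commute mult.left_commute)
  qed
  also have "\<dots> = of_bool (\<forall>i<3. l (\<sigma> i) = l i) * val V' p"
    unfolding sum_distrib_left[symmetric] inner sum_distrib_right[symmetric] val_def by (rule mult.commute)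
  finally show ?thesis by (simp add: V'_def)
qed

definition theta_pairings :: "'v set \<Rightarrow> 'v \<Rightarrow> 'v \<Rightarrow> ('v \<times> nat \<Rightarrow> 'v \<times> nat) set" where
  "theta_pairings V v w = {p \<in> pairings (V \<times> {..<3}). \<forall>i<3. fst (p (v, i)) = w}"

lemma bij_betw_theta_join:
  assumes vw: "v \<in> V" "w \<in> V" "v \<noteq> w"
  shows "bij_betw (\<lambda>(\<sigma>, p). theta_join v w \<sigma> p)
    ({\<sigma>. \<sigma> permutes {..<3}} \<times> pairings ((V - {v, w}) \<times> {..<3})) (theta_pairings V v w)"
  unfolding bij_betw_def
proof
  let ?V' = "V - {v, w}"
  let ?D = "{\<sigma>. \<sigma> permutes {..<3}} \<times> pairings (?V' \<times> {..<3})"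
  show "inj_on (\<lambda>(\<sigma>, p). theta_join v w \<sigma> p) ?D"
  proof (rule inj_onI, clarify)
    fix \<sigma> \<tau> :: "nat \<Rightarrow> nat" and p q
    assume \<sigma>: "\<sigma> permutes {..<3}" and \<tau>: "\<tau> permutes {..<3}"
      and p: "p \<in> pairings (?V' \<times> {..<3})" and q: "q \<in> pairings (?V' \<times> {..<3})"
      and eq: "theta_join v w \<sigma> p = theta_join v w \<tau> q"
    have "\<sigma> i = \<tau> i" for i
    proof (cases "i < 3")
      case True
      then show ?thesis using fun_cong[OF eq, of "(v, i)"] by (simp add: theta_join_def)
    next
      case False
      then show ?thesis using permutes_not_in[OF \<sigma>, of i] permutes_not_in[OF \<tau>, of i] by simp
    qed
    moreover have "p (u, i) = q (u, i)" for u i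
    proof (cases "(u = v \<or> u = w) \<and> i < 3")
      case True
      then have "(u, i) \<notin> ?V' \<times> {..<3}" by auto
      then show ?thesis using pairings_outside[OF p] pairings_outside[OF q] by metis
    next
      case False
      then show ?thesis using fun_cong[OF eq, of "(u, i)"] by (auto simp: theta_join_def split: if_splits)
    qed
    ultimately show "\<sigma> = \<tau> \<and> p = q" by auto
  qed
  show "(\<lambda>(\<sigma>, p). theta_join v w \<sigma> p) ` ?D = theta_pairings V v w"
  proof (intro equalityI subsetI)
    fix q assume "q \<in> (\<lambda>(\<sigma>, p). theta_join v w \<sigma> p) ` ?D"
    then obtain \<sigma> p where \<sigma>: "\<sigma> permutes {..<3}" and p: "p \<in> pairings (?V' \<times> {..<3})"
      and q: "q = theta_join v w \<sigma> p" by auto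
    have i3: "inv \<sigma> i < 3 \<longleftrightarrow> i < 3" "\<sigma> i < 3 \<longleftrightarrow> i < 3" for i
      using permutes_in_image[OF permutes_inv[OF \<sigma>], of i] permutes_in_image[OF \<sigma>, of i] by auto
    have inv: "\<sigma> (inv \<sigma> i) = i" "inv \<sigma> (\<sigma> i) = i" for i using permutes_inverses[OF \<sigma>] by auto
    have "q \<in> pairings (V \<times> {..<3})"
      unfolding pairings_iff
    proof (intro conjI allI impI ballI)
      fix h assume h: "h \<notin> V \<times> {..<3::nat}"
      then have "h \<notin> ?V' \<times> {..<3}" by auto
      then have "p h = h" by (rule pairings_outside[OF p])
      then show "q h = h" using h vw by (cases h) (auto simp: q theta_join_def)
    next
      fix h assume h: "h \<in> V \<times> {..<3::nat}"
      obtain u i where ui: "h = (u, i)" by force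
      have "q h \<noteq> h \<and> q (q h) = h"
      proof (cases "u = v \<or> u = w")
        case True
        have "i < 3" using h ui by simp
        then have "q (v, i) = (w, \<sigma> i)" "q (w, \<sigma> i) = (v, i)" "q (w, i) = (v, inv \<sigma> i)" "q (v, inv \<sigma> i) = (w, i)"
          using vw(3) by (simp_all add: q theta_join_def i3 inv)
        then show ?thesis using True vw(3) ui by auto
      next
        case False
        then have h': "h \<in> ?V' \<times> {..<3}" using h ui by auto
        note pD = pairingsD[OF p h']
        have "q h = p h" using False by (simp add: q theta_join_def ui)
        moreover have "q (p h) = p (p h)" using pD(1) by (cases "p h") (auto simp: q theta_join_def)
        ultimately show ?thesis using pD by simp
      qed
      then show "q h \<noteq> h" "q (q h) = h" by auto
    qed
    moreover have "fst (q (v, i)) = w" if "i < 3" for i using that by (simp add: q theta_join_def)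
    ultimately show "q \<in> theta_pairings V v w" by (simp add: theta_pairings_def)
  next
    fix q assume "q \<in> theta_pairings V v w"
    then have q: "q \<in> pairings (V \<times> {..<3})" and qv: "\<And>i. i < 3 \<Longrightarrow> fst (q (v, i)) = w"
      by (auto simp: theta_pairings_def)
    \<comment> \<open>The permutation is read off at \<open>v\<close>; removing \<open>v\<close> and
      \<open>w\<close> from \<open>q\<close> means making it the identity on their legs.\<close>
    define \<sigma> where "\<sigma> i = (if i < 3 then snd (q (v, i)) else i)" for i :: nat
    define p where "p h = (if (fst h = v \<or> fst h = w) \<and> snd h < 3 then h else q h)" for h
    have q\<sigma>: "q (v, i) = (w, \<sigma> i)" if "i < 3" for i
      using qv[OF that] that by (cases "q (v, i)") (simp add: \<sigma>_def)
    have \<sigma>: "\<sigma> permutes {..<3}"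
    proof (rule bij_imp_permutes)
      have "inj_on \<sigma> {..<3}"
      proof (rule inj_onI)
        fix i j assume "i \<in> {..<3::nat}" "j \<in> {..<3}" "\<sigma> i = \<sigma> j"
        then have "q (v, i) = q (v, j)" using q\<sigma> by auto
        then have "q (q (v, i)) = q (q (v, j))" by simp
        then show "i = j" using pairingsD(3)[OF q, of "(v, i)"] pairingsD(3)[OF q, of "(v, j)"] \<open>i \<in> _\<close> \<open>j \<in> _\<close> vw by simp
      qed
      moreover have "\<sigma> ` {..<3} \<subseteq> {..<3}"
      proof
        fix k assume "k \<in> \<sigma> ` {..<3}"
        then obtain i where i: "i < 3" "k = \<sigma> i" by auto
        then show "k \<in> {..<3}" using pairingsD(1)[OF q, of "(v, i)"] q\<sigma>[OF i(1)] vw by auto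
      qed
      ultimately show "bij_betw \<sigma> {..<3} {..<3}"
        by (simp add: bij_betw_def endo_inj_surj)
    qed (auto simp: \<sigma>_def)
    have i3: "inv \<sigma> i < 3 \<longleftrightarrow> i < 3" for i
      using permutes_in_image[OF permutes_inv[OF \<sigma>], of i] by auto
    have qw: "q (w, i) = (v, inv \<sigma> i)" if "i < 3" for i
    proof -
      have "q (v, inv \<sigma> i) = (w, i)" using q\<sigma>[of "inv \<sigma> i"] that i3[of i] permutes_inverses(1)[OF \<sigma>] by simp
      then show ?thesis using pairingsD(3)[OF q, of "(v, inv \<sigma> i)"] that i3[of i] vw by simp
    qed
    have "p \<in> pairings (?V' \<times> {..<3})"
      unfolding pairings_iff
    proof (intro conjI allI impI ballI)
      fix h assume h: "h \<notin> ?V' \<times> {..<3::nat}"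
      show "p h = h"
      proof (cases "(fst h = v \<or> fst h = w) \<and> snd h < 3")
        case False
        then have "h \<notin> V \<times> {..<3}" using h by (cases h) auto
        then show ?thesis using pairings_outside[OF q] by (auto simp: p_def)
      qed (auto simp: p_def)
    next
      fix h assume h: "h \<in> ?V' \<times> {..<3::nat}"
      then have hV: "h \<in> V \<times> {..<3}" by auto
      note qD = pairingsD[OF q hV]
      have ph: "p h = q h" using h by (auto simp: p_def)
      have "\<not> ((fst (q h) = v \<or> fst (q h) = w) \<and> snd (q h) < 3)"
      proof
        assume "(fst (q h) = v \<or> fst (q h) = w) \<and> snd (q h) < 3"
        then have "q (q h) = (w, \<sigma> (snd (q h))) \<or> q (q h) = (v, inv \<sigma> (snd (q h)))"
          using q\<sigma>[of "snd (q h)"] qw[of "snd (q h)"] by (cases "q h") auto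
        then show False using qD(3) h by auto
      qed
      then have "p (q h) = q (q h)" by (auto simp: p_def)
      then show "p h \<noteq> h" "p (p h) = h" using ph qD by auto
    qed
    moreover have "q = theta_join v w \<sigma> p"
    proof
      fix h :: "'a \<times> nat"
      show "q h = theta_join v w \<sigma> p h"
        using q\<sigma> qw by (cases h) (auto simp: theta_join_def p_def)
    qed
    ultimately show "q \<in> (\<lambda>(\<sigma>, p). theta_join v w \<sigma> p) ` ?D" using \<sigma> by (auto intro!: image_eqI[of _ _ "(\<sigma>, p)"])
  qed
qed

text \<open>The leg permutations along which a theta has value 1 instead of 0; their number becomes
  \<open>Delta3\<close>.\<close>

definition automorphisms :: "(nat \<Rightarrow> nat) set" where
  "automorphisms = {\<sigma>. \<sigma> permutes {..<3} \<and> (\<forall>i<3. l (\<sigma> i) = l i)}"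

lemma sum_theta_pairings:
  assumes "finite V" "v \<in> V" "w \<in> V" "v \<noteq> w"
  shows "(\<Sum>p\<in>theta_pairings V v w. val V p) = real (card automorphisms) * Z (V - {v, w})"
proof -
  let ?P = "{\<sigma>. \<sigma> permutes {..<3::nat}}" and ?D = "pairings ((V - {v, w}) \<times> {..<3::nat})"
  have "(\<Sum>p\<in>theta_pairings V v w. val V p) = (\<Sum>z\<in>?P \<times> ?D. val V (theta_join v w (fst z) (snd z)))"
    using sum.reindex_bij_betw[OF bij_betw_theta_join[OF assms(2-4)], of "val V"] by (simp add: case_prod_unfold)
  also have "\<dots> = (\<Sum>z\<in>?P \<times> ?D. of_bool (\<forall>i<3. l (fst z i) = l i) * val (V - {v, w}) (snd z))"
    by (intro sum.cong refl val_theta_join assms) auto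
  also have "\<dots> = (\<Sum>\<sigma>\<in>?P. of_bool (\<forall>i<3. l (\<sigma> i) = l i)) * Z (V - {v, w})"
    unfolding Z_def sum_product sum.cartesian_product by (simp add: case_prod_unfold)
  also have "(\<Sum>\<sigma>\<in>?P. of_bool (\<forall>i<3. l (\<sigma> i) = l i)) = real (card automorphisms)"
  proof -
    have "finite ?P" by (rule finite_permutations) simp
    moreover have "automorphisms = {\<sigma>\<in>?P. \<forall>i<3. l (\<sigma> i) = l i}" by (auto simp: automorphisms_def)
    ultimately show ?thesis by (simp add: of_bool_def sum.If_cases Int_def)
  qed
  finally show ?thesis .
qed

text \<open>Thetas through the fixed vertex \<open>v\<close> are sorted by their other vertex
  \<open>w\<close>. Every other pairing has a loop, hence value 0, or satisfies
  \<open>val_loopless_bound\<close>. For two vertices the latter kind does not occur: without loops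
  all legs of \<open>v\<close> lead to the only other vertex.\<close>

lemma Z_recursion:
  fixes V :: "nat set"
  assumes V: "finite V" "v \<in> V"
  shows "\<bar>Z V - (\<Sum>w\<in>V - {v}. real (card automorphisms) * Z (V - {v, w}))\<bar> \<le> real (card (pairings (V \<times> {..<3::nat}))) * g"
    and "card V = 2 \<Longrightarrow> Z V = (\<Sum>w\<in>V - {v}. real (card automorphisms) * Z (V - {v, w}))"
proof -
  let ?P = "pairings (V \<times> {..<3::nat})"
  define U where "U = (\<Union>w\<in>V - {v}. theta_pairings V v w)"
  have fin: "finite ?P" using V by (intro finite_pairings) auto
  have U: "U \<subseteq> ?P" by (auto simp: U_def theta_pairings_def)
  have "(\<Sum>p\<in>U. val V p) = (\<Sum>w\<in>V - {v}. \<Sum>p\<in>theta_pairings V v w. val V p)"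
    unfolding U_def
  proof (rule sum.UNION_disjoint)
    show "\<forall>w\<in>V - {v}. finite (theta_pairings V v w)"
      using fin by (auto simp: theta_pairings_def)
    show "\<forall>w\<in>V - {v}. \<forall>w'\<in>V - {v}. w \<noteq> w' \<longrightarrow> theta_pairings V v w \<inter> theta_pairings V v w' = {}"
    proof (intro ballI impI equals0I)
      fix w w' x assume "w \<noteq> w'" "x \<in> theta_pairings V v w \<inter> theta_pairings V v w'"
      then have "\<forall>i<3. fst (x (v, i)) = w" "\<forall>i<3. fst (x (v, i)) = w'" by (auto simp: theta_pairings_def)
      then have "fst (x (v, 0)) = w" "fst (x (v, 0)) = w'" using zero_less_numeral by blast+
      then show False using \<open>w \<noteq> w'\<close> by simp
    qed
  qed (use V in auto)
  also have "\<dots> = (\<Sum>w\<in>V - {v}. real (card automorphisms) * Z (V - {v, w}))"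
    using V by (intro sum.cong refl sum_theta_pairings) auto
  finally have R: "Z V - (\<Sum>w\<in>V - {v}. real (card automorphisms) * Z (V - {v, w})) = (\<Sum>p\<in>?P - U. val V p)"
    unfolding Z_def using sum.subset_diff[OF U fin, of "val V"] by simp
  have outside: "\<not> (\<exists>w. \<forall>i<3. fst (p (v, i)) = w)"
    if p: "p \<in> ?P - U" and loopless: "\<And>h. h \<in> V \<times> {..<3} \<Longrightarrow> fst (p h) \<noteq> fst h" for p
  proof
    assume "\<exists>w. \<forall>i<3. fst (p (v, i)) = w"
    then obtain w where w: "\<forall>i<3. fst (p (v, i)) = w" by blast
    have "w = fst (p (v, 0))" using w by simp
    then have "w \<in> V - {v}" using pairingsD(1)[of p "V \<times> {..<3}" "(v, 0)"] p loopless[of "(v, 0)"] V by auto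
    then have "p \<in> U" using w p by (auto simp: U_def theta_pairings_def)
    then show False using p by simp
  qed
  have "\<bar>val V p\<bar> \<le> g" if p: "p \<in> ?P - U" for p
  proof (cases "\<exists>h\<in>V \<times> {..<3}. fst (p h) = fst h")
    case True
    then obtain u i where "(u, i) \<in> V \<times> {..<3}" "fst (p (u, i)) = u" by auto
    then have "val V p = 0" using val_loop_eq_0[OF V(1), of p u i] p by blast
    then show ?thesis using g by simp
  next
    case False
    then show ?thesis using p outside[OF p] by (intro val_loopless_bound[OF V(1) _ _ V(2)]) auto
  qed
  then have "\<bar>\<Sum>p\<in>?P - U. val V p\<bar> \<le> (\<Sum>p\<in>?P - U. g)"
    by (intro order_trans[OF sum_abs] sum_mono)
  also have "\<dots> \<le> real (card ?P) * g"
    using g card_mono[OF fin, of "?P - U"] by (simp add: mult_right_mono)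
  finally show "\<bar>Z V - (\<Sum>w\<in>V - {v}. real (card automorphisms) * Z (V - {v, w}))\<bar> \<le> real (card ?P) * g"
    unfolding R .
  assume c: "card V = 2"
  have "val V p = 0" if p: "p \<in> ?P - U" for p
  proof (cases "\<exists>h\<in>V \<times> {..<3}. fst (p h) = fst h")
    case True
    then obtain u i where "(u, i) \<in> V \<times> {..<3}" "fst (p (u, i)) = u" by auto
    then show ?thesis using val_loop_eq_0[OF V(1), of p u i] p by blast
  next
    case False
    have "card (V - {v}) = 1" using c V by simp
    then obtain w where w: "V - {v} = {w}" by (auto simp: card_1_singleton_iff)
    have "fst (p (v, i)) = w" if "i < 3" for i
    proof -
      have "(v, i) \<in> V \<times> {..<3}" using V that by simp
      then have "fst (p (v, i)) \<in> V - {v}" using pairingsD(1)[of p "V \<times> {..<3}" "(v, i)"] p False by force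
      then show ?thesis using w by simp
    qed
    then show ?thesis using outside[OF p] False by blast
  qed
  then show "Z V = (\<Sum>w\<in>V - {v}. real (card automorphisms) * Z (V - {v, w}))"
    using R by simp
qed

end

section \<open>Wick's formula\<close>

definition std_moment :: "nat \<Rightarrow> real" where
  "std_moment n = (\<integral>x. std_normal_density x * x ^ n \<partial>lborel)"

text \<open>Gaussian integration by parts, read off from the explicit moments. At
  \<open>n = 0\<close> the truncated index is harmless because of the factor 0.\<close>

lemma std_moment_Suc: "std_moment (Suc n) = real n * std_moment (n - 1)"
proof (cases "even n")
  case True
  then obtain k where k: "n = 2 * k" by blast
  have 1: "std_moment (Suc n) = 0"
    unfolding std_moment_def k using integral_std_normal_moment_odd[of k] by simp
  show ?thesis
  proof (cases k)
    case 0
    then show ?thesis using 1 k by simp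
  next
    case (Suc j)
    then have "n - 1 = 2 * j + 1" using k by simp
    then have "std_moment (n - 1) = 0" unfolding std_moment_def using integral_std_normal_moment_odd[of j] by simp
    then show ?thesis using 1 by simp
  qed
next
  case False
  then obtain k where k: "n = 2 * k + 1" using oddE by blast
  have e: "std_moment (2 * k) = fact (2 * k) / (2 ^ k * fact k)" for k
    unfolding std_moment_def by (rule integral_std_normal_moment_even)
  have "Suc n = 2 * Suc k" "n - 1 = 2 * k" using k by auto
  then have "std_moment (Suc n) = fact (2 * Suc k) / (2 ^ Suc k * fact (Suc k))"
    "std_moment (n - 1) = fact (2 * k) / (2 ^ k * fact k)" by (simp_all only: e)
  moreover have "(fact (2 * Suc k) :: real) = (2 * (real k + 1)) * ((2 * real k + 1) * fact (2 * k))"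
    by (simp add: algebra_simps)
  moreover have "(2 ^ Suc k * fact (Suc k) :: real) = (2 * (real k + 1)) * (2 ^ k * fact k)" by simp
  ultimately show ?thesis using k by (simp only: mult_divide_mult_cancel_left_if) simp
qed

locale std_gaussian_family = prob_space M for M :: "'a measure" +
  fixes \<xi> :: "'j \<Rightarrow> 'a \<Rightarrow> real" and J :: "'j set"
  assumes finite_J: "finite J"
    and indep: "indep_vars (\<lambda>_. borel) \<xi> J"
    and normal: "\<And>j. j \<in> J \<Longrightarrow> distributed M lborel (\<xi> j) std_normal_density"
begin

definition mono_moment :: "'h set \<Rightarrow> ('h \<Rightarrow> 'j) \<Rightarrow> real" where
  "mono_moment H \<phi> = (\<Prod>j\<in>J. std_moment (card {h\<in>H. \<phi> h = j}))"

lemma power_moment: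
  assumes "j \<in> J"
  shows "integrable M (\<lambda>x. \<xi> j x ^ n)" "expectation (\<lambda>x. \<xi> j x ^ n) = std_moment n"
proof -
  show "integrable M (\<lambda>x. \<xi> j x ^ n)"
    using distributed_integrable[OF normal[OF assms], of "\<lambda>x. x ^ n"] integrable_std_normal_moment[of n] by simp
  show "expectation (\<lambda>x. \<xi> j x ^ n) = std_moment n"
    using distributed_integral[OF normal[OF assms], of "\<lambda>x. x ^ n"] by (simp add: std_moment_def)
qed

text \<open>Grouping the factors by variable gives powers of independent variables, whose moments
  multiply.\<close>

lemma monomial_moment:
  assumes "finite H" "\<phi> ` H \<subseteq> J"
  shows "integrable M (\<lambda>x. \<Prod>h\<in>H. \<xi> (\<phi> h) x)" "expectation (\<lambda>x. \<Prod>h\<in>H. \<xi> (\<phi> h) x) = mono_moment H \<phi>"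
proof -
  have e: "(\<Prod>h\<in>H. \<xi> (\<phi> h) x) = (\<Prod>j\<in>J. \<xi> j x ^ card {h\<in>H. \<phi> h = j})" for x
  proof -
    have "(\<Prod>h\<in>H. \<xi> (\<phi> h) x) = (\<Prod>j\<in>J. \<Prod>h\<in>{h\<in>H. \<phi> h = j}. \<xi> (\<phi> h) x)"
      by (rule prod.group[symmetric]) (use assms finite_J in auto)
    also have "\<dots> = (\<Prod>j\<in>J. \<xi> j x ^ card {h\<in>H. \<phi> h = j})"
      by (intro prod.cong refl) simp
    finally show ?thesis .
  qed
  have ind: "indep_vars (\<lambda>_. borel) (\<lambda>j x. \<xi> j x ^ card {h\<in>H. \<phi> h = j}) J"
    by (rule indep_vars_compose2[OF indep, of "\<lambda>j y. y ^ card {h\<in>H. \<phi> h = j}"]) simp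
  show "integrable M (\<lambda>x. \<Prod>h\<in>H. \<xi> (\<phi> h) x)"
    unfolding e by (rule indep_vars_integrable[OF finite_J ind]) (rule power_moment)
  show "expectation (\<lambda>x. \<Prod>h\<in>H. \<xi> (\<phi> h) x) = mono_moment H \<phi>"
    unfolding e mono_moment_def
    by (subst indep_vars_lebesgue_integral[OF finite_J ind]) (auto simp: power_moment)
qed

lemma mono_moment_cong: "(\<And>h. h \<in> H \<Longrightarrow> \<phi> h = \<psi> h) \<Longrightarrow> mono_moment H \<phi> = mono_moment H \<psi>"
  unfolding mono_moment_def by (intro prod.cong refl arg_cong[where f = std_moment] arg_cong[where f = card]) auto

text \<open>Integration by parts in the variable \<open>j\<close>: one more factor yields its
  multiplicity times the moment with one factor fewer, and the multiplicity counts the possible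
  partners of \<open>h0\<close>.\<close>

lemma mono_moment_insert:
  assumes "finite H" "h0 \<notin> H" "j \<in> J"
  shows "mono_moment (insert h0 H) (\<phi>(h0 := j)) = (\<Sum>h\<in>H. of_bool (\<phi> h = j) * mono_moment (H - {h}) \<phi>)"
proof -
  define n where "n i = card {h\<in>H. \<phi> h = i}" for i
  have ne: "card {h\<in>insert h0 H. (\<phi>(h0 := j)) h = i} = (if i = j then Suc (n i) else n i)" for i
  proof -
    have "{h\<in>insert h0 H. (\<phi>(h0 := j)) h = i} = (if i = j then insert h0 {h\<in>H. \<phi> h = i} else {h\<in>H. \<phi> h = i})"
      using assms by auto
    then show ?thesis using assms by (simp add: n_def)
  qed
  have "mono_moment (insert h0 H) (\<phi>(h0 := j)) = (\<Prod>i\<in>J. std_moment (if i = j then Suc (n i) else n i))"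
    unfolding mono_moment_def ne ..
  also have "\<dots> = std_moment (Suc (n j)) * (\<Prod>i\<in>J - {j}. std_moment (n i))"
    using assms(3) finite_J by (subst prod.remove[of J j]) auto
  also have "\<dots> = real (n j) * (std_moment (n j - 1) * (\<Prod>i\<in>J - {j}. std_moment (n i)))"
    by (simp add: std_moment_Suc)
  also have "\<dots> = (\<Sum>h\<in>{h\<in>H. \<phi> h = j}. mono_moment (H - {h}) \<phi>)"
  proof -
    have "mono_moment (H - {h}) \<phi> = std_moment (n j - 1) * (\<Prod>i\<in>J - {j}. std_moment (n i))" if "h \<in> H" "\<phi> h = j" for h
    proof -
      have "card {h'\<in>H - {h}. \<phi> h' = i} = (if i = j then n i - 1 else n i)" for i
      proof -
        have "{h'\<in>H - {h}. \<phi> h' = i} = (if i = j then {h'\<in>H. \<phi> h' = i} - {h} else {h'\<in>H. \<phi> h' = i})"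
          using that by auto
        then show ?thesis using that assms(1) by (simp add: n_def)
      qed
      then show ?thesis unfolding mono_moment_def
        using assms(3) finite_J by (subst prod.remove[of J j]) auto
    qed
    then show ?thesis by (simp add: n_def)
  qed
  also have "\<dots> = (\<Sum>h\<in>H. of_bool (\<phi> h = j) * mono_moment (H - {h}) \<phi>)"
    unfolding sum.inter_filter[OF assms(1)] by (intro sum.cong) auto
  finally show ?thesis .
qed

definition lin :: "('j \<Rightarrow> complex) \<Rightarrow> 'a \<Rightarrow> complex" where
  "lin c x = (\<Sum>j\<in>J. c j * of_real (\<xi> j x))"

lemma prod_lin_expectation:
  assumes "finite H"
  shows "integrable M (\<lambda>x. \<Prod>h\<in>H. lin (c h) x)"
    "expectation (\<lambda>x. \<Prod>h\<in>H. lin (c h) x) = (\<Sum>\<phi>\<in>PiE H (\<lambda>_. J). (\<Prod>h\<in>H. c h (\<phi> h)) * of_real (mono_moment H \<phi>))"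
proof -
  have e: "(\<Prod>h\<in>H. lin (c h) x) = (\<Sum>\<phi>\<in>PiE H (\<lambda>_. J). (\<Prod>h\<in>H. c h (\<phi> h)) * of_real (\<Prod>h\<in>H. \<xi> (\<phi> h) x))" for x
    unfolding lin_def using assms finite_J by (subst prod_sum_PiE) (auto simp: prod.distrib)
  have i: "integrable M (\<lambda>x. (\<Prod>h\<in>H. c h (\<phi> h)) * complex_of_real (\<Prod>h\<in>H. \<xi> (\<phi> h) x))"
    "expectation (\<lambda>x. (\<Prod>h\<in>H. c h (\<phi> h)) * complex_of_real (\<Prod>h\<in>H. \<xi> (\<phi> h) x)) = (\<Prod>h\<in>H. c h (\<phi> h)) * of_real (mono_moment H \<phi>)"
    if "\<phi> \<in> PiE H (\<lambda>_. J)" for \<phi>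
  proof -
    have "\<phi> ` H \<subseteq> J" using that by auto
    note mm = monomial_moment[OF assms this]
    show "integrable M (\<lambda>x. (\<Prod>h\<in>H. c h (\<phi> h)) * complex_of_real (\<Prod>h\<in>H. \<xi> (\<phi> h) x))"
      by (intro integrable_mult_right integrable_of_real mm)
    show "expectation (\<lambda>x. (\<Prod>h\<in>H. c h (\<phi> h)) * complex_of_real (\<Prod>h\<in>H. \<xi> (\<phi> h) x)) = (\<Prod>h\<in>H. c h (\<phi> h)) * of_real (mono_moment H \<phi>)"
      using mm by (simp del: of_real_prod)
  qed
  show "integrable M (\<lambda>x. \<Prod>h\<in>H. lin (c h) x)"
    unfolding e by (intro Bochner_Integration.integrable_sum i)
  show "expectation (\<lambda>x. \<Prod>h\<in>H. lin (c h) x) = (\<Sum>\<phi>\<in>PiE H (\<lambda>_. J). (\<Prod>h\<in>H. c h (\<phi> h)) * of_real (mono_moment H \<phi>))"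
    unfolding e
    by (rule trans[OF Bochner_Integration.integral_sum[OF i(1)]], assumption, rule sum.cong[OF refl], rule i(2))
qed

text \<open>Isserlis' recursion on the partner \<open>h\<close> of \<open>h0\<close>. No conjugates
  occur, so the relevant covariance is bilinear:
  \<open>\<Sum>j\<in>J. c h0 j * c h j\<close>.\<close>

lemma wick_step:
  assumes "finite H" "h0 \<notin> H"
  shows "expectation (\<lambda>x. \<Prod>h\<in>insert h0 H. lin (c h) x) =
     (\<Sum>h\<in>H. (\<Sum>j\<in>J. c h0 j * c h j) * expectation (\<lambda>x. \<Prod>h\<in>H - {h}. lin (c h) x))"
proof -
  have "expectation (\<lambda>x. \<Prod>h\<in>insert h0 H. lin (c h) x) =
    (\<Sum>\<phi>\<in>PiE H (\<lambda>_. J). \<Sum>j\<in>J. (\<Prod>h\<in>insert h0 H. c h ((\<phi>(h0 := j)) h)) * of_real (mono_moment (insert h0 H) (\<phi>(h0 := j))))"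
    using assms by (subst prod_lin_expectation(2)) (simp_all only: finite_insert sum_PiE_insert[OF assms(2)])
  also have "\<dots> = (\<Sum>\<phi>\<in>PiE H (\<lambda>_. J). \<Sum>h\<in>H. c h0 (\<phi> h) * (\<Prod>h\<in>H. c h (\<phi> h)) * of_real (mono_moment (H - {h}) \<phi>))"
  proof (rule sum.cong[OF refl])
    fix \<phi> assume \<phi>: "\<phi> \<in> PiE H (\<lambda>_. J)"
    have cb: "complex_of_real (of_bool b) = of_bool b" for b by (cases b) auto
    have "(\<Prod>h\<in>H. c h ((\<phi>(h0 := j)) h)) = (\<Prod>h\<in>H. c h (\<phi> h))" for j
      using assms by (intro prod.cong) auto
    then have "(\<Prod>h\<in>insert h0 H. c h ((\<phi>(h0 := j)) h)) = c h0 j * (\<Prod>h\<in>H. c h (\<phi> h))" for j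
      using assms by simp
    then have "(\<Sum>j\<in>J. (\<Prod>h\<in>insert h0 H. c h ((\<phi>(h0 := j)) h)) * of_real (mono_moment (insert h0 H) (\<phi>(h0 := j)))) =
      (\<Sum>j\<in>J. c h0 j * (\<Prod>h\<in>H. c h (\<phi> h)) * of_real (\<Sum>h\<in>H. of_bool (\<phi> h = j) * mono_moment (H - {h}) \<phi>))"
      using assms by (intro sum.cong refl) (simp add: mono_moment_insert)
    also have "\<dots> = (\<Sum>j\<in>J. \<Sum>h\<in>H. of_bool (\<phi> h = j) * (c h0 j * (\<Prod>h\<in>H. c h (\<phi> h)) * of_real (mono_moment (H - {h}) \<phi>)))"
      by (intro sum.cong refl) (simp add: sum_distrib_left mult_ac cb)
    also have "\<dots> = (\<Sum>h\<in>H. \<Sum>j\<in>J. of_bool (\<phi> h = j) * (c h0 j * (\<Prod>h\<in>H. c h (\<phi> h)) * of_real (mono_moment (H - {h}) \<phi>)))"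
      by (rule sum.swap)
    also have "\<dots> = (\<Sum>h\<in>H. c h0 (\<phi> h) * (\<Prod>h\<in>H. c h (\<phi> h)) * of_real (mono_moment (H - {h}) \<phi>))"
    proof (rule sum.cong[OF refl])
      fix h assume "h \<in> H"
      then have "\<phi> h \<in> J" using \<phi> by auto
      then show "(\<Sum>j\<in>J. of_bool (\<phi> h = j) * (c h0 j * (\<Prod>h\<in>H. c h (\<phi> h)) * of_real (mono_moment (H - {h}) \<phi>))) =
        c h0 (\<phi> h) * (\<Prod>h\<in>H. c h (\<phi> h)) * of_real (mono_moment (H - {h}) \<phi>)"
        using finite_J by (simp add: of_bool_def if_distrib[of "\<lambda>x. x * _"] sum.delta cong: if_cong)
    qed
    finally show "(\<Sum>j\<in>J. (\<Prod>h\<in>insert h0 H. c h ((\<phi>(h0 := j)) h)) * of_real (mono_moment (insert h0 H) (\<phi>(h0 := j)))) =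
      (\<Sum>h\<in>H. c h0 (\<phi> h) * (\<Prod>h\<in>H. c h (\<phi> h)) * of_real (mono_moment (H - {h}) \<phi>))" .
  qed
  also have "\<dots> = (\<Sum>h\<in>H. \<Sum>\<phi>\<in>PiE H (\<lambda>_. J). c h0 (\<phi> h) * (\<Prod>h\<in>H. c h (\<phi> h)) * of_real (mono_moment (H - {h}) \<phi>))"
    by (rule sum.swap)
  also have "\<dots> = (\<Sum>h\<in>H. (\<Sum>j\<in>J. c h0 j * c h j) * expectation (\<lambda>x. \<Prod>h\<in>H - {h}. lin (c h) x))"
  proof (rule sum.cong[OF refl])
    fix h assume h: "h \<in> H"
    \<comment> \<open>\<open>mono_moment (H - {h})\<close> does not see the value at
      \<open>h\<close>; summing out that coordinate produces the covariance of \<open>h0\<close> and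
      \<open>h\<close>.\<close>
    have "(\<Sum>\<phi>\<in>PiE (insert h (H - {h})) (\<lambda>_. J). c h0 (\<phi> h) * (\<Prod>h\<in>H. c h (\<phi> h)) * of_real (mono_moment (H - {h}) \<phi>)) =
      (\<Sum>\<phi>\<in>PiE (H - {h}) (\<lambda>_. J). \<Sum>j\<in>J. c h0 ((\<phi>(h := j)) h) * (\<Prod>h'\<in>H. c h' ((\<phi>(h := j)) h')) * of_real (mono_moment (H - {h}) (\<phi>(h := j))))"
      by (rule sum_PiE_insert) simp
    also have "\<dots> = (\<Sum>\<phi>\<in>PiE (H - {h}) (\<lambda>_. J). \<Sum>j\<in>J. c h0 j * c h j * ((\<Prod>h'\<in>H - {h}. c h' (\<phi> h')) * of_real (mono_moment (H - {h}) \<phi>)))"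
    proof (intro sum.cong refl)
      fix \<phi> j
      have "(\<Prod>h'\<in>H. c h' ((\<phi>(h := j)) h')) = c h j * (\<Prod>h'\<in>H - {h}. c h' (\<phi> h'))"
        using assms h by (subst prod.remove[of H h]) auto
      moreover have "mono_moment (H - {h}) (\<phi>(h := j)) = mono_moment (H - {h}) \<phi>"
        by (rule mono_moment_cong) auto
      ultimately show "c h0 ((\<phi>(h := j)) h) * (\<Prod>h'\<in>H. c h' ((\<phi>(h := j)) h')) * of_real (mono_moment (H - {h}) (\<phi>(h := j))) =
        c h0 j * c h j * ((\<Prod>h'\<in>H - {h}. c h' (\<phi> h')) * of_real (mono_moment (H - {h}) \<phi>))"
        by simp
    qed
    also have "\<dots> = (\<Sum>j\<in>J. c h0 j * c h j) * (\<Sum>\<phi>\<in>PiE (H - {h}) (\<lambda>_. J). (\<Prod>h'\<in>H - {h}. c h' (\<phi> h')) * of_real (mono_moment (H - {h}) \<phi>))"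
      by (simp only: sum_distrib_right[symmetric] sum_distrib_left[symmetric])
    finally show "(\<Sum>\<phi>\<in>PiE H (\<lambda>_. J). c h0 (\<phi> h) * (\<Prod>h\<in>H. c h (\<phi> h)) * of_real (mono_moment (H - {h}) \<phi>)) =
      (\<Sum>j\<in>J. c h0 j * c h j) * expectation (\<lambda>x. \<Prod>h\<in>H - {h}. lin (c h) x)"
      using h assms by (simp only: prod_lin_expectation(2) finite_Diff insert_Diff)
  qed
  finally show ?thesis .
qed

text \<open>As \<open>\<gamma>\<close> takes only the values 0 and 1, each pair may be counted from both of its ends.\<close>

theorem wick:
  assumes "finite H" and c: "\<And>h h'. h \<in> H \<Longrightarrow> h' \<in> H \<Longrightarrow> (\<Sum>j\<in>J. c h j * c h' j) = of_real (\<gamma> h h')"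
    and sym: "\<And>h h'. \<gamma> h h' = \<gamma> h' h" and idem: "\<And>h h'. \<gamma> h h' * \<gamma> h h' = \<gamma> h h'"
  shows "expectation (\<lambda>x. \<Prod>h\<in>H. lin (c h) x) = of_real (\<Sum>p\<in>pairings H. \<Prod>h\<in>H. \<gamma> h (p h))"
  using assms(1,2)
proof (induction "card H" arbitrary: H rule: less_induct)
  case less
  show ?case
  proof (cases "H = {}")
    case True
    have "pairings {} = {id :: 'b \<Rightarrow> 'b}" by (auto simp: pairings_iff)
    then show ?thesis using True by (simp add: prob_space)
  next
    case False
    then obtain h0 H' where H: "H = insert h0 H'" "h0 \<notin> H'" by (meson Set.set_insert ex_in_conv)
    have fin: "finite H'" using less.prems H by simp
    have "expectation (\<lambda>x. \<Prod>h\<in>H. lin (c h) x) =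
      (\<Sum>h\<in>H'. of_real (\<gamma> h0 h) * of_real (\<Sum>p\<in>pairings (H' - {h}). \<Prod>h\<in>H' - {h}. \<gamma> h (p h)))"
      unfolding H(1) wick_step[OF fin H(2)]
    proof (rule sum.cong[OF refl])
      fix h assume h: "h \<in> H'"
      have "card (H' - {h}) < card H" using h fin H by (simp add: card_Diff1_le le_imp_less_Suc)
      then have "expectation (\<lambda>x. \<Prod>h\<in>H' - {h}. lin (c h) x) = of_real (\<Sum>p\<in>pairings (H' - {h}). \<Prod>h\<in>H' - {h}. \<gamma> h (p h))"
        by (rule less.hyps) (use fin less.prems(2) H in auto)
      moreover have "(\<Sum>j\<in>J. c h0 j * c h j) = of_real (\<gamma> h0 h)" using less.prems(2) h H by simp
      ultimately show "(\<Sum>j\<in>J. c h0 j * c h j) * expectation (\<lambda>x. \<Prod>h\<in>H' - {h}. lin (c h) x) =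
         of_real (\<gamma> h0 h) * of_real (\<Sum>p\<in>pairings (H' - {h}). \<Prod>h\<in>H' - {h}. \<gamma> h (p h))" by simp
    qed
    also have "\<dots> = of_real (\<Sum>h\<in>H'. \<Sum>p\<in>pairings (H' - {h}). \<gamma> h0 h * (\<Prod>h\<in>H' - {h}. \<gamma> h (p h)))"
      by (simp only: of_real_sum of_real_mult sum_distrib_left)
    also have "(\<Sum>h\<in>H'. \<Sum>p\<in>pairings (H' - {h}). \<gamma> h0 h * (\<Prod>h\<in>H' - {h}. \<gamma> h (p h))) =
      (\<Sum>z\<in>(SIGMA h:H'. pairings (H' - {h})). \<gamma> h0 (fst z) * (\<Prod>h\<in>H' - {fst z}. \<gamma> h (snd z h)))"
      using fin finite_pairings by (subst sum.Sigma) (auto simp: case_prod_unfold)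
    \<comment> \<open>A pairing of \<open>H\<close> amounts to the partner of \<open>h0\<close> and
      a pairing of what remains. The product over \<open>H\<close> contains the new pair twice, and
      \<open>idem\<close> merges the two factors.\<close>
    also have "\<dots> = (\<Sum>p\<in>pairings H. \<Prod>h\<in>H. \<gamma> h (p h))"
    proof (rule sum.reindex_bij_witness[of _ "\<lambda>p. (p h0, \<lambda>x. if x = h0 \<or> x = p h0 then x else p x)"
          "\<lambda>z x. if x = h0 then fst z else if x = fst z then h0 else snd z x"])
      fix p assume p: "p \<in> pairings H"
      have h0: "h0 \<in> H" using H by simp
      note D0 = pairingsD[OF p h0]
      show "(\<lambda>x. if x = h0 then fst (p h0, \<lambda>x. if x = h0 \<or> x = p h0 then x else p x)
         else if x = fst (p h0, \<lambda>x. if x = h0 \<or> x = p h0 then x else p x) then h0 else snd (p h0, \<lambda>x. if x = h0 \<or> x = p h0 then x else p x) x) = p"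
        using D0 by auto
      have "(\<lambda>x. if x = h0 \<or> x = p h0 then x else p x) \<in> pairings (H' - {p h0})"
        unfolding pairings_iff
      proof (intro conjI allI impI ballI)
        fix h assume "h \<notin> H' - {p h0}"
        then have "h = h0 \<or> h = p h0 \<or> h \<notin> H" using H by auto
        then show "(if h = h0 \<or> h = p h0 then h else p h) = h" using pairings_outside[OF p] by auto
      next
        fix h assume h: "h \<in> H' - {p h0}"
        then have hH: "h \<in> H" "h \<noteq> h0" using H by auto
        note D = pairingsD[OF p hH(1)]
        have "p h \<noteq> p h0" using D(3) D0(3) hH by metis
        moreover have "p h \<noteq> h0" using D(3) h by auto
        ultimately show "(if h = h0 \<or> h = p h0 then h else p h) \<noteq> h"
          "(if (if h = h0 \<or> h = p h0 then h else p h) = h0 \<or> (if h = h0 \<or> h = p h0 then h else p h) = p h0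
             then (if h = h0 \<or> h = p h0 then h else p h) else p (if h = h0 \<or> h = p h0 then h else p h)) = h"
          using D h hH by auto
      qed
      then show "(p h0, \<lambda>x. if x = h0 \<or> x = p h0 then x else p x) \<in> (SIGMA h:H'. pairings (H' - {h}))"
        using D0 H by auto
    next
      fix z assume z: "z \<in> (SIGMA h:H'. pairings (H' - {h}))"
      obtain h p where hp: "z = (h, p)" "h \<in> H'" "p \<in> pairings (H' - {h})" using z by auto
      have out: "p h0 = h0" "p h = h" using pairings_outside[OF hp(3)] H by auto
      have "h \<noteq> h0" using hp H by auto
      let ?q = "\<lambda>x. if x = h0 then fst z else if x = fst z then h0 else snd z x"
      have q: "?q h0 = h" "?q h = h0" "\<And>x. x \<noteq> h0 \<Longrightarrow> x \<noteq> h \<Longrightarrow> ?q x = p x" using hp \<open>h \<noteq> h0\<close> by auto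
      have pne: "p x \<noteq> h0" "p x \<noteq> h" "p x \<noteq> x" "p (p x) = x" if "x \<in> H' - {h}" for x
        using pairingsD[OF hp(3) that] H by auto
      show "(?q h0, \<lambda>x. if x = h0 \<or> x = ?q h0 then x else ?q x) = z"
        using out hp(1) \<open>h \<noteq> h0\<close> by (auto simp: fun_eq_iff)
      show qp: "?q \<in> pairings H"
        unfolding pairings_iff
      proof (intro conjI allI impI ballI)
        fix x assume x: "x \<notin> H"
        then have "x \<noteq> h0" "x \<noteq> h" "x \<notin> H' - {h}" using H hp by auto
        then show "?q x = x" using q pairings_outside[OF hp(3)] by metis
      next
        fix x assume x: "x \<in> H"
        then consider "x = h0" | "x = h" | "x \<in> H' - {h}" "x \<noteq> h0" "x \<noteq> h" using H by auto
        then have "?q x \<noteq> x \<and> ?q (?q x) = x"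
        proof cases
          case 1
          then show ?thesis using hp(1) \<open>h \<noteq> h0\<close> by simp
        next
          case 2
          then show ?thesis using hp(1) \<open>h \<noteq> h0\<close> by simp
        next
          case 3
          then show ?thesis using hp(1) pne[of x] by simp
        qed
        then show "?q x \<noteq> x" "?q (?q x) = x" by blast+
      qed
      have "(\<Prod>x\<in>H. \<gamma> x (?q x)) = \<gamma> h0 (?q h0) * (\<gamma> h (?q h) * (\<Prod>x\<in>H' - {h}. \<gamma> x (?q x)))"
        unfolding H(1) using fin H(2) hp(2) by (simp add: prod.remove)
      also have "(\<Prod>x\<in>H' - {h}. \<gamma> x (?q x)) = (\<Prod>x\<in>H' - {h}. \<gamma> x (p x))"
        using H by (intro prod.cong refl arg_cong2[where f = \<gamma>] q) auto
      also have "\<gamma> h0 (?q h0) * (\<gamma> h (?q h) * (\<Prod>x\<in>H' - {h}. \<gamma> x (p x))) = (\<gamma> h0 h * \<gamma> h0 h) * (\<Prod>x\<in>H' - {h}. \<gamma> x (p x))"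
        unfolding q sym[of h h0] by simp
      finally show "(\<Prod>x\<in>H. \<gamma> x (?q x)) = \<gamma> h0 (fst z) * (\<Prod>h\<in>H' - {fst z}. \<gamma> h (snd z h))"
        unfolding idem hp(1) by simp
    qed
    finally show ?thesis .
  qed
qed

end

section \<open>The 3j network\<close>

text \<open>The sign is the product of the phases \<open>(-i)^|m|\<close> on the support of the 3j symbol. Multiplying the
  coefficient \<open>a l m\<close> by \<open>i^|m|\<close> removes the factor \<open>(-1)^m\<close> from the covariance.\<close>

definition signed_w3 :: "int \<Rightarrow> int \<Rightarrow> int \<Rightarrow> int \<Rightarrow> int \<Rightarrow> int \<Rightarrow> real" where
  "signed_w3 j1 j2 j3 m1 m2 m3 = (-1) ^ ((nat \<bar>m1\<bar> + nat \<bar>m2\<bar> + nat \<bar>m3\<bar>) div 2) * wigner3j j1 j2 j3 m1 m2 m3"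

lemma signed_w3_swap12:
  assumes "w3_triangle j1 j2 j3" "even (j1 + j2 + j3)"
  shows "signed_w3 j1 j2 j3 m1 m2 m3 = signed_w3 j2 j1 j3 m2 m1 m3"
  unfolding signed_w3_def wigner3j_swap12[OF assms] by (simp add: add.commute)

lemma signed_w3_swap23:
  assumes "w3_triangle j1 j2 j3" "even (j1 + j2 + j3)"
  shows "signed_w3 j1 j2 j3 m1 m2 m3 = signed_w3 j1 j3 j2 m1 m3 m2"
proof -
  have "nat \<bar>m1\<bar> + nat \<bar>m2\<bar> + nat \<bar>m3\<bar> = nat \<bar>m1\<bar> + nat \<bar>m3\<bar> + nat \<bar>m2\<bar>" by simp
  then show ?thesis unfolding signed_w3_def wigner3j_swap23[OF assms] by (simp only:)
qed

lemma signed_w3_neg: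
  assumes "w3_triangle j1 j2 j3" "even (j1 + j2 + j3)"
  shows "signed_w3 j1 j2 j3 (- m1) (- m2) (- m3) = signed_w3 j1 j2 j3 m1 m2 m3"
  unfolding signed_w3_def wigner3j_neg[OF assms] by simp

lemma signed_w3_eq_0: "m1 + m2 + m3 \<noteq> 0 \<Longrightarrow> signed_w3 j1 j2 j3 m1 m2 m3 = 0"
  by (simp add: signed_w3_def wigner3j_eq_0)

lemma signed_w3_sq: "(signed_w3 j1 j2 j3 m1 m2 m3)\<^sup>2 = (wigner3j j1 j2 j3 m1 m2 m3)\<^sup>2"
  by (simp add: signed_w3_def power_mult_distrib flip: power_mult)

lemma signed_w3_row:
  assumes "w3_triangle j1 j2 j3" "even (j1 + j2 + j3)" "\<bar>m3\<bar> \<le> j3"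
  shows "(\<Sum>m1\<in>{-j1..j1}. \<Sum>m2\<in>{-j2..j2}. (signed_w3 j1 j2 j3 m1 m2 m3)\<^sup>2) = 1 / (2 * of_int j3 + 1)"
proof -
  have "(\<Sum>m2\<in>{-j2..j2}. (signed_w3 j1 j2 j3 m1 m2 m3)\<^sup>2) = (wigner3j j1 j2 j3 m1 (- m1 - m3) m3)\<^sup>2" for m1
  proof -
    have "(\<Sum>m2\<in>{-j2..j2}. (signed_w3 j1 j2 j3 m1 m2 m3)\<^sup>2) = (\<Sum>m2\<in>{-j2..j2} \<inter> {- m1 - m3}. (signed_w3 j1 j2 j3 m1 m2 m3)\<^sup>2)"
    proof (rule sum.mono_neutral_right)
      show "\<forall>m2\<in>{-j2..j2} - {-j2..j2} \<inter> {- m1 - m3}. (signed_w3 j1 j2 j3 m1 m2 m3)\<^sup>2 = 0"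
      proof
        fix m2 assume "m2 \<in> {-j2..j2} - {-j2..j2} \<inter> {- m1 - m3}"
        then have "m1 + m2 + m3 \<noteq> 0" by auto
        then show "(signed_w3 j1 j2 j3 m1 m2 m3)\<^sup>2 = 0" by (simp add: signed_w3_eq_0)
      qed
    qed auto
    also have "\<dots> = (\<Sum>m2\<in>{- m1 - m3}. (signed_w3 j1 j2 j3 m1 m2 m3)\<^sup>2)"
    proof (rule sum.mono_neutral_left)
      show "\<forall>m2\<in>{- m1 - m3} - {-j2..j2} \<inter> {- m1 - m3}. (signed_w3 j1 j2 j3 m1 m2 m3)\<^sup>2 = 0"
      proof
        fix m2 assume "m2 \<in> {- m1 - m3} - {-j2..j2} \<inter> {- m1 - m3}"
        then have "\<bar>m2\<bar> > j2" by auto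
        then show "(signed_w3 j1 j2 j3 m1 m2 m3)\<^sup>2 = 0" by (simp add: signed_w3_sq wigner3j_eq_0)
      qed
    qed auto
    finally show ?thesis by (simp add: signed_w3_sq)
  qed
  then show ?thesis using wigner3j_norm[OF assms] by simp
qed

text \<open>At \<open>(m, - m, 0)\<close> the halved exponent is \<open>|m|\<close>, so the sign is
  precisely the \<open>(-1)^m\<close> of the singlet contraction.\<close>

lemma signed_w3_loop:
  assumes "w3_triangle j j j3" "even (j + j + j3)" "1 \<le> j3"
  shows "(\<Sum>m\<in>{-j..j}. signed_w3 j j j3 m (- m) 0) = 0"
proof -
  have "(-1::real) ^ nat \<bar>m\<bar> = (-1) powi m" for m
    by (auto simp: minus_one_power_iff power_int_minus_left even_nat_iff)
  then have "signed_w3 j j j3 m (- m) 0 = (-1) powi m * wigner3j j j j3 m (- m) 0" for m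
    by (simp add: signed_w3_def flip: mult_2)
  then show ?thesis using wigner3j_loop[OF assms] by simp
qed

section \<open>Index triples and the network of a 3j symbol\<close>

definition level :: "nat \<Rightarrow> nat \<Rightarrow> nat \<Rightarrow> nat \<Rightarrow> nat" where
  "level l1 l2 l3 i = (if i = 0 then l1 else if i = 1 then l2 else l3)"

lemma level_simps: "level l1 l2 l3 0 = l1" "level l1 l2 l3 (Suc 0) = l2" "level l1 l2 l3 1 = l2" "level l1 l2 l3 2 = l3"
  by (simp_all add: level_def)

lemma sum_mbox:
  "(\<Sum>y\<in>mbox l. F (y 0) (y 1) (y 2)) =
     (\<Sum>m1\<in>{- int (l 0)..int (l 0)}. \<Sum>m2\<in>{- int (l 1)..int (l 1)}. \<Sum>m3\<in>{- int (l 2)..int (l 2)}. F m1 m2 m3)"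
proof -
  let ?f = "\<lambda>(m1, m2, m3). \<lambda>i\<in>{..<3::nat}. if i = 0 then m1 else if i = 1 then m2 else (m3 :: int)"
  have "(\<Sum>y\<in>mbox l. F (y 0) (y 1) (y 2)) = (\<Sum>(m1, m2, m3)\<in>{- int (l 0)..int (l 0)} \<times> {- int (l 1)..int (l 1)} \<times> {- int (l 2)..int (l 2)}. F m1 m2 m3)"
  proof (rule sum.reindex_bij_witness[of _ ?f "\<lambda>y. (y 0, y 1, y 2)"])
    fix y assume y: "y \<in> mbox l"
    show "?f (y 0, y 1, y 2) = y"
    proof
      fix i show "?f (y 0, y 1, y 2) i = y i"
      proof (cases "i < 3")
        case True
        then have "i = 0 \<or> i = 1 \<or> i = 2" by auto
        then show ?thesis by auto
      next
        case False
        then show ?thesis using PiE_arb[OF y[unfolded mbox_def], of i] by simp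
      qed
    qed
    have "y i \<in> {- int (l i)..int (l i)}" if "i < 3" for i
      using PiE_mem[OF y[unfolded mbox_def], of i] that by simp
    from this[of 0] this[of 1] this[of 2]
    show "(y 0, y 1, y 2) \<in> {- int (l 0)..int (l 0)} \<times> {- int (l 1)..int (l 1)} \<times> {- int (l 2)..int (l 2)}" by simp
  next
    fix b assume b: "b \<in> {- int (l 0)..int (l 0)} \<times> {- int (l 1)..int (l 1)} \<times> {- int (l 2)..int (l 2)}"
    obtain m1 m2 m3 where bb: "b = (m1, m2, m3)" by (metis prod_cases3)
    have "(if i = 0 then m1 else if i = 1 then m2 else m3) \<in> {- int (l i)..int (l i)}" if "i < 3" for i
    proof -
      have "i = 0 \<or> i = 1 \<or> i = 2" using that by auto
      then show ?thesis using b bb by auto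
    qed
    then show "?f b \<in> mbox l" unfolding mbox_def bb by (simp add: restrict_PiE_iff)
  qed auto
  then show ?thesis by (simp add: sum.cartesian_product)
qed

text \<open>The two adjacent swaps generate all six column permutations; triangle and parity
  conditions are carried along because each swap asks for them.\<close>

lemma signed_w3_perm:
  fixes y :: "nat \<Rightarrow> int" and l :: "nat \<Rightarrow> nat"
  assumes tri: "w3_triangle (int (l 0)) (int (l 1)) (int (l 2))" and ev: "even (int (l 0) + int (l 1) + int (l 2))"
    and ijk: "{..<3} = {i, j, k}"
  shows "signed_w3 (int (l i)) (int (l j)) (int (l k)) (y i) (y j) (y k) = signed_w3 (int (l 0)) (int (l 1)) (int (l 2)) (y 0) (y 1) (y 2)"
    and "w3_triangle (int (l i)) (int (l j)) (int (l k))" "even (int (l i) + int (l j) + int (l k))"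
proof -
  have "i < 3" "j < 3" "k < 3" using ijk by auto
  moreover have "i \<noteq> j \<and> j \<noteq> k \<and> i \<noteq> k"
  proof -
    have "card {i, j, k} = 3" unfolding ijk[symmetric] by simp
    then show ?thesis by (auto simp: card_insert_if split: if_splits)
  qed
  ultimately consider "i = 0" "j = 1" "k = 2" | "i = 0" "j = 2" "k = 1" | "i = 1" "j = 0" "k = 2"
    | "i = 1" "j = 2" "k = 0" | "i = 2" "j = 0" "k = 1" | "i = 2" "j = 1" "k = 0"
    unfolding in_lessThan_3 by blast
  note cs = this
  from cs show tri': "w3_triangle (int (l i)) (int (l j)) (int (l k))"
    by cases (use tri in \<open>auto simp: w3_triangle_def\<close>)
  from cs show ev': "even (int (l i) + int (l j) + int (l k))"
    by cases (use ev in \<open>auto simp: add_ac\<close>)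
  have s12: "signed_w3 (int (l a)) (int (l b)) (int (l c)) (y a) (y b) (y c) = signed_w3 (int (l b)) (int (l a)) (int (l c)) (y b) (y a) (y c)"
    if "w3_triangle (int (l a)) (int (l b)) (int (l c))" "even (int (l a) + int (l b) + int (l c))" for a b c
    by (rule signed_w3_swap12[OF that])
  have s23: "signed_w3 (int (l a)) (int (l b)) (int (l c)) (y a) (y b) (y c) = signed_w3 (int (l a)) (int (l c)) (int (l b)) (y a) (y c) (y b)"
    if "w3_triangle (int (l a)) (int (l b)) (int (l c))" "even (int (l a) + int (l b) + int (l c))" for a b c
    by (rule signed_w3_swap23[OF that])
  have t: "w3_triangle a b c \<longleftrightarrow> w3_triangle b a c" "w3_triangle a b c \<longleftrightarrow> w3_triangle a c b" for a b c
    by (auto simp: w3_triangle_def)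
  have e: "even (a + b + c) \<longleftrightarrow> even (b + a + c)" "even (a + b + c) \<longleftrightarrow> even (a + c + b)" for a b c :: int
    by auto
  from cs show "signed_w3 (int (l i)) (int (l j)) (int (l k)) (y i) (y j) (y k) = signed_w3 (int (l 0)) (int (l 1)) (int (l 2)) (y 0) (y 1) (y 2)"
  proof cases
    case 2 then show ?thesis using s23 tri' ev' by metis
  next
    case 3 then show ?thesis using s12 tri' ev' by metis
  next
    case 4 then show ?thesis using s12[of 0 1 2] s23[of 1 0 2] tri ev t e by metis
  next
    case 5 then show ?thesis using s23[of 0 1 2] s12[of 0 2 1] tri ev t e by metis
  next
    case 6 then show ?thesis using s12[of 0 1 2] s23[of 1 0 2] s12[of 1 2 0] tri ev t e by metis
  qed simp
qed

lemma distinct_indices: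
  assumes "{..<3} = {i, j, k::nat}"
  shows "i < 3" "j < 3" "k < 3" "i \<noteq> j" "j \<noteq> k" "i \<noteq> k" "\<And>n. n < 3 \<Longrightarrow> n = i \<or> n = j \<or> n = k"
proof -
  have "card {i, j, k} = 3" unfolding assms[symmetric] by simp
  then show "i \<noteq> j" "j \<noteq> k" "i \<noteq> k" by (auto simp: card_insert_if split: if_splits)
qed (use assms in blast)+

lemma sum_mbox_fix1:
  assumes ijk: "{..<3} = {i, j, k}" and \<mu>: "\<bar>\<mu>\<bar> \<le> int (l k)"
  shows "(\<Sum>y\<in>{y\<in>mbox l. y k = \<mu>}. F (y i) (y j)) = (\<Sum>m\<in>{- int (l i)..int (l i)}. \<Sum>m'\<in>{- int (l j)..int (l j)}. F m m')"
proof -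
  note d = distinct_indices[OF ijk]
  let ?f = "\<lambda>(m, m'). \<lambda>n\<in>{..<3}. if n = i then m else if n = j then m' else \<mu>"
  have "(\<Sum>y\<in>{y\<in>mbox l. y k = \<mu>}. F (y i) (y j)) = (\<Sum>(m, m')\<in>{- int (l i)..int (l i)} \<times> {- int (l j)..int (l j)}. F m m')"
  proof (rule sum.reindex_bij_witness[of _ ?f "\<lambda>y. (y i, y j)"])
    fix y assume "y \<in> {y\<in>mbox l. y k = \<mu>}"
    then have y: "y \<in> mbox l" and yk: "y k = \<mu>" by auto
    show "?f (y i, y j) = y"
    proof
      fix n show "?f (y i, y j) n = y n"
      proof (cases "n < 3")
        case True
        then have "n = i \<or> n = j \<or> n = k" by (rule d(7))
        then show ?thesis using True yk d(4-6) by auto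
      next
        case False
        then show ?thesis using PiE_arb[OF y[unfolded mbox_def], of n] by simp
      qed
    qed
    show "(y i, y j) \<in> {- int (l i)..int (l i)} \<times> {- int (l j)..int (l j)}"
      using PiE_mem[OF y[unfolded mbox_def], of i] PiE_mem[OF y[unfolded mbox_def], of j] d by simp
  next
    fix b assume b: "b \<in> {- int (l i)..int (l i)} \<times> {- int (l j)..int (l j)}"
    obtain m m' where bb: "b = (m, m')" by force
    have "(if n = i then m else if n = j then m' else \<mu>) \<in> {- int (l n)..int (l n)}" if "n < 3" for n
      using d(7)[OF that] b bb d(4-6) \<mu> by (elim disjE) auto
    moreover have "?f b k = \<mu>" using d by (simp add: bb)
    ultimately show "?f b \<in> {y\<in>mbox l. y k = \<mu>}" unfolding mbox_def bb by (simp add: restrict_PiE_iff)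
    show "(?f b i, ?f b j) = b" using d by (simp add: bb)
  qed auto
  then show ?thesis by (simp add: sum.cartesian_product)
qed

lemma sum_mbox_loop:
  assumes ijk: "{..<3} = {i, j, k}" and lij: "l i = l j"
  shows "(\<Sum>y\<in>{y\<in>mbox l. y i = - y j \<and> y k = 0}. F (y i)) = (\<Sum>m\<in>{- int (l i)..int (l i)}. F m)"
proof -
  note d = distinct_indices[OF ijk]
  let ?f = "\<lambda>m. \<lambda>n\<in>{..<3}. if n = i then m else if n = j then - m else (0::int)"
  show ?thesis
  proof (rule sum.reindex_bij_witness[of _ ?f "\<lambda>y. y i"])
    fix y assume "y \<in> {y\<in>mbox l. y i = - y j \<and> y k = 0}"
    then have y: "y \<in> mbox l" and yk: "y i = - y j" "y k = 0" by auto
    show "?f (y i) = y"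
    proof
      fix n show "?f (y i) n = y n"
      proof (cases "n < 3")
        case True
        then have "n = i \<or> n = j \<or> n = k" by (rule d(7))
        then show ?thesis using True yk d(4-6) by auto
      next
        case False
        then show ?thesis using PiE_arb[OF y[unfolded mbox_def], of n] by simp
      qed
    qed
    show "y i \<in> {- int (l i)..int (l i)}"
      using PiE_mem[OF y[unfolded mbox_def], of i] d by simp
  next
    fix m assume m: "m \<in> {- int (l i)..int (l i)}"
    have "(if n = i then m else if n = j then - m else 0) \<in> {- int (l n)..int (l n)}" if "n < 3" for n
      using d(7)[OF that] m d(4-6) lij by (elim disjE) auto
    moreover have "?f m i = - ?f m j" "?f m k = 0" using d by simp_all
    ultimately show "?f m \<in> {y\<in>mbox l. y i = - y j \<and> y k = 0}" unfolding mbox_def by (simp add: restrict_PiE_iff)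
    show "?f m i = m" using d by simp
  qed auto
qed

text \<open>\<open>s\<close> carries the overall sign of the bispectrum. A row in leg
  \<open>k\<close> has square sum \<open>1 / (2 * l k + 1)\<close>, weakened to the common lower
  bound \<open>L\<close> of the levels; \<open>1 <= L\<close> provides the nonzero spin that the
  loop identity needs.\<close>

lemma cubic_network_wigner:
  fixes l :: "nat \<Rightarrow> nat" and s :: real
  defines "T \<equiv> \<lambda>y. s * signed_w3 (int (l 0)) (int (l 1)) (int (l 2)) (y 0) (y 1) (y 2)"
  assumes tri: "w3_triangle (int (l 0)) (int (l 1)) (int (l 2))" and ev: "even (int (l 0) + int (l 1) + int (l 2))"
    and L: "1 \<le> L" "\<And>i. i < 3 \<Longrightarrow> L \<le> l i" and s: "s\<^sup>2 = 1"
  shows "cubic_network l T (1 / (2 * real L + 1))"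
proof
  note perm = signed_w3_perm[OF tri ev]
  have sq: "(T y)\<^sup>2 = (signed_w3 (int (l 0)) (int (l 1)) (int (l 2)) (y 0) (y 1) (y 2))\<^sup>2" for y
    by (simp add: T_def power_mult_distrib s)
  show "m 0 + m 1 + m 2 = 0" if "T m \<noteq> 0" for m
    using that signed_w3_eq_0[of "m 0" "m 1" "m 2"] unfolding T_def by auto
  show "0 \<le> 1 / (2 * real L + 1)" "1 / (2 * real L + 1) \<le> 1" by auto
  show "(\<Sum>m\<in>{m\<in>mbox l. m k = \<mu>}. (T m)\<^sup>2) \<le> 1 / (2 * real L + 1)" if k: "k < 3" for k \<mu>
  proof (cases "\<bar>\<mu>\<bar> \<le> int (l k)")
    case True
    obtain i j where ijk: "{..<3} = {i, j, k}"
    proof -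
      have "k = 0 \<or> k = 1 \<or> k = 2" using k by auto
      then have "{..<3} = {1, 2, k} \<or> {..<3} = {0, 2, k} \<or> {..<3} = {0, 1, k}" unfolding lessThan_3 by auto
      then show ?thesis using that by blast
    qed
    have "(\<Sum>m\<in>{m\<in>mbox l. m k = \<mu>}. (T m)\<^sup>2) = (\<Sum>m\<in>{m\<in>mbox l. m k = \<mu>}. (signed_w3 (int (l i)) (int (l j)) (int (l k)) (m i) (m j) \<mu>)\<^sup>2)"
      unfolding sq perm(1)[OF ijk, symmetric] by (rule sum.cong) auto
    also have "\<dots> = 1 / (2 * of_int (int (l k)) + 1)"
      unfolding sum_mbox_fix1[where l = l and F = "\<lambda>m m'. (signed_w3 (int (l i)) (int (l j)) (int (l k)) m m' \<mu>)\<^sup>2", OF ijk True] by (rule signed_w3_row[OF perm(2)[OF ijk] perm(3)[OF ijk] True])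
    also have "\<dots> \<le> 1 / (2 * real L + 1)" using L(2)[OF k] by (simp add: frac_le)
    finally show ?thesis .
  next
    case False
    have "{m\<in>mbox l. m k = \<mu>} = {}"
      using False k by (auto simp: mbox_def dest!: PiE_mem[of _ _ _ k])
    then show ?thesis by (simp only: sum.empty) simp
  qed
  show "(\<Sum>m\<in>mbox l. (T m)\<^sup>2) = 1"
  proof -
    have "(\<Sum>m\<in>mbox l. (T m)\<^sup>2) = (\<Sum>m1\<in>{- int (l 0)..int (l 0)}. \<Sum>m2\<in>{- int (l 1)..int (l 1)}. \<Sum>m3\<in>{- int (l 2)..int (l 2)}.
        (signed_w3 (int (l 0)) (int (l 1)) (int (l 2)) m1 m2 m3)\<^sup>2)"
      unfolding sq by (rule sum_mbox[where F = "\<lambda>m1 m2 m3. (signed_w3 (int (l 0)) (int (l 1)) (int (l 2)) m1 m2 m3)\<^sup>2"])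
    also have "\<dots> = (\<Sum>m1\<in>{- int (l 0)..int (l 0)}. \<Sum>m3\<in>{- int (l 2)..int (l 2)}. \<Sum>m2\<in>{- int (l 1)..int (l 1)}.
        (signed_w3 (int (l 0)) (int (l 1)) (int (l 2)) m1 m2 m3)\<^sup>2)"
      by (intro sum.cong refl sum.swap)
    also have "\<dots> = (\<Sum>m3\<in>{- int (l 2)..int (l 2)}. \<Sum>m1\<in>{- int (l 0)..int (l 0)}. \<Sum>m2\<in>{- int (l 1)..int (l 1)}.
        (signed_w3 (int (l 0)) (int (l 1)) (int (l 2)) m1 m2 m3)\<^sup>2)"
      by (rule sum.swap)
    \<comment> \<open>Each of the \<open>2 * l 2 + 1\<close> rows has the same square sum.\<close>
    also have "\<dots> = (\<Sum>m3\<in>{- int (l 2)..int (l 2)}. 1 / (2 * of_int (int (l 2)) + 1))"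
      by (intro sum.cong refl signed_w3_row[OF tri ev]) auto
    also have "\<dots> = 1" by (simp add: add.commute)
    finally show ?thesis .
  qed
  show "T (\<lambda>i\<in>{..<3}. - m (\<sigma> i)) = T m" if \<sigma>: "\<sigma> permutes {..<3}" and l: "\<forall>i<3. l (\<sigma> i) = l i" for \<sigma> m
  proof -
    have "{..<3} = \<sigma> ` {0, 1, 2}" using permutes_image[OF \<sigma>] unfolding lessThan_3 by simp
    then have *: "{..<3} = {\<sigma> 0, \<sigma> 1, \<sigma> 2}" by simp
    have "T (\<lambda>i\<in>{..<3}. - m (\<sigma> i)) = s * signed_w3 (int (l 0)) (int (l 1)) (int (l 2)) (m (\<sigma> 0)) (m (\<sigma> 1)) (m (\<sigma> 2))"
      by (simp add: T_def signed_w3_neg[OF tri ev] del: One_nat_def)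
    also have "\<dots> = s * signed_w3 (int (l (\<sigma> 0))) (int (l (\<sigma> 1))) (int (l (\<sigma> 2))) (m (\<sigma> 0)) (m (\<sigma> 1)) (m (\<sigma> 2))"
      using l by simp
    also have "\<dots> = T m" unfolding perm(1)[OF *] by (simp add: T_def)
    finally show ?thesis .
  qed
  show "(\<Sum>m\<in>{m\<in>mbox l. m i = - m j \<and> m k = \<mu>}. T m) = 0"
    if ijk: "{..<3} = {i, j, k}" and "l i = l j" for i j k \<mu>
  \<comment> \<open>The joined legs carry opposite indices, so the selection rule leaves only the
    third index 0.\<close>
  proof (cases "\<mu> = 0")
    case True
    have "(\<Sum>m\<in>{m\<in>mbox l. m i = - m j \<and> m k = \<mu>}. T m) =
      (\<Sum>m\<in>{m\<in>mbox l. m i = - m j \<and> m k = 0}. s * signed_w3 (int (l i)) (int (l i)) (int (l k)) (m i) (- m i) 0)"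
      using True \<open>l i = l j\<close> unfolding T_def perm(1)[OF ijk, symmetric] by (intro sum.cong) auto
    also have "\<dots> = s * (\<Sum>m\<in>{- int (l i)..int (l i)}. signed_w3 (int (l i)) (int (l i)) (int (l k)) m (- m) 0)"
      unfolding sum_mbox_loop[where l = l and F = "\<lambda>m. s * signed_w3 (int (l i)) (int (l i)) (int (l k)) m (- m) 0", OF ijk \<open>l i = l j\<close>] sum_distrib_left ..
    also have "\<dots> = 0"
      using perm(2,3)[OF ijk] L(1) L(2)[of k] distinct_indices[OF ijk] \<open>l i = l j\<close> by (subst signed_w3_loop) auto
    finally show ?thesis .
  next
    case False
    have "T m = 0" if "m i = - m j" "m k = \<mu>" for m
      unfolding T_def perm(1)[OF ijk, symmetric] using that False by (simp add: signed_w3_eq_0)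
    then show ?thesis by (intro sum.neutral) auto
  qed
qed

section \<open>Level-preserving permutations of three legs\<close>

lemma permutes_3_eqI:
  assumes "\<sigma> permutes {..<3::nat}" "\<tau> permutes {..<3}" "\<sigma> 0 = \<tau> 0" "\<sigma> 1 = \<tau> 1" "\<sigma> 2 = \<tau> 2"
  shows "\<sigma> = \<tau>"
proof
  fix i show "\<sigma> i = \<tau> i"
  proof (cases "i < 3")
    case True
    then have "i = 0 \<or> i = 1 \<or> i = 2" by auto
    then show ?thesis using assms by auto
  next
    case False
    then show ?thesis using permutes_not_in[OF assms(1), of i] permutes_not_in[OF assms(2), of i] by simp
  qed
qed

lemma card_automorphisms:
  assumes "l1 \<le> l2" "l2 \<le> l3"
  shows "card {\<sigma>. \<sigma> permutes {..<3} \<and> (\<forall>i<3. level l1 l2 l3 (\<sigma> i) = level l1 l2 l3 i)} = Delta3 l1 l2 l3"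
proof -
  let ?l = "level l1 l2 l3" and ?A = "{\<sigma>. \<sigma> permutes {..<3} \<and> (\<forall>i<3. level l1 l2 l3 (\<sigma> i) = level l1 l2 l3 i)}"
  have A: "\<sigma> 0 < 3" "\<sigma> 1 < 3" "\<sigma> 2 < 3" "\<sigma> 0 \<noteq> \<sigma> 1" "\<sigma> 1 \<noteq> \<sigma> 2" "\<sigma> 0 \<noteq> \<sigma> 2"
    "?l (\<sigma> 0) = l1" "?l (\<sigma> 1) = l2" "?l (\<sigma> 2) = l3" "\<sigma> permutes {..<3}" if "\<sigma> \<in> ?A" for \<sigma>
  proof -
    have \<sigma>: "\<sigma> permutes {..<3}" and l: "\<forall>i<3. ?l (\<sigma> i) = ?l i" using that by auto
    show "\<sigma> permutes {..<3}" by fact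
    show "\<sigma> 0 < 3" "\<sigma> 1 < 3" "\<sigma> 2 < 3"
      using permutes_in_image[OF \<sigma>, of 0] permutes_in_image[OF \<sigma>, of 1] permutes_in_image[OF \<sigma>, of 2] by auto
    show "\<sigma> 0 \<noteq> \<sigma> 1" "\<sigma> 1 \<noteq> \<sigma> 2" "\<sigma> 0 \<noteq> \<sigma> 2"
      using inj_eq[OF permutes_inj[OF \<sigma>]] by auto
    show "?l (\<sigma> 0) = l1" "?l (\<sigma> 1) = l2" "?l (\<sigma> 2) = l3" using l by (auto simp: level_simps)
  qed
  consider "l1 = l2" "l2 = l3" | "l1 = l2" "l2 < l3" | "l1 < l2" "l2 = l3" | "l1 < l2" "l2 < l3" using assms by linarith
  then show ?thesis
  proof cases
    case 1
    then have "?A = {\<sigma>. \<sigma> permutes {..<3}}" by (auto simp: level_def)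
    moreover have "card {\<sigma>. \<sigma> permutes {..<3::nat}} = fact 3" by (rule card_permutations) auto
    ultimately show ?thesis using 1 by (simp add: Delta3_def fact_numeral)
  next
    case 2
    let ?t = "Transposition.transpose 0 (1::nat)"
    have t: "?t permutes {..<3}" by (rule permutes_swap_id) auto
    have "?A = {id, ?t}"
    proof (intro equalityI subsetI)
      fix \<sigma> assume "\<sigma> \<in> ?A"
      note a = A[OF this]
      have "\<sigma> 2 = 2" using a(3,9) 2 by (auto simp: level_def split: if_splits)
      then have "(\<sigma> 0 = 0 \<and> \<sigma> 1 = 1) \<or> (\<sigma> 0 = 1 \<and> \<sigma> 1 = 0)" using a by auto
      then show "\<sigma> \<in> {id, ?t}"
        using \<open>\<sigma> 2 = 2\<close> permutes_3_eqI[OF a(10) permutes_id] permutes_3_eqI[OF a(10) t] by (auto simp: transpose_def)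
    next
      fix \<sigma> assume "\<sigma> \<in> {id, ?t}"
      then show "\<sigma> \<in> ?A" using 2 t by (auto simp: level_def transpose_def permutes_id)
    qed
    moreover have "id \<noteq> ?t" by (metis id_apply transpose_apply_first zero_neq_one)
    ultimately show ?thesis using 2 by (simp add: Delta3_def)
  next
    case 3
    let ?t = "Transposition.transpose 1 (2::nat)"
    have t: "?t permutes {..<3}" by (rule permutes_swap_id) auto
    have "?A = {id, ?t}"
    proof (intro equalityI subsetI)
      fix \<sigma> assume "\<sigma> \<in> ?A"
      note a = A[OF this]
      have "\<sigma> 0 = 0" using a(1,7) 3 by (auto simp: level_def split: if_splits)
      then have "(\<sigma> 1 = 1 \<and> \<sigma> 2 = 2) \<or> (\<sigma> 1 = 2 \<and> \<sigma> 2 = 1)" using a by auto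
      then show "\<sigma> \<in> {id, ?t}"
        using \<open>\<sigma> 0 = 0\<close> permutes_3_eqI[OF a(10) permutes_id] permutes_3_eqI[OF a(10) t] by (auto simp: transpose_def)
    next
      fix \<sigma> assume "\<sigma> \<in> {id, ?t}"
      then show "\<sigma> \<in> ?A" using 3 t by (auto simp: level_def transpose_def permutes_id in_lessThan_3)
    qed
    moreover have "id \<noteq> ?t" by (metis id_apply transpose_apply_first numeral_eq_one_iff semiring_norm(85))
    ultimately show ?thesis using 3 by (simp add: Delta3_def)
  next
    case 4
    have "?A = {id}"
    proof (intro equalityI subsetI)
      fix \<sigma> assume "\<sigma> \<in> ?A"
      note a = A[OF this]
      have "\<sigma> 0 = 0" "\<sigma> 1 = 1" "\<sigma> 2 = 2" using a(1-3,7-9) 4 by (auto simp: level_def split: if_splits)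
      then show "\<sigma> \<in> {id}" using permutes_3_eqI[OF a(10) permutes_id] by simp
    qed (auto simp: permutes_id)
    then show ?thesis using 4 by (simp add: Delta3_def)
  qed
qed

section \<open>Moments of the normalized bispectrum\<close>

text \<open>Coordinates of \<open>i^|m| * a l m / sqrt (C l)\<close> with respect to the
  standardized real and imaginary parts; for \<open>m < 0\<close> the relation between
  \<open>a l m\<close> and the conjugate of \<open>a l (- m)\<close> is built in.\<close>

definition mode_coeff :: "nat \<Rightarrow> int \<Rightarrow> nat \<times> int \<times> bool \<Rightarrow> complex" where
  "mode_coeff l m = (\<lambda>(l', m', b). if l' = l \<and> m' = \<bar>m\<bar> then
     (if m = 0 then 1 else \<i> ^ nat \<bar>m\<bar> / of_real (sqrt 2) * (if 0 < m then 1 else (-1) ^ nat \<bar>m\<bar>) *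
        (if b then 1 else if 0 < m then \<i> else - \<i>)) else 0)"

text \<open>Truncation at level \<open>L\<close> makes the family finite; for \<open>m = 0\<close>
  only the real part is a random variable.\<close>

definition modes :: "nat \<Rightarrow> (nat \<times> int \<times> bool) set" where
  "modes L = {(l, m, b). 1 \<le> l \<and> l \<le> L \<and> 0 \<le> m \<and> m \<le> int l \<and> (b \<or> 1 \<le> m)}"

lemma finite_modes: "finite (modes L)"
proof (rule finite_subset)
  show "modes L \<subseteq> {..L} \<times> {0..int L} \<times> UNIV" by (auto simp: modes_def)
qed auto

lemma sum_modes_supported:
  fixes f :: "nat \<times> int \<times> bool \<Rightarrow> complex"
  assumes "1 \<le> l" "l \<le> L" "\<bar>m\<bar> \<le> int l" and f: "\<And>l' m' b. \<not> (l' = l \<and> m' = \<bar>m\<bar>) \<Longrightarrow> f (l', m', b) = 0"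
  shows "(\<Sum>j\<in>modes L. f j) = f (l, \<bar>m\<bar>, True) + (if m = 0 then 0 else f (l, \<bar>m\<bar>, False))"
proof -
  let ?S = "{(l, \<bar>m\<bar>, True)} \<union> (if m = 0 then {} else {(l, \<bar>m\<bar>, False)})"
  have "(\<Sum>j\<in>modes L. f j) = (\<Sum>j\<in>?S. f j)"
  proof (rule sum.mono_neutral_right[OF finite_modes])
    show "?S \<subseteq> modes L" using assms by (auto simp: modes_def)
    show "\<forall>j\<in>modes L - ?S. f j = 0"
    proof
      fix j assume j: "j \<in> modes L - ?S"
      obtain l' m' b where e: "j = (l', m', b)" by (metis prod_cases3)
      have "\<not> (l' = l \<and> m' = \<bar>m\<bar>)" using j e by (cases b) (auto simp: modes_def split: if_splits)
      then show "f j = 0" unfolding e by (rule f)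
    qed
  qed
  then show ?thesis by simp
qed

text \<open>For \<open>m' = m\<close> nonzero, real and imaginary part cancel because of
  \<open>i^2 = -1\<close>. For \<open>m' = - m\<close> they add up, and the phase
  \<open>i^(2|m|)\<close> cancels the \<open>(-1)^|m|\<close> of the conjugation relation.\<close>

lemma mode_coeff_covariance:
  assumes "1 \<le> l" "l \<le> L" "\<bar>m\<bar> \<le> int l"
  shows "(\<Sum>j\<in>modes L. mode_coeff l m j * mode_coeff l' m' j) = of_bool (l = l' \<and> m = - m')"
proof -
  have "(\<Sum>j\<in>modes L. mode_coeff l m j * mode_coeff l' m' j) = mode_coeff l m (l, \<bar>m\<bar>, True) * mode_coeff l' m' (l, \<bar>m\<bar>, True)
     + (if m = 0 then 0 else mode_coeff l m (l, \<bar>m\<bar>, False) * mode_coeff l' m' (l, \<bar>m\<bar>, False))"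
    by (rule sum_modes_supported[OF assms]) (auto simp: mode_coeff_def)
  also have "\<dots> = of_bool (l = l' \<and> m = - m')"
  proof (cases "l = l' \<and> \<bar>m\<bar> = \<bar>m'\<bar>")
    case False
    then show ?thesis by (auto simp: mode_coeff_def)
  next
    case True
    define k where "k = nat \<bar>m\<bar>"
    have ii: "\<i> ^ k * \<i> ^ k = (-1) ^ k" by (simp flip: power_mult_distrib)
    have mm: "(-1::complex) ^ k * (-1) ^ k = 1" by (simp flip: power_mult_distrib)
    have s2: "complex_of_real (sqrt 2) * complex_of_real (sqrt 2) = 2" by (simp flip: of_real_mult)
    have nz: "complex_of_real (sqrt 2) \<noteq> 0" by simp
    have k': "nat \<bar>m'\<bar> = k" using True by (simp add: k_def)
    consider "m = 0" "m' = 0" | "m \<noteq> 0" "m' = m" | "m > 0" "m' = - m" | "m < 0" "m' = - m" using True by linarith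
    then show ?thesis
    proof cases
      case 1
      then show ?thesis using True by (simp add: mode_coeff_def)
    next
      case 2
      then show ?thesis using True by (simp add: mode_coeff_def algebra_simps)
    next
      case 3
      have p1: "mode_coeff l m (l, \<bar>m\<bar>, True) * mode_coeff l' m' (l, \<bar>m\<bar>, True) =
        ((\<i> ^ k * \<i> ^ k) * (-1) ^ k) / (complex_of_real (sqrt 2) * complex_of_real (sqrt 2))"
        using 3 True k' by (simp add: mode_coeff_def k_def mult_ac)
      have p2: "mode_coeff l m (l, \<bar>m\<bar>, False) * mode_coeff l' m' (l, \<bar>m\<bar>, False) =
        ((\<i> ^ k * \<i> ^ k) * (-1) ^ k) / (complex_of_real (sqrt 2) * complex_of_real (sqrt 2))"
        using 3 True k' by (simp add: mode_coeff_def k_def mult_ac)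
      have c: "(l = l' \<and> m = - m') = True" "(m = 0) = False" using 3 True by auto
      show ?thesis unfolding p1 p2 c ii mm s2 by simp
    next
      case 4
      have p1: "mode_coeff l m (l, \<bar>m\<bar>, True) * mode_coeff l' m' (l, \<bar>m\<bar>, True) =
        ((\<i> ^ k * \<i> ^ k) * (-1) ^ k) / (complex_of_real (sqrt 2) * complex_of_real (sqrt 2))"
        using 4 True k' by (simp add: mode_coeff_def k_def mult_ac)
      have p2: "mode_coeff l m (l, \<bar>m\<bar>, False) * mode_coeff l' m' (l, \<bar>m\<bar>, False) =
        ((\<i> ^ k * \<i> ^ k) * (-1) ^ k) / (complex_of_real (sqrt 2) * complex_of_real (sqrt 2))"
        using 4 True k' by (simp add: mode_coeff_def k_def mult_ac)
      have c: "(l = l' \<and> m = - m') = True" "(m = 0) = False" using 4 True by auto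
      show ?thesis unfolding p1 p2 c ii mm s2 by simp
    qed
  qed
  finally show ?thesis .
qed

text \<open>On the support \<open>m1 + m2 + m3 = 0\<close> the exponent is an even number
  \<open>2 n\<close>, and \<open>(-i)^(2 n) = (-1)^n\<close>; elsewhere both sides vanish.\<close>

lemma neg_i_power_wigner3j:
  "(- \<i>) ^ (nat \<bar>m1\<bar> + nat \<bar>m2\<bar> + nat \<bar>m3\<bar>) * complex_of_real (wigner3j j1 j2 j3 m1 m2 m3) =
     of_real (signed_w3 j1 j2 j3 m1 m2 m3)"
proof (cases "m1 + m2 + m3 = 0")
  case True
  have "even (\<bar>m1\<bar> + \<bar>m2\<bar> + \<bar>m3\<bar>) \<longleftrightarrow> even (m1 + m2 + m3)" by simp
  then have "even (nat \<bar>m1\<bar> + nat \<bar>m2\<bar> + nat \<bar>m3\<bar>)" using True by (simp add: even_nat_iff)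
  then obtain n where n: "nat \<bar>m1\<bar> + nat \<bar>m2\<bar> + nat \<bar>m3\<bar> = 2 * n" by blast
  show ?thesis unfolding signed_w3_def n by (simp add: power_mult)
qed (simp add: signed_w3_def wigner3j_eq_0)

locale gaussian_coeffs =
  fixes M :: "'a measure" and C :: "nat \<Rightarrow> real" and a :: "nat \<Rightarrow> int \<Rightarrow> 'a \<Rightarrow> complex" and L :: nat
  assumes field: "isotropic_gaussian_coeffs M C a"
begin

definition mode_sd :: "nat \<times> int \<times> bool \<Rightarrow> real" where
  "mode_sd = (\<lambda>(l, m, b). if m = 0 then sqrt (C l) else sqrt (C l / 2))"

definition mode :: "nat \<times> int \<times> bool \<Rightarrow> 'a \<Rightarrow> real" where
  "mode = (\<lambda>(l, m, b) x. (if b then Re (a l m x) else Im (a l m x)) / mode_sd (l, m, b))"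

sublocale std_gaussian_family M mode "modes L"
proof -
  note F = field[unfolded isotropic_gaussian_coeffs_def]
  interpret prob_space M using F by blast
  show "std_gaussian_family M mode (modes L)"
  proof
    show "finite (modes L)" by (rule finite_modes)
    have "indep_vars (\<lambda>_. borel) (\<lambda>(l, m, b) x. if b then Re (a l m x) else Im (a l m x))
        {(l, m, b). 1 \<le> l \<and> 0 \<le> m \<and> m \<le> int l \<and> (b \<or> 1 \<le> m)}" using F by blast
    then have "indep_vars (\<lambda>_. borel) (\<lambda>(l, m, b) x. if b then Re (a l m x) else Im (a l m x)) (modes L)"
      by (rule indep_vars_subset) (auto simp: modes_def)
    then have "indep_vars (\<lambda>_. borel) (\<lambda>j x. (\<lambda>y. y / mode_sd j) ((\<lambda>(l, m, b) x. if b then Re (a l m x) else Im (a l m x)) j x)) (modes L)"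
      by (rule indep_vars_compose2) simp
    also have "(\<lambda>j x. (\<lambda>y. y / mode_sd j) ((\<lambda>(l, m, b) x. if b then Re (a l m x) else Im (a l m x)) j x)) = mode"
      by (auto simp: mode_def fun_eq_iff)
    finally show "indep_vars (\<lambda>_. borel) mode (modes L)" .
    fix j assume j: "j \<in> modes L"
    obtain l m b where e: "j = (l, m, b)" by (metis prod_cases3)
    have l: "1 \<le> l" "0 \<le> m" "m \<le> int l" "b \<or> 1 \<le> m" using j e by (auto simp: modes_def)
    have C: "0 < C l" using F l by blast
    have d: "distributed M lborel (\<lambda>x. if b then Re (a l m x) else Im (a l m x)) (normal_density 0 (mode_sd j))"
    proof (cases "m = 0")
      case True
      then show ?thesis using F l e by (auto simp: mode_sd_def)
    next
      case False
      then have "1 \<le> m" using l by simp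
      then have "distributed M lborel (\<lambda>x. Re (a l m x)) (normal_density 0 (sqrt (C l / 2)))"
        "distributed M lborel (\<lambda>x. Im (a l m x)) (normal_density 0 (sqrt (C l / 2)))" using F l by blast+
      then show ?thesis using False e by (cases b) (auto simp: mode_sd_def)
    qed
    have "0 < mode_sd j" using C e by (auto simp: mode_sd_def)
    from normal_standard_normal_convert[OF this, THEN iffD1, OF d]
    have "distributed M lborel (\<lambda>x. ((if b then Re (a l m x) else Im (a l m x)) - 0) / mode_sd j) std_normal_density" .
    then show "distributed M lborel (mode j) std_normal_density" by (simp add: mode_def e)
  qed
qed

lemma coeff_eq_lin:
  assumes "1 \<le> l" "l \<le> L" "\<bar>m\<bar> \<le> int l" "x \<in> space M"
  shows "a l m x = of_real (sqrt (C l)) * (- \<i>) ^ nat \<bar>m\<bar> * lin (mode_coeff l m) x"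
proof -
  note F = field[unfolded isotropic_gaussian_coeffs_def]
  have C: "0 < C l" using F assms by blast
  define k where "k = nat \<bar>m\<bar>"
  have one: "(- \<i>) ^ k * \<i> ^ k = 1" by (simp flip: power_mult_distrib)
  have mm: "(-1::complex) ^ k * (-1) ^ k = 1" by (simp flip: power_mult_distrib)
  have sC: "sqrt (C l / 2) * sqrt 2 = sqrt (C l)" by (simp flip: real_sqrt_mult)
  then have sC': "complex_of_real (sqrt (C l)) / complex_of_real (sqrt 2) = complex_of_real (sqrt (C l / 2))"
    by (metis nonzero_mult_div_cancel_right of_real_divide real_sqrt_eq_zero_cancel_iff zero_neq_numeral)
  have nz: "complex_of_real (sqrt (C l)) \<noteq> 0" "complex_of_real (sqrt (C l / 2)) \<noteq> 0" using C by auto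
  have lin: "lin (mode_coeff l m) x = mode_coeff l m (l, \<bar>m\<bar>, True) * of_real (mode (l, \<bar>m\<bar>, True) x)
    + (if m = 0 then 0 else mode_coeff l m (l, \<bar>m\<bar>, False) * of_real (mode (l, \<bar>m\<bar>, False) x))"
    unfolding lin_def by (rule sum_modes_supported[OF assms(1-3)]) (auto simp: mode_coeff_def)
  consider "m = 0" | "m > 0" | "m < 0" by linarith
  then show ?thesis
  proof cases
    case 1
    then have "Im (a l 0 x) = 0" using F assms by blast
    then have "a l 0 x = of_real (Re (a l 0 x))" by (simp add: complex_eq_iff)
    moreover have "lin (mode_coeff l m) x = of_real (Re (a l 0 x)) / of_real (sqrt (C l))"
      unfolding lin using 1 by (simp add: mode_coeff_def mode_def mode_sd_def)
    ultimately show ?thesis using 1 nz by simp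
  next
    case 2
    have "lin (mode_coeff l m) x = \<i> ^ k / of_real (sqrt 2) * ((of_real (Re (a l m x)) + \<i> * of_real (Im (a l m x))) / of_real (sqrt (C l / 2)))"
      unfolding lin using 2 by (simp add: mode_coeff_def mode_def mode_sd_def k_def algebra_simps add_divide_distrib)
    also have "of_real (Re (a l m x)) + \<i> * of_real (Im (a l m x)) = a l m x" by (simp add: complex_eq_iff)
    finally have "of_real (sqrt (C l)) * (- \<i>) ^ k * lin (mode_coeff l m) x =
      ((- \<i>) ^ k * \<i> ^ k) * (complex_of_real (sqrt (C l)) / complex_of_real (sqrt 2)) * a l m x / of_real (sqrt (C l / 2))" by simp
    then show ?thesis unfolding one sC' using nz by (simp add: k_def)
  next
    case 3
    have am: "a l m x = (-1) ^ k * cnj (a l (- m) x)"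
    proof -
      have neg: "1 \<le> - m \<and> - m \<le> int l" using 3 assms(3) by simp
      have "a l (- (- m)) x = (-1) ^ nat (- m) * cnj (a l (- m) x)" using F assms(1,4) neg by blast
      then show ?thesis using 3 by (simp add: k_def)
    qed
    have "lin (mode_coeff l m) x = \<i> ^ k / of_real (sqrt 2) * (-1) ^ k * ((of_real (Re (a l (- m) x)) - \<i> * of_real (Im (a l (- m) x))) / of_real (sqrt (C l / 2)))"
      unfolding lin using 3 by (simp add: mode_coeff_def mode_def mode_sd_def k_def algebra_simps diff_divide_distrib)
    also have "of_real (Re (a l (- m) x)) - \<i> * of_real (Im (a l (- m) x)) = cnj (a l (- m) x)" by (simp add: complex_eq_iff)
    finally have "of_real (sqrt (C l)) * (- \<i>) ^ k * lin (mode_coeff l m) x =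
      ((- \<i>) ^ k * \<i> ^ k) * (complex_of_real (sqrt (C l)) / complex_of_real (sqrt 2)) * ((-1) ^ k * cnj (a l (- m) x)) / of_real (sqrt (C l / 2))" by simp
    then show ?thesis unfolding one sC' am using nz by (simp add: k_def)
  qed
qed

text \<open>The spectra cancel against the normalization, and the three phases
  \<open>(-i)^|m|\<close> merge with the 3j symbol into \<open>signed_w3\<close>. What remains is a
  cubic form with real coefficients in the rotated coefficients.\<close>

lemma Ibisp_eq_lin:
  assumes l: "1 \<le> l1" "1 \<le> l2" "1 \<le> l3" "l1 \<le> L" "l2 \<le> L" "l3 \<le> L" and x: "x \<in> space M"
  shows "Ibisp C a l1 l2 l3 x = (\<Sum>y\<in>mbox (level l1 l2 l3).
     of_real ((-1) ^ ((l1 + l2 + l3) div 2) * signed_w3 (int l1) (int l2) (int l3) (y 0) (y 1) (y 2)) *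
     (\<Prod>i<3. lin (mode_coeff (level l1 l2 l3 i) (y i)) x))"
proof -
  let ?s = "(-1) ^ ((l1 + l2 + l3) div 2) :: complex"
  have C: "0 < C l1" "0 < C l2" "0 < C l3" using field l unfolding isotropic_gaussian_coeffs_def by blast+
  have "?s * complex_of_real (1 / sqrt (C l1 * C l2 * C l3)) *
       (complex_of_real (wigner3j (int l1) (int l2) (int l3) m1 m2 m3) * a l1 m1 x * a l2 m2 x * a l3 m3 x)
     = of_real ((-1) ^ ((l1 + l2 + l3) div 2) * signed_w3 (int l1) (int l2) (int l3) m1 m2 m3) *
       (lin (mode_coeff l1 m1) x * lin (mode_coeff l2 m2) x * lin (mode_coeff l3 m3) x)"
    if m: "m1 \<in> {- int l1..int l1}" "m2 \<in> {- int l2..int l2}" "m3 \<in> {- int l3..int l3}" for m1 m2 m3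
  proof -
    have a: "a l1 m1 x = of_real (sqrt (C l1)) * (- \<i>) ^ nat \<bar>m1\<bar> * lin (mode_coeff l1 m1) x"
      "a l2 m2 x = of_real (sqrt (C l2)) * (- \<i>) ^ nat \<bar>m2\<bar> * lin (mode_coeff l2 m2) x"
      "a l3 m3 x = of_real (sqrt (C l3)) * (- \<i>) ^ nat \<bar>m3\<bar> * lin (mode_coeff l3 m3) x"
      by (rule coeff_eq_lin; use l m x in auto)+
    have "1 / sqrt (C l1 * C l2 * C l3) * (sqrt (C l1) * sqrt (C l2) * sqrt (C l3)) = 1"
      using C by (simp add: real_sqrt_mult)
    then have sC: "complex_of_real (1 / sqrt (C l1 * C l2 * C l3)) * (of_real (sqrt (C l1)) * of_real (sqrt (C l2)) * of_real (sqrt (C l3))) = 1"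
      by (simp only: of_real_mult[symmetric] of_real_1)
    have "?s * complex_of_real (1 / sqrt (C l1 * C l2 * C l3)) *
       (complex_of_real (wigner3j (int l1) (int l2) (int l3) m1 m2 m3) * a l1 m1 x * a l2 m2 x * a l3 m3 x)
     = (complex_of_real (1 / sqrt (C l1 * C l2 * C l3)) * (of_real (sqrt (C l1)) * of_real (sqrt (C l2)) * of_real (sqrt (C l3)))) *
       (?s * ((- \<i>) ^ (nat \<bar>m1\<bar> + nat \<bar>m2\<bar> + nat \<bar>m3\<bar>) * complex_of_real (wigner3j (int l1) (int l2) (int l3) m1 m2 m3)) *
       (lin (mode_coeff l1 m1) x * lin (mode_coeff l2 m2) x * lin (mode_coeff l3 m3) x))"
      unfolding a power_add by (simp only: mult_ac)
    also have "\<dots> = of_real ((-1) ^ ((l1 + l2 + l3) div 2) * signed_w3 (int l1) (int l2) (int l3) m1 m2 m3) *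
       (lin (mode_coeff l1 m1) x * lin (mode_coeff l2 m2) x * lin (mode_coeff l3 m3) x)"
      unfolding sC neg_i_power_wigner3j by simp
    finally show ?thesis .
  qed
  then have "Ibisp C a l1 l2 l3 x = (\<Sum>m1\<in>{- int l1..int l1}. \<Sum>m2\<in>{- int l2..int l2}. \<Sum>m3\<in>{- int l3..int l3}.
     of_real ((-1) ^ ((l1 + l2 + l3) div 2) * signed_w3 (int l1) (int l2) (int l3) m1 m2 m3) *
       (lin (mode_coeff l1 m1) x * lin (mode_coeff l2 m2) x * lin (mode_coeff l3 m3) x))"
    unfolding Ibisp_def sum_distrib_left by (intro sum.cong refl) blast
  also have "\<dots> = (\<Sum>y\<in>mbox (level l1 l2 l3).
     of_real ((-1) ^ ((l1 + l2 + l3) div 2) * signed_w3 (int l1) (int l2) (int l3) (y 0) (y 1) (y 2)) *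
       (lin (mode_coeff l1 (y 0)) x * lin (mode_coeff l2 (y 1)) x * lin (mode_coeff l3 (y 2)) x))"
    using sum_mbox[of "\<lambda>m1 m2 m3. of_real ((-1) ^ ((l1 + l2 + l3) div 2) * signed_w3 (int l1) (int l2) (int l3) m1 m2 m3) *
       (lin (mode_coeff l1 m1) x * lin (mode_coeff l2 m2) x * lin (mode_coeff l3 m3) x)" "level l1 l2 l3"] unfolding level_simps by (rule sym)
  also have "\<dots> = (\<Sum>y\<in>mbox (level l1 l2 l3).
     of_real ((-1) ^ ((l1 + l2 + l3) div 2) * signed_w3 (int l1) (int l2) (int l3) (y 0) (y 1) (y 2)) *
     (\<Prod>i<3. lin (mode_coeff (level l1 l2 l3 i) (y i)) x))"
  proof -
    have "(\<Prod>i<3. lin (mode_coeff (level l1 l2 l3 i) (y i)) x) = lin (mode_coeff l1 (y 0)) x * lin (mode_coeff l2 (y 1)) x * lin (mode_coeff l3 (y 2)) x" for y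
      unfolding lessThan_3 by (simp add: level_simps mult_ac)
    then show ?thesis by (simp only:)
  qed
  finally show ?thesis .
qed

text \<open>Expanding the power assigns a label to every vertex; Wick's formula is applied to the
  half-edges for each assignment, and exchanging the sums over labels and pairings gives
  \<open>Z\<close>.\<close>

lemma expectation_network_power:
  fixes l :: "nat \<Rightarrow> nat" and T :: "(nat \<Rightarrow> int) \<Rightarrow> real" and V :: "'v set"
  assumes net: "cubic_network l T g" and l: "\<And>i. i < 3 \<Longrightarrow> 1 \<le> l i \<and> l i \<le> L" and V: "finite V"
  shows "expectation (\<lambda>x. (\<Sum>y\<in>mbox l. of_real (T y) * (\<Prod>i<3. lin (mode_coeff (l i) (y i)) x)) ^ card V) =
    of_real (cubic_network.Z l T V)"
proof -
  interpret N: cubic_network l T g by (rule net)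
  define c where "c m h = mode_coeff (l (snd h)) (m (fst h) (snd h))" for m :: "'v \<Rightarrow> nat \<Rightarrow> int" and h
  have e: "(\<Sum>y\<in>mbox l. of_real (T y) * (\<Prod>i<3. lin (mode_coeff (l i) (y i)) x)) ^ card V =
    (\<Sum>m\<in>PiE V (\<lambda>_. mbox l). of_real (\<Prod>v\<in>V. T (m v)) * (\<Prod>h\<in>V \<times> {..<3}. lin (c m h) x))" for x
  proof -
    have "(\<Sum>y\<in>mbox l. of_real (T y) * (\<Prod>i<3. lin (mode_coeff (l i) (y i)) x)) ^ card V =
      (\<Prod>v\<in>V. \<Sum>y\<in>mbox l. of_real (T y) * (\<Prod>i<3. lin (mode_coeff (l i) (y i)) x))" by simp
    also have "\<dots> = (\<Sum>m\<in>PiE V (\<lambda>_. mbox l). \<Prod>v\<in>V. of_real (T (m v)) * (\<Prod>i<3. lin (mode_coeff (l i) (m v i)) x))"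
      by (rule prod_sum_PiE) (use V finite_mbox in auto)
    also have "\<dots> = (\<Sum>m\<in>PiE V (\<lambda>_. mbox l). of_real (\<Prod>v\<in>V. T (m v)) * (\<Prod>h\<in>V \<times> {..<3}. lin (c m h) x))"
      by (simp add: prod.distrib c_def prod.cartesian_product case_prod_unfold)
    finally show ?thesis .
  qed
  have fH: "finite (V \<times> {..<3::nat})" using V by simp
  have w: "expectation (\<lambda>x. \<Prod>h\<in>V \<times> {..<3}. lin (c m h) x) = of_real (\<Sum>p\<in>pairings (V \<times> {..<3}). \<Prod>h\<in>V \<times> {..<3}. N.edge_weight m h (p h))"
    if m: "m \<in> PiE V (\<lambda>_. mbox l)" for m
  proof (rule wick[where c = "c m" and \<gamma> = "N.edge_weight m", OF fH])
    fix h h' :: "'v \<times> nat" assume h: "h \<in> V \<times> {..<3::nat}" "h' \<in> V \<times> {..<3}"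
    have "m (fst h) \<in> mbox l" using m h by auto
    then have "m (fst h) (snd h) \<in> {- int (l (snd h))..int (l (snd h))}"
      using PiE_mem[of "m (fst h)" "{..<3}" _ "snd h"] h unfolding mbox_def by auto
    then have lb: "1 \<le> l (snd h)" "l (snd h) \<le> L" "\<bar>m (fst h) (snd h)\<bar> \<le> int (l (snd h))"
      using l[of "snd h"] h(1) by auto
    show "(\<Sum>j\<in>modes L. c m h j * c m h' j) = of_real (N.edge_weight m h h')"
      unfolding c_def mode_coeff_covariance[OF lb] N.edge_weight_def by simp
  qed (auto simp: N.edge_weight_def)
  have "expectation (\<lambda>x. (\<Sum>y\<in>mbox l. of_real (T y) * (\<Prod>i<3. lin (mode_coeff (l i) (y i)) x)) ^ card V) =
    (\<Sum>m\<in>PiE V (\<lambda>_. mbox l). expectation (\<lambda>x. of_real (\<Prod>v\<in>V. T (m v)) * (\<Prod>h\<in>V \<times> {..<3}. lin (c m h) x)))"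
    unfolding e by (intro Bochner_Integration.integral_sum integrable_mult_right prod_lin_expectation(1)[OF fH])
  also have "\<dots> = (\<Sum>m\<in>PiE V (\<lambda>_. mbox l). of_real ((\<Prod>v\<in>V. T (m v)) * (\<Sum>p\<in>pairings (V \<times> {..<3}). \<Prod>h\<in>V \<times> {..<3}. N.edge_weight m h (p h))))"
  proof (rule sum.cong[OF refl])
    fix m assume "m \<in> PiE V (\<lambda>_. mbox l)"
    from w[OF this] show "expectation (\<lambda>x. of_real (\<Prod>v\<in>V. T (m v)) * (\<Prod>h\<in>V \<times> {..<3}. lin (c m h) x)) =
      of_real ((\<Prod>v\<in>V. T (m v)) * (\<Sum>p\<in>pairings (V \<times> {..<3}). \<Prod>h\<in>V \<times> {..<3}. N.edge_weight m h (p h)))"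
      by (simp only: integral_mult_right_zero of_real_mult)
  qed
  also have "\<dots> = of_real (\<Sum>m\<in>PiE V (\<lambda>_. mbox l). \<Sum>p\<in>pairings (V \<times> {..<3}). (\<Prod>v\<in>V. T (m v)) * (\<Prod>h\<in>V \<times> {..<3}. N.edge_weight m h (p h)))"
    by (simp only: of_real_sum sum_distrib_left)
  also have "(\<Sum>m\<in>PiE V (\<lambda>_. mbox l). \<Sum>p\<in>pairings (V \<times> {..<3}). (\<Prod>v\<in>V. T (m v)) * (\<Prod>h\<in>V \<times> {..<3}. N.edge_weight m h (p h))) = N.Z V"
    unfolding N.Z_def N.val_def by (rule sum.swap)
  finally show ?thesis .
qed

end

section \<open>From the network recursion to the moment bounds\<close>

text \<open>The moments are real because \<open>Z\<close> is. At \<open>n = 1\<close> the truncated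
  index \<open>n - 2\<close> is harmless, as its coefficient \<open>n - 1\<close> is 0.\<close>

lemma bispectrum_moments:
  assumes field: "isotropic_gaussian_coeffs M C a"
    and l: "1 \<le> l1" "l1 \<le> l2" "l2 \<le> l3" "l3 \<le> l1 + l2" "even (l1 + l2 + l3)"
  obtains e :: "nat \<Rightarrow> real"
  where "\<And>n. prob_space.expectation M (\<lambda>x. (Ibisp C a l1 l2 l3 x) ^ n) = of_real (e n)"
    and "e 0 = 1" and "e 2 = real (Delta3 l1 l2 l3)"
    and "\<And>n. 1 \<le> n \<Longrightarrow> \<bar>e n - real (n - 1) * real (Delta3 l1 l2 l3) * e (n - 2)\<bar>
           \<le> real (card (pairings ({..<n} \<times> {..<3::nat}))) * (1 / (2 * real l1 + 1))"
proof -
  \<comment> \<open>The largest level that occurs is \<open>l3\<close>, so truncating the modes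
    there suffices.\<close>
  interpret gaussian_coeffs M C a l3 by unfold_locales (rule field)
  let ?l = "level l1 l2 l3" and ?g = "1 / (2 * real l1 + 1)" and ?s = "(-1) ^ ((l1 + l2 + l3) div 2) :: real"
  define T :: "(nat \<Rightarrow> int) \<Rightarrow> real" where "T = (\<lambda>y. ?s * signed_w3 (int (?l 0)) (int (?l 1)) (int (?l 2)) (y 0) (y 1) (y 2))"
  have net: "cubic_network ?l T ?g"
    unfolding T_def
  proof (rule cubic_network_wigner[where l = ?l and L = l1 and s = ?s])
    show "w3_triangle (int (?l 0)) (int (?l 1)) (int (?l 2))" unfolding level_simps w3_triangle_def using l(1-4) by simp
    show "even (int (?l 0) + int (?l 1) + int (?l 2))" using l(5) unfolding level_simps by (simp flip: of_nat_add)
    show "l1 \<le> ?l i" for i using l(2,3) by (simp add: level_def)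
    show "?s\<^sup>2 = 1" by (simp flip: power_mult)
  qed (use l(1) in auto)
  interpret N: cubic_network ?l T ?g by (rule net)
  have EI: "expectation (\<lambda>x. (Ibisp C a l1 l2 l3 x) ^ card V) = of_real (N.Z V)" if "finite V" for V :: "nat set"
  proof -
    have "expectation (\<lambda>x. (Ibisp C a l1 l2 l3 x) ^ card V) =
      expectation (\<lambda>x. (\<Sum>y\<in>mbox ?l. of_real (T y) * (\<Prod>i<3. lin (mode_coeff (?l i) (y i)) x)) ^ card V)"
    proof (rule Bochner_Integration.integral_cong[OF refl])
      fix x assume "x \<in> space M"
      then show "(Ibisp C a l1 l2 l3 x) ^ card V = (\<Sum>y\<in>mbox ?l. of_real (T y) * (\<Prod>i<3. lin (mode_coeff (?l i) (y i)) x)) ^ card V"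
        using Ibisp_eq_lin[of l1 l2 l3 x] l(1-3) unfolding T_def level_simps by simp
    qed
    also have "\<dots> = of_real (N.Z V)"
      by (rule expectation_network_power[OF net _ that]) (use l(1-3) in \<open>simp add: level_def\<close>)
    finally show ?thesis .
  qed
  define e where "e n = N.Z {..<n::nat}" for n
  \<comment> \<open>Invariance of \<open>Z\<close> under renaming of vertices needs no
    combinatorics: \<open>Z V\<close> is a moment whose order is \<open>card V\<close>.\<close>
  have Ze: "N.Z V = e (card V)" if "finite V" for V :: "nat set"
  proof -
    have "complex_of_real (N.Z V) = of_real (e (card V))"
      unfolding e_def using EI[OF that] EI[of "{..<card V}"] by simp
    then show ?thesis by simp
  qed
  have aut: "real (card N.automorphisms) = real (Delta3 l1 l2 l3)"
    unfolding N.automorphisms_def using card_automorphisms[of l1 l2 l3] l by simp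
  have rec: "(\<Sum>w\<in>{..<n} - {0}. real (card N.automorphisms) * N.Z ({..<n} - {0, w})) =
     real (n - 1) * real (Delta3 l1 l2 l3) * e (n - 2)" if n: "1 \<le> n" for n
  proof -
    have "N.Z ({..<n} - {0, w}) = e (n - 2)" if w: "w \<in> {..<n} - {0}" for w
    proof -
      have "card ({..<n} - {0, w}) = n - 2" using w n by (subst card_Diff_subset) auto
      then show ?thesis using Ze[of "{..<n} - {0, w}"] by simp
    qed
    then have "(\<Sum>w\<in>{..<n} - {0}. real (card N.automorphisms) * N.Z ({..<n} - {0, w})) =
      (\<Sum>w\<in>{..<n} - {0}. real (Delta3 l1 l2 l3) * e (n - 2))" unfolding aut by simp
    also have "\<dots> = real (n - 1) * real (Delta3 l1 l2 l3) * e (n - 2)" using n by simp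
    finally show ?thesis .
  qed
  have E: "expectation (\<lambda>x. (Ibisp C a l1 l2 l3 x) ^ n) = of_real (e n)" for n
    using EI[of "{..<n}"] by (simp add: e_def)
  have e0: "e 0 = 1"
  proof -
    have "complex_of_real (e 0) = of_real 1" using E[of 0] by (simp add: prob_space)
    then show ?thesis by (simp only: of_real_eq_iff)
  qed
  show ?thesis
  proof (rule that[OF E e0])
    show "e 2 = real (Delta3 l1 l2 l3)"
      using N.Z_recursion(2)[of "{..<2}" 0] rec[of 2] e0 by (simp add: e_def)
    show "\<bar>e n - real (n - 1) * real (Delta3 l1 l2 l3) * e (n - 2)\<bar>
           \<le> real (card (pairings ({..<n} \<times> {..<3::nat}))) * ?g" if "1 \<le> n" for n
      using N.Z_recursion(1)[of "{..<n}" 0] rec[OF that] that by (simp add: e_def)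
  qed
qed

theorem theorem3p1:
  fixes M :: "'a measure" and C :: "nat \<Rightarrow> real" and a :: "nat \<Rightarrow> int \<Rightarrow> 'a \<Rightarrow> complex"
  assumes field: "isotropic_gaussian_coeffs M C a"
  shows "(\<forall>l1 l2 l3. 1 \<le> l1 \<and> l1 \<le> l2 \<and> l2 \<le> l3
            \<and> l1 \<le> l2 + l3 \<and> l2 \<le> l1 + l3 \<and> l3 \<le> l1 + l2 \<and> even (l1 + l2 + l3)
          \<longrightarrow> prob_space.expectation M (\<lambda>x. (Ibisp C a l1 l2 l3 x) ^ 2)
                = of_nat (Delta3 l1 l2 l3))
       \<and> (\<forall>p\<in>{2, 3, 4::nat}. \<exists>c::real. \<forall>l1 l2 l3. 1 \<le> l1 \<and> l1 \<le> l2 \<and> l2 \<le> l3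
            \<and> l1 \<le> l2 + l3 \<and> l2 \<le> l1 + l3 \<and> l3 \<le> l1 + l2 \<and> even (l1 + l2 + l3)
          \<longrightarrow> cmod (prob_space.expectation M (\<lambda>x. (Ibisp C a l1 l2 l3 x) ^ (2 * p))
                     - of_nat (odd_dfact p * Delta3 l1 l2 l3 ^ p)) \<le> c / real l1)"
proof (intro conjI allI impI)
  fix l1 l2 l3 :: nat
  assume l: "1 \<le> l1 \<and> l1 \<le> l2 \<and> l2 \<le> l3 \<and> l1 \<le> l2 + l3 \<and> l2 \<le> l1 + l3 \<and> l3 \<le> l1 + l2 \<and> even (l1 + l2 + l3)"
  obtain e :: "nat \<Rightarrow> real"
    where "\<And>n. prob_space.expectation M (\<lambda>x. (Ibisp C a l1 l2 l3 x) ^ n) = of_real (e n)"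
      and "e 2 = real (Delta3 l1 l2 l3)"
    by (rule bispectrum_moments[OF field, of l1 l2 l3]) (use l in blast)+
  then show "prob_space.expectation M (\<lambda>x. (Ibisp C a l1 l2 l3 x) ^ 2) = of_nat (Delta3 l1 l2 l3)"
    by (simp only: of_real_of_nat_eq)
next
  define N where "N n = real (card (pairings ({..<n::nat} \<times> {..<3::nat})))" for n
  \<comment> \<open>The main term solves the recursion exactly. The error of order
    \<open>2 p + 2\<close> is thus at most the new error, with constant
    \<open>N (2 * Suc p)\<close>, plus the previous error times \<open>(2 * p + 1) * Delta3\<close>,
    where \<open>Delta3 <= 6\<close>. The constants are chosen before any level is fixed.\<close>
  define c where "c = rec_nat 0 (\<lambda>p c. N (2 * Suc p) + real (2 * p + 1) * 6 * c)"
  have c_Suc: "c (Suc p) = N (2 * Suc p) + real (2 * p + 1) * 6 * c p" and c_0: "c 0 = 0" for p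
    by (simp_all add: c_def)
  have c_nonneg: "0 \<le> c p" for p
    by (induction p) (simp_all add: c_0 c_Suc N_def)
  show "\<forall>p\<in>{2, 3, 4::nat}. \<exists>c::real. \<forall>l1 l2 l3. 1 \<le> l1 \<and> l1 \<le> l2 \<and> l2 \<le> l3
            \<and> l1 \<le> l2 + l3 \<and> l2 \<le> l1 + l3 \<and> l3 \<le> l1 + l2 \<and> even (l1 + l2 + l3)
          \<longrightarrow> cmod (prob_space.expectation M (\<lambda>x. (Ibisp C a l1 l2 l3 x) ^ (2 * p))
                     - of_nat (odd_dfact p * Delta3 l1 l2 l3 ^ p)) \<le> c / real l1"
  proof (intro ballI exI allI impI)
    fix p l1 l2 l3 :: nat
    assume l: "1 \<le> l1 \<and> l1 \<le> l2 \<and> l2 \<le> l3 \<and> l1 \<le> l2 + l3 \<and> l2 \<le> l1 + l3 \<and> l3 \<le> l1 + l2 \<and> even (l1 + l2 + l3)"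
    define D where "D = real (Delta3 l1 l2 l3)"
    have D: "0 \<le> D" "D \<le> 6" by (auto simp: D_def Delta3_def)
    obtain e :: "nat \<Rightarrow> real"
      where E: "\<And>n. prob_space.expectation M (\<lambda>x. (Ibisp C a l1 l2 l3 x) ^ n) = of_real (e n)"
        and e0: "e 0 = 1"
        and step: "\<And>n. 1 \<le> n \<Longrightarrow> \<bar>e n - real (n - 1) * D * e (n - 2)\<bar> \<le> N n * (1 / (2 * real l1 + 1))"
      unfolding D_def N_def by (rule bispectrum_moments[OF field, of l1 l2 l3]) (use l in blast)+
    have bound: "\<bar>e (2 * p) - real (odd_dfact p) * D ^ p\<bar> \<le> c p * (1 / (2 * real l1 + 1))" for p
    proof (induction p)
      case 0
      then show ?case by (simp add: e0 c_0 odd_dfact_def)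
    next
      case (Suc p)
      let ?g = "1 / (2 * real l1 + 1)"
      have odd: "real (odd_dfact (Suc p)) = real (2 * p + 1) * real (odd_dfact p)"
        by (simp add: odd_dfact_def algebra_simps)
      have i: "2 * Suc p - 1 = 2 * p + 1" "2 * Suc p - 2 = 2 * p" by auto
      have "e (2 * Suc p) - real (odd_dfact (Suc p)) * D ^ Suc p =
        (e (2 * Suc p) - real (2 * p + 1) * D * e (2 * p)) + real (2 * p + 1) * D * (e (2 * p) - real (odd_dfact p) * D ^ p)"
        unfolding odd by (simp add: algebra_simps)
      also have "\<bar>\<dots>\<bar> \<le> \<bar>e (2 * Suc p) - real (2 * p + 1) * D * e (2 * p)\<bar> + real (2 * p + 1) * D * \<bar>e (2 * p) - real (odd_dfact p) * D ^ p\<bar>"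
        using D by (intro order_trans[OF abs_triangle_ineq]) (simp add: abs_mult)
      also have "\<dots> \<le> N (2 * Suc p) * ?g + real (2 * p + 1) * 6 * (c p * ?g)"
        using step[of "2 * Suc p"] Suc.IH D c_nonneg[of p] unfolding i by (intro add_mono mult_mono) auto
      also have "\<dots> = c (Suc p) * ?g" unfolding c_Suc by (simp only: distrib_right mult.assoc)
      finally show ?case .
    qed
    have "cmod (prob_space.expectation M (\<lambda>x. (Ibisp C a l1 l2 l3 x) ^ (2 * p)) - of_nat (odd_dfact p * Delta3 l1 l2 l3 ^ p))
      = cmod (of_real (e (2 * p) - real (odd_dfact p) * D ^ p))"
      unfolding E D_def by simp
    also have "\<dots> = \<bar>e (2 * p) - real (odd_dfact p) * D ^ p\<bar>" by (rule norm_of_real)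
    also have "\<dots> \<le> c p * (1 / (2 * real l1 + 1))" by (rule bound)
    also have "\<dots> \<le> c p * (1 / real l1)" using l c_nonneg[of p] by (intro mult_left_mono frac_le) auto
    finally show "cmod (prob_space.expectation M (\<lambda>x. (Ibisp C a l1 l2 l3 x) ^ (2 * p)) - of_nat (odd_dfact p * Delta3 l1 l2 l3 ^ p))
      \<le> c p / real l1" by simp
  qed
qed

end
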